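(* Let $\mathbf{A}\in\mathbb{R}^{n\times n}$ be positive semidefinite. Consider a corrupted matrix $\mathbf{B}=\mathbf{A}+\mathbf{N}$ with $\|\mathbf{N}\|_{\mathrm F}^2\le\eta\|\mathbf{A}\|_{\mathrm F}^2$ for some $\eta\in[0,1]$, and assume access to the diagonal corruption parameter $$\phi_{\max}=\max\Bigl\{1,\max_{1\le i\le n}\frac{\mathbf{A}_{ii}}{|\mathbf{B}_{ii}|}\Bigr\}.$$ Consider running the low-rank approximation algorithm described in the context, with target rank $k\in\{1,\dots,n\}$ and accuracy parameter $\epsilon\in(0,1)$, on the clipped matrix $\widetilde{\mathbf{B}}$, using the robust sampling subroutine described in the context to draw the column indices. This procedure returns matrices $\mathbf{X},\mathbf{Y}\in\mathbb{R}^{n\times k}$ such that, with probability at least $2/3$, $$\|\mathbf{A}-\mathbf{X}\mathbf{Y}^\top\|_{\mathrm F}^2\le\|\mathbf{A}-\mathbf{A}_k\|_{\mathrm F}^2+(\epsilon+9\sqrt\eta)\|\mathbf{A}\|_{\mathrm F}^2.$$ The algorithm queries $O\!\left(\frac{\phi_{\max}^2nk}{\epsilon^2}\right)$ entries of $\mathbf{B}$ and uses $O\!\left(n\left(\frac{k}{\epsilon^2}\right)^{\omega-1}+\frac{\phi_{\max}^2nk}{\epsilon^2}\right)$ arithmetic operations in expectation, where $\omega$ is the exponent of fast matrix multiplication.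
   Context: Rows and columns of a matrix $\mathbf{M}$ are $\mathbf{M}_{i,*}$ (a row vector) and $\mathbf{M}_{*,i}$; $\|\cdot\|$ is the Euclidean norm, $\|\cdot\|_{\mathrm F}$ the Frobenius norm; $\mathbf{A}_k$ is the best rank-$k$ approximation of $\mathbf{A}$ in Frobenius norm. A positive semidefinite matrix is a real symmetric matrix with $\mathbf{x}^\top\mathbf{A}\mathbf{x}\ge0$ for all $\mathbf{x}$. The matrix $\mathbf{B}$ is accessed by querying individual entries. Clipped matrix: $\widetilde{\mathbf{B}}_{ij}=\operatorname{clip}\bigl(\mathbf{B}_{ij};\phi_{\max}\sqrt{|\mathbf{B}_{ii}||\mathbf{B}_{jj}|}\bigr)$, where $\operatorname{clip}(x;a)$ equals $-a$ if $x<-a$, $x$ if $-a\le x\le a$, and $a$ if $x>a$. Robust sampling subroutine (stated purpose: output an index $I$ sampled from the length-squared distribution $\mathcal{L}(i)=\|\widetilde{\mathbf{B}}_{i,*}\|_2^2/\|\widetilde{\mathbf{B}}\|_{\mathrm F}^2$): let $D=\sum_i|\widetilde{\mathbf{B}}_{ii}|$ and $\mathcal{D}(i)=|\widetilde{\mathbf{B}}_{ii}|/D$; repeat: sample independent $I,J\sim\mathcal{D}$, and with probability $\widetilde{\mathbf{B}}_{IJ}^2/(\phi_{\max}^2|\widetilde{\mathbf{B}}_{II}||\widetilde{\mathbf{B}}_{JJ}|)$ return $I$. Low-rank approximation algorithm (applied to $\widetilde{\mathbf{B}}$). (1) Set $s=\lceil Ck/\epsilon^2\rceil$ and $t=\lceil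 C'k/\epsilon\rceil$ for sufficiently large absolute constants $C,C'>0$. (2) Run the robust sampling subroutine $s$ times to sample i.i.d. indices $I_1,\dots,I_s$. (3) Read the full columns $\widetilde{\mathbf{B}}_{*,I_1},\dots,\widetilde{\mathbf{B}}_{*,I_s}$ and form the $n\times s$ matrix with columns $\widetilde{\mathbf{B}}_{*,I_q}/\|\widetilde{\mathbf{B}}_{*,I_q}\|$. (4) Compute the top-$k$ left singular vectors $\mathbf{X}\in\mathbb{R}^{n\times k}$ of this matrix. (5) Let $\mathcal{S}(i)=\|\mathbf{X}_{i,*}\|^2/k$ and sample $J_1,\dots,J_t$ i.i.d. from $\mathcal{S}$. (6) Query the full rows $\widetilde{\mathbf{B}}_{J_1,*},\dots,\widetilde{\mathbf{B}}_{J_t,*}$ and set $\mathbf{Y}=\frac1t\sum_{r=1}^t\frac{\widetilde{\mathbf{B}}_{J_r,*}^\top\mathbf{X}_{J_r,*}}{\|\mathbf{X}_{J_r,*}\|^2/k}\in\mathbb{R}^{n\times k}$. (7) Return $\mathbf{X},\mathbf{Y}$. Computing the top-$k$ left singular vectors of an $n\times s$ matrix is counted as $O(ns^{\omega-1})$ arithmetic operations. *)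

theory Defs
  imports
    "HOL-Probability.Probability"
    "HOL-Probability.SPMF"
    "Jordan_Normal_Form.DL_Rank"
begin

section \<open>Matrices\<close>

text \<open>Matrices carry their dimensions at run time (\<open>carrier_mat n m\<close>), so that the constants in
  the theorem can be chosen uniformly in all dimensions. Indices start at 0.\<close>

definition psd_mat :: "real mat \<Rightarrow> bool" where
  "psd_mat A \<longleftrightarrow> square_mat A \<and> transpose_mat A = A \<and>
     (\<forall>x \<in> carrier_vec (dim_row A). 0 \<le> scalar_prod x (A *\<^sub>v x))"

definition euclid_norm :: "real vec \<Rightarrow> real" where
  "euclid_norm v = sqrt (scalar_prod v v)"

definition frob_norm :: "real mat \<Rightarrow> real" where
  "frob_norm A = sqrt (\<Sum>i<dim_row A. \<Sum>j<dim_col A. (A $$ (i, j))\<^sup>2)"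

definition best_rank_approx :: "nat \<Rightarrow> real mat \<Rightarrow> real mat \<Rightarrow> bool" where
  "best_rank_approx k A Ak \<longleftrightarrow>
     Ak \<in> carrier_mat (dim_row A) (dim_col A) \<and> vec_space.rank (dim_row A) Ak \<le> k \<and>
     (\<forall>M \<in> carrier_mat (dim_row A) (dim_col A).
        vec_space.rank (dim_row A) M \<le> k \<longrightarrow> frob_norm (A - Ak) \<le> frob_norm (A - M))"

definition is_svd :: "real mat \<Rightarrow> real mat \<Rightarrow> real mat \<Rightarrow> real mat \<Rightarrow> bool" where
  "is_svd M U S V \<longleftrightarrow>
     U \<in> carrier_mat (dim_row M) (dim_row M) \<and> transpose_mat U * U = 1\<^sub>m (dim_row M) \<and>
     V \<in> carrier_mat (dim_col M) (dim_col M) \<and> transpose_mat V * V = 1\<^sub>m (dim_col M) \<and>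
     S \<in> carrier_mat (dim_row M) (dim_col M) \<and>
     (\<forall>i < dim_row M. \<forall>j < dim_col M. i \<noteq> j \<longrightarrow> S $$ (i, j) = 0) \<and>
     (\<forall>i < min (dim_row M) (dim_col M). 0 \<le> S $$ (i, i)) \<and>
     (\<forall>i j. i \<le> j \<and> j < min (dim_row M) (dim_col M) \<longrightarrow> S $$ (j, j) \<le> S $$ (i, i)) \<and>
     M = U * S * transpose_mat V"

text \<open>Singular vectors are not unique; this relation holds for every admissible choice.\<close>

definition top_left_singular_vectors :: "nat \<Rightarrow> real mat \<Rightarrow> real mat \<Rightarrow> bool" where
  "top_left_singular_vectors k M X \<longleftrightarrow> k \<le> dim_row M \<and>
     (\<exists>U S V. is_svd M U S V \<and> X = mat (dim_row M) k (\<lambda>(i, j). U $$ (i, j)))"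

definition clip :: "real \<Rightarrow> real \<Rightarrow> real" where
  "clip x a = (if x < - a then - a else if x \<le> a then x else a)"

definition clipped_mat :: "real \<Rightarrow> real mat \<Rightarrow> real mat" where
  "clipped_mat \<phi> B = mat (dim_row B) (dim_col B)
     (\<lambda>(i, j). clip (B $$ (i, j)) (\<phi> * sqrt (\<bar>B $$ (i, i)\<bar> * \<bar>B $$ (j, j)\<bar>)))"

text \<open>For \<open>B $$ (i, i) = 0\<close> the quotient below is 0 in HOL. This is the intended value only if also
  \<open>A $$ (i, i) = 0\<close>; otherwise the parameter is infinite, which the theorem excludes.\<close>

definition phi_max :: "real mat \<Rightarrow> real mat \<Rightarrow> real" where
  "phi_max A B = max 1 (MAX i\<in>{..<dim_row A}. A $$ (i, i) / \<bar>B $$ (i, i)\<bar>)"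


section \<open>Randomized programs with query and operation counts\<close>

text \<open>A program is a subdistribution over triples (result, number of queried entries, number of
  arithmetic operations); the missing mass is the probability of nontermination. Repeated queries of
  one entry are counted each time.\<close>

type_synonym 'a prog = "('a \<times> nat \<times> nat) spmf"

definition ret :: "'a \<Rightarrow> 'a prog" where
  "ret x = return_spmf (x, 0, 0)"

definition bind_prog :: "'a prog \<Rightarrow> ('a \<Rightarrow> 'b prog) \<Rightarrow> 'b prog" where
  "bind_prog m f = bind_spmf m (\<lambda>(x, q, a). map_spmf (\<lambda>(y, q', a'). (y, q + q', a + a')) (f x))"

syntax
  "_run_prog" :: "pttrn \<Rightarrow> 'a \<Rightarrow> 'b \<Rightarrow> 'b"
    (\<open>(\<open>notation=\<open>mixfix run\<close>\<close>run _ \<leftarrow> _;//_)\<close> [0, 11, 10] 10)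
translations
  "run x \<leftarrow> m; p" \<rightleftharpoons> "CONST bind_prog m (\<lambda>x. p)"

lemma bind_prog_mono [partial_function_mono]:
  assumes "mono_spmf B" and "\<And>y. mono_spmf (\<lambda>f. C y f)"
  shows "mono_spmf (\<lambda>f. bind_prog (B f) (\<lambda>y. C y f))"
  unfolding bind_prog_def
proof (rule bind_spmf_mono[OF assms(1)])
  fix z :: "'c \<times> nat \<times> nat"
  obtain x q a where z: "z = (x, q, a)" by (cases z)
  show "mono_spmf (\<lambda>f. case z of (x, q, a) \<Rightarrow>
          map_spmf (\<lambda>(y, q', a'). (y, q + q', a + a')) (C x f))"
    unfolding z prod.case by (rule map_spmf_mono[OF assms(2)])
qed

primrec for_each :: "'a list \<Rightarrow> ('a \<Rightarrow> 'b prog) \<Rightarrow> 'b list prog" where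
  "for_each [] f = ret []"
| "for_each (x # xs) f = (run y \<leftarrow> f x; run ys \<leftarrow> for_each xs f; ret (y # ys))"

definition query :: "real mat \<Rightarrow> nat \<Rightarrow> nat \<Rightarrow> real prog" where
  "query B i j = return_spmf (B $$ (i, j), 1, 0)"

text \<open>\<open>charge c x\<close> delivers the value \<open>x\<close>, which is computed with at most \<open>c\<close> operations
  (additions, multiplications, divisions, square roots, absolute values, comparisons, roundings).\<close>

definition charge :: "nat \<Rightarrow> 'a \<Rightarrow> 'a prog" where
  "charge c x = return_spmf (x, 0, c)"

definition flip :: "real \<Rightarrow> bool prog" where
  "flip p = map_spmf (\<lambda>b. (b, 0, 1)) (spmf_of_pmf (bernoulli_pmf p))"

text \<open>Sampling from an explicit probability vector on \<open>{..<n}\<close>: as with the alias technique, building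
  the table costs a number of operations linear in \<open>n\<close>, after which each draw costs one.\<close>

definition table_pmf :: "nat \<Rightarrow> (nat \<Rightarrow> real) \<Rightarrow> nat pmf" where
  "table_pmf n p = embed_pmf (\<lambda>i. if i < n then p i else 0)"

definition make_table :: "nat \<Rightarrow> (nat \<Rightarrow> real) \<Rightarrow> nat pmf prog" where
  "make_table n p = charge n (table_pmf n p)"

definition draw :: "nat pmf \<Rightarrow> nat prog" where
  "draw D = map_spmf (\<lambda>i. (i, 0, 1)) (spmf_of_pmf D)"

text \<open>Operations for a \<open>p \<times> q\<close> by \<open>q \<times> r\<close> product that is cut into square blocks of side
  \<open>m = min p (min q r)\<close>, where \<open>mm_ops m\<close> counts the operations of one \<open>m \<times> m\<close> product and
  \<open>m\<^sup>2\<close> those for accumulating its result.\<close>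

definition rect_mult_ops :: "(nat \<Rightarrow> nat) \<Rightarrow> nat \<Rightarrow> nat \<Rightarrow> nat \<Rightarrow> nat" where
  "rect_mult_ops mm_ops p q r =
     (let m = min p (min q r); blocks = (\<lambda>x. nat \<lceil>real x / real m\<rceil>)
      in blocks p * blocks q * blocks r * (mm_ops m + m\<^sup>2))"

definition mult_prog :: "(nat \<Rightarrow> nat) \<Rightarrow> real mat \<Rightarrow> real mat \<Rightarrow> real mat prog" where
  "mult_prog mm_ops M L = charge (rect_mult_ops mm_ops (dim_row M) (dim_col M) (dim_col L)) (M * L)"


section \<open>The algorithm\<close>

text \<open>The programs see the input matrix only through the argument \<open>qry\<close>, resp. \<open>entry\<close>, that reads a
  single entry.\<close>

definition clipped_entry :: "(nat \<Rightarrow> nat \<Rightarrow> real prog) \<Rightarrow> real \<Rightarrow> nat \<Rightarrow> nat \<Rightarrow> real prog" where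
  "clipped_entry qry \<phi> i j =
     (run x \<leftarrow> qry i j;
      run y \<leftarrow> qry i i;
      run z \<leftarrow> qry j j;
      charge 8 (clip x (\<phi> * sqrt (\<bar>y\<bar> * \<bar>z\<bar>))))"

lemma clipped_entry_query:
  assumes "i < dim_row B" "j < dim_col B"
  shows "clipped_entry (query B) \<phi> i j = return_spmf (clipped_mat \<phi> B $$ (i, j), 3, 8)"
  using assms
  by (simp add: clipped_entry_def clipped_mat_def query_def charge_def bind_prog_def)

partial_function (spmf) rejection_loop ::
  "(nat \<Rightarrow> nat \<Rightarrow> real prog) \<Rightarrow> real \<Rightarrow> real list \<Rightarrow> nat pmf \<Rightarrow> nat prog" where
  "rejection_loop entry \<phi> dg D =
     (run I \<leftarrow> draw D;
      run J \<leftarrow> draw D;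
      run b \<leftarrow> entry I J;
      run p \<leftarrow> charge 7 (b\<^sup>2 / (\<phi>\<^sup>2 * \<bar>dg ! I\<bar> * \<bar>dg ! J\<bar>));
      run accept \<leftarrow> flip p;
      if accept then ret I else rejection_loop entry \<phi> dg D)"

text \<open>The proposal distribution is undefined if the diagonal vanishes. In the theorem this happens only
  for \<open>A = B = 0\<close>, and then the index 0 is returned.\<close>

definition robust_sample :: "(nat \<Rightarrow> nat \<Rightarrow> real prog) \<Rightarrow> real \<Rightarrow> nat \<Rightarrow> nat prog" where
  "robust_sample entry \<phi> n =
     (run dg \<leftarrow> for_each [0..<n] (\<lambda>i. entry i i);
      run d \<leftarrow> charge (2 * n) (\<Sum>i<n. \<bar>dg ! i\<bar>);
      run zero \<leftarrow> charge 1 (d = 0);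
      if zero then ret 0
      else (run p \<leftarrow> charge (2 * n) (\<lambda>i. \<bar>dg ! i\<bar> / d);
            run D \<leftarrow> make_table n p;
            rejection_loop entry \<phi> dg D))"

text \<open>\<open>svd k M\<close> yields the top \<open>k\<close> left singular vectors of \<open>M\<close>, and \<open>svd_ops n s\<close> is the number of
  operations counted for this if \<open>M\<close> is \<open>n \<times> s\<close>. A zero column (division by zero) stays zero when
  it is normalized. With \<open>R\<close> the matrix of the rows read in the last phase, the sum defining \<open>Y\<close> is
  the product of the transpose of \<open>R\<close> with the matrix \<open>Z\<close> of rescaled rows of \<open>X\<close>.\<close>

definition low_rank_approx ::
  "(nat \<Rightarrow> nat \<Rightarrow> real prog) \<Rightarrow> nat prog \<Rightarrow>
   (nat \<Rightarrow> real mat \<Rightarrow> real mat) \<Rightarrow> (nat \<Rightarrow> nat \<Rightarrow> nat) \<Rightarrow> (nat \<Rightarrow> nat) \<Rightarrow>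
   real \<Rightarrow> real \<Rightarrow> nat \<Rightarrow> nat \<Rightarrow> real \<Rightarrow> (real mat \<times> real mat) prog" where
  "low_rank_approx entry sampler svd svd_ops mm_ops C C' n k \<epsilon> =
     (run (s, t) \<leftarrow> charge 7 (nat \<lceil>C * real k / \<epsilon>\<^sup>2\<rceil>, nat \<lceil>C' * real k / \<epsilon>\<rceil>);
      run Is \<leftarrow> for_each [0..<s] (\<lambda>_. sampler);
      run cs \<leftarrow> for_each Is (\<lambda>j.
        (run es \<leftarrow> for_each [0..<n] (\<lambda>i. entry i j);
         charge (3 * n) ((1 / euclid_norm (vec_of_list es)) \<cdot>\<^sub>v vec_of_list es)));
      run X \<leftarrow> charge (svd_ops n s) (svd k (mat_of_cols n cs));
      run p \<leftarrow> charge (2 * n * k) (\<lambda>i. (euclid_norm (row X i))\<^sup>2 / real k);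
      run S \<leftarrow> make_table n p;
      run Js \<leftarrow> for_each [0..<t] (\<lambda>_. draw S);
      run rs \<leftarrow> for_each Js (\<lambda>i.
        (run es \<leftarrow> for_each [0..<n] (\<lambda>j. entry i j);
         ret (vec_of_list es)));
      run zs \<leftarrow> for_each Js (\<lambda>i.
        charge (3 * k) ((1 / ((euclid_norm (row X i))\<^sup>2 / real k)) \<cdot>\<^sub>v row X i));
      run P \<leftarrow> mult_prog mm_ops (transpose_mat (mat_of_rows n rs)) (mat_of_rows k zs);
      run Y \<leftarrow> charge (n * k) ((1 / real t) \<cdot>\<^sub>m P);
      ret (X, Y))"

definition robust_low_rank_approx ::
  "(nat \<Rightarrow> nat \<Rightarrow> real prog) \<Rightarrow> real \<Rightarrow>
   (nat \<Rightarrow> real mat \<Rightarrow> real mat) \<Rightarrow> (nat \<Rightarrow> nat \<Rightarrow> nat) \<Rightarrow> (nat \<Rightarrow> nat) \<Rightarrow>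
   real \<Rightarrow> real \<Rightarrow> nat \<Rightarrow> nat \<Rightarrow> real \<Rightarrow> (real mat \<times> real mat) prog" where
  "robust_low_rank_approx qry \<phi> svd svd_ops mm_ops C C' n k \<epsilon> =
     low_rank_approx (clipped_entry qry \<phi>) (robust_sample (clipped_entry qry \<phi>) \<phi> n)
       svd svd_ops mm_ops C C' n k \<epsilon>"

definition expected_queries :: "'a prog \<Rightarrow> ennreal" where
  "expected_queries m = (\<integral>\<^sup>+ (x, q, a). ennreal (real q) \<partial>measure_spmf m)"

definition expected_ops :: "'a prog \<Rightarrow> ennreal" where
  "expected_ops m = (\<integral>\<^sup>+ (x, q, a). ennreal (real a) \<partial>measure_spmf m)"

end

theory Submission
  imports Defs "Jordan_Normal_Form.Gram_Schmidt"
begin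

text \<open>Clipping projects each entry of \<open>B\<close> onto an interval that contains the entry of \<open>A\<close>, because
  \<open>A\<close> is positive semidefinite; so the clipped matrix \<open>b\<close> is no farther from \<open>A\<close> than \<open>B\<close> is. The error
  \<open>\<parallel>A - X Y\<^sup>T\<parallel>\<^sup>2\<close> splits orthogonally into \<open>\<parallel>A\<parallel>\<^sup>2 - \<parallel>X\<^sup>T A\<parallel>\<^sup>2\<close> and \<open>\<parallel>X\<^sup>T A - Y\<^sup>T\<parallel>\<^sup>2\<close>. The second part is
  the noise plus a sampling variance. In the first part \<open>X\<close> is compared with an orthonormal basis \<open>U\<close> of
  the column space of the best approximation: the difference of the two projections has norm at most 1,
  so \<open>A\<close> may be exchanged for the matrix that is really being sampled at a price linear in the noise,
  and on the sample itself \<open>X\<close> beats \<open>U\<close> by Ky Fan's principle. As \<open>B\<close> need not be symmetric, row and column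
  norms of \<open>b\<close> differ, which triples the noise; the constant 9 still suffices because for large noise
  the trivial bound \<open>\<parallel>X\<^sup>T A\<parallel>\<^sup>2 \<ge> 0\<close> is enough.

  A proposal is accepted with probability at least \<open>1 / (\<phi>\<^sup>2 n)\<close>, by the Cauchy-Schwarz inequality for the
  diagonal, which bounds the expected length of the rejection loop.\<close>


section \<open>Orthonormal families\<close>

text \<open>\<open>X\<close> is computed from the very columns that were sampled, so a concentration
  bound for one fixed subspace says nothing about the energy it captures. Instead the whole sum of
  outer products of the normalized columns is shown to be close to its mean in Frobenius norm. A
  projection onto at most \<open>k\<close> dimensions has Frobenius norm at most
  \<open>sqrt k\<close>, so Cauchy-Schwarz then controls the energies of all such subspaces at once,
  including those that depend on the sample. The relative error is of order
  \<open>sqrt (k / s)\<close>, which is why \<open>s\<close> is of order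
  \<open>k / \<epsilon>\<^sup>2\<close>. The rows are drawn when \<open>X\<close> is already fixed,
  and apart from a cross term with the noise their error enters squared, so \<open>t\<close> of
  order \<open>k / \<epsilon>\<close> suffices. The column phase succeeds with probability at least
  9/10, and so does the row phase after a good column phase; the product 81/100 exceeds 2/3.\<close>

definition ip :: "nat \<Rightarrow> (nat \<Rightarrow> real) \<Rightarrow> (nat \<Rightarrow> real) \<Rightarrow> real" where
  "ip n v w = (\<Sum>i<n. v i * w i)"

definition orthonormal :: "nat \<Rightarrow> nat \<Rightarrow> (nat \<Rightarrow> nat \<Rightarrow> real) \<Rightarrow> bool" where
  "orthonormal n k u \<longleftrightarrow> (\<forall>a<k. \<forall>b<k. ip n (u a) (u b) = (if a = b then 1 else 0))"

text \<open>For an orthonormal family this is the form of the orthogonal projection onto its span.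
  It is kept bilinear because the perturbation argument needs its mixed values.\<close>

definition proj_form :: "nat \<Rightarrow> nat \<Rightarrow> (nat \<Rightarrow> nat \<Rightarrow> real) \<Rightarrow> (nat \<Rightarrow> real) \<Rightarrow> (nat \<Rightarrow> real) \<Rightarrow> real" where
  "proj_form n k u v w = (\<Sum>a<k. ip n (u a) v * ip n (u a) w)"

lemma ip_commute: "ip n v w = ip n w v"
  by (simp add: ip_def mult.commute)

lemma ip_add_right: "ip n v (\<lambda>i. w i + x i) = ip n v w + ip n v x"
  by (simp add: ip_def algebra_simps sum.distrib)

lemma ip_diff_right: "ip n v (\<lambda>i. w i - x i) = ip n v w - ip n v x"
  by (simp add: ip_def algebra_simps sum_subtractf)

lemma ip_scale_right: "ip n v (\<lambda>i. c * w i) = c * ip n v w"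
  by (simp add: ip_def algebra_simps sum_distrib_left)

lemma ip_sum_right: "ip n v (\<lambda>i. \<Sum>a\<in>A. w a i) = (\<Sum>a\<in>A. ip n v (w a))"
  unfolding ip_def sum_distrib_left by (rule sum.swap)

lemma ip_add_left: "ip n (\<lambda>i. w i + x i) v = ip n w v + ip n x v"
  by (simp add: ip_def algebra_simps sum.distrib)

lemma ip_diff_left: "ip n (\<lambda>i. w i - x i) v = ip n w v - ip n x v"
  by (simp add: ip_def algebra_simps sum_subtractf)

lemma ip_scale_left: "ip n (\<lambda>i. c * w i) v = c * ip n w v"
  by (simp add: ip_def algebra_simps sum_distrib_left)

lemma ip_sum_left: "ip n (\<lambda>i. \<Sum>a\<in>A. w a i) v = (\<Sum>a\<in>A. ip n (w a) v)"
  unfolding ip_def sum_distrib_right by (rule sum.swap)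

lemma ip_self: "ip n v v = (\<Sum>i<n. (v i)\<^sup>2)"
  by (simp add: ip_def power2_eq_square)

lemma ip_self_nonneg: "0 \<le> ip n v v"
  by (simp add: ip_self sum_nonneg)

lemma proj_form_self: "proj_form n k u v v = (\<Sum>a<k. (ip n (u a) v)\<^sup>2)"
  by (simp add: proj_form_def power2_eq_square)

lemma proj_form_self_nonneg: "0 \<le> proj_form n k u v v"
  by (simp add: proj_form_self sum_nonneg)

lemma orthonormal_ip: "orthonormal n k u \<Longrightarrow> a < k \<Longrightarrow> b < k \<Longrightarrow> ip n (u a) (u b) = (if a = b then 1 else 0)"
  by (simp add: orthonormal_def)

text \<open>Pythagoras: a residual splits into the distance of \<open>v\<close> from the span and
  the deviation of the coefficients \<open>y\<close> from the optimal ones. With arbitrary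
  \<open>y\<close> it serves both the low-rank competitor, where the second part is dropped, and the
  output \<open>Y\<close>, where that part is the error to be estimated.\<close>

lemma ip_residual:
  assumes "orthonormal n k u"
  shows "(\<Sum>i<n. (v i - (\<Sum>a<k. u a i * y a))\<^sup>2)
    = ip n v v - proj_form n k u v v + (\<Sum>a<k. (ip n (u a) v - y a)\<^sup>2)"
proof -
  let ?c = "\<lambda>i. \<Sum>a<k. y a * u a i"
  have uc: "ip n (u a) ?c = y a" if "a < k" for a
  proof -
    have "ip n (u a) ?c = (\<Sum>b<k. y b * ip n (u a) (u b))"
      by (simp add: ip_sum_right ip_scale_right)
    also have "\<dots> = (\<Sum>b<k. if a = b then y b else 0)"
      using that assms by (intro sum.cong) (auto simp: orthonormal_def)
    finally show ?thesis using that by simp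
  qed
  have cv: "ip n ?c v = (\<Sum>a<k. y a * ip n (u a) v)"
    by (simp add: ip_sum_left ip_scale_left)
  have cc: "ip n ?c ?c = (\<Sum>a<k. y a * y a)"
    by (subst ip_sum_left) (simp add: ip_scale_left uc)
  have "(\<Sum>i<n. (v i - (\<Sum>a<k. u a i * y a))\<^sup>2) = ip n (\<lambda>i. v i - ?c i) (\<lambda>i. v i - ?c i)"
    by (simp add: ip_self mult.commute)
  also have "\<dots> = ip n v v - 2 * ip n ?c v + ip n ?c ?c"
    by (simp add: ip_diff_left ip_diff_right ip_commute[of n v ?c])
  also have "\<dots> = ip n v v - proj_form n k u v v + (\<Sum>a<k. (ip n (u a) v - y a)\<^sup>2)"
  proof -
    have "(\<Sum>a<k. (ip n (u a) v - y a)\<^sup>2)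
      = (\<Sum>a<k. (ip n (u a) v)\<^sup>2 - 2 * (y a * ip n (u a) v) + y a * y a)"
      by (intro sum.cong refl) (simp add: power2_eq_square algebra_simps)
    then show ?thesis unfolding cv cc proj_form_self
      by (simp add: sum.distrib sum_subtractf sum_distrib_left)
  qed
  finally show ?thesis .
qed

lemma bessel:
  assumes "orthonormal n k u"
  shows "proj_form n k u v v \<le> ip n v v"
proof -
  have "0 \<le> (\<Sum>i<n. (v i - (\<Sum>a<k. u a i * ip n (u a) v))\<^sup>2)"
    by (intro sum_nonneg) simp
  then show ?thesis by (simp add: ip_residual[OF assms])
qed

section \<open>Differences of projections\<close>

lemma proj_form_add_scaled:
  "proj_form n k u (\<lambda>i. c * v i + w i) (\<lambda>i. c * v i + w i)
   = c\<^sup>2 * proj_form n k u v v + 2 * c * proj_form n k u v w + proj_form n k u w w"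
  by (simp add: proj_form_def ip_add_right ip_scale_right algebra_simps sum.distrib
      sum_distrib_left power2_eq_square)

text \<open>A quadratic polynomial in \<open>c\<close> without negative values has discriminant at
  most 0. This gives Cauchy-Schwarz for the indefinite difference of two projections as well as the
  bound on the off-diagonal entries of a positive semidefinite matrix.\<close>

lemma quadratic_bound:
  fixes V W b :: real
  assumes "0 \<le> V" and le: "\<And>c. 2 * c * b \<le> c\<^sup>2 * V + W"
  shows "b\<^sup>2 \<le> V * W"
proof (cases "V = 0")
  case True
  have "b = 0"
  proof (rule ccontr)
    assume "b \<noteq> 0"
    \<comment> \<open>With \<open>V = 0\<close> this choice of \<open>c\<close> makes the left side
      of the hypothesis \<open>W + 1\<close>.\<close>
    with le[of "(W + 1) / (2 * b)"] True show False by simp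
  qed
  with True show ?thesis by simp
next
  case False
  with \<open>0 \<le> V\<close> have "0 < V" by simp
  have "2 * (b / V) * b \<le> (b / V)\<^sup>2 * V + W" by (rule le)
  with \<open>0 < V\<close> show ?thesis by (simp add: field_simps power2_eq_square)
qed

text \<open>A difference of two orthogonal projections has operator norm at most 1.\<close>

lemma proj_form_diff_bound:
  assumes u: "orthonormal n k u" and x: "orthonormal n l x"
  shows "(\<Sum>j<m. proj_form n k u (v j) (w j) - proj_form n l x (v j) (w j))\<^sup>2
    \<le> (\<Sum>j<m. ip n (v j) (v j)) * (\<Sum>j<m. ip n (w j) (w j))"
proof (rule quadratic_bound)
  show "0 \<le> (\<Sum>j<m. ip n (v j) (v j))" by (intro sum_nonneg ip_self_nonneg)
next
  fix c :: real
  let ?d = "\<lambda>v w. proj_form n k u v w - proj_form n l x v w"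
  have abs: "\<bar>?d z z\<bar> \<le> ip n z z" for z
    using bessel[OF u, of z] bessel[OF x, of z] proj_form_self_nonneg[of n k u z]
      proj_form_self_nonneg[of n l x z] by (simp add: abs_le_iff)
  \<comment> \<open>Polarization: the difference of the quadratic form at \<open>c v + w\<close> and
    \<open>- c v + w\<close> is four times the mixed term, while by the parallelogram law the
    squared norms of these two vectors add up to twice the right side.\<close>
  have step: "2 * c * ?d (v j) (w j) \<le> c\<^sup>2 * ip n (v j) (v j) + ip n (w j) (w j)" for j
  proof -
    let ?p = "\<lambda>c i. c * v j i + w j i"
    have "?d (?p c) (?p c) \<le> ip n (?p c) (?p c)" "- ?d (?p (- c)) (?p (- c)) \<le> ip n (?p (- c)) (?p (- c))"
      using abs[of "?p c"] abs[of "?p (-c)"] by (simp_all only: abs_le_iff)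
    moreover have "?d (?p c) (?p c) - ?d (?p (- c)) (?p (- c)) = 4 * (c * ?d (v j) (w j))"
      unfolding proj_form_add_scaled by (simp add: algebra_simps)
    moreover have ipp: "ip n (?p e) (?p e) = e\<^sup>2 * ip n (v j) (v j) + 2 * (e * ip n (v j) (w j)) + ip n (w j) (w j)" for e
      by (simp add: ip_add_left ip_add_right ip_scale_left ip_scale_right ip_commute[of n "w j" "v j"]
          power2_eq_square algebra_simps)
    moreover have "ip n (?p (- c)) (?p (- c)) = c\<^sup>2 * ip n (v j) (v j) - 2 * (c * ip n (v j) (w j)) + ip n (w j) (w j)"
      unfolding ipp by simp
    ultimately have "2 * (c * ?d (v j) (w j)) \<le> c\<^sup>2 * ip n (v j) (v j) + ip n (w j) (w j)"
      using ipp[of c] by linarith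
    then show ?thesis by (simp only: mult.assoc)
  qed
  have "2 * c * (\<Sum>j<m. ?d (v j) (w j)) = (\<Sum>j<m. 2 * c * ?d (v j) (w j))"
    by (simp only: sum_distrib_left)
  also have "\<dots> \<le> (\<Sum>j<m. c\<^sup>2 * ip n (v j) (v j) + ip n (w j) (w j))"
    by (intro sum_mono step)
  also have "\<dots> = c\<^sup>2 * (\<Sum>j<m. ip n (v j) (v j)) + (\<Sum>j<m. ip n (w j) (w j))"
    by (simp only: sum.distrib sum_distrib_left)
  finally show "2 * c * (\<Sum>j<m. ?d (v j) (w j))
    \<le> c\<^sup>2 * (\<Sum>j<m. ip n (v j) (v j)) + (\<Sum>j<m. ip n (w j) (w j))" .
qed

lemma proj_form_difference:
  "proj_form n k u v v - proj_form n k u w w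
   = proj_form n k u (\<lambda>i. v i - w i) (\<lambda>i. v i + w i)"
  unfolding proj_form_def ip_diff_right ip_add_right
  by (simp add: algebra_simps sum.distrib sum_subtractf)

text \<open>The double sum is the squared Frobenius norm of the projection matrix; after exchanging
  the order of summation it becomes that of the Gram matrix of \<open>u\<close>, which is the
  identity of size \<open>k\<close>.\<close>

lemma gram_frobenius:
  assumes "orthonormal n k u"
  shows "(\<Sum>x<n. \<Sum>y<n. (\<Sum>a<k. u a x * u a y)\<^sup>2) = real k"
proof -
  have "(\<Sum>x<n. \<Sum>y<n. (\<Sum>a<k. u a x * u a y)\<^sup>2)
    = (\<Sum>x<n. \<Sum>y<n. \<Sum>a<k. \<Sum>b<k. (u a x * u b x) * (u a y * u b y))"
    by (simp add: power2_eq_square sum_product algebra_simps)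
  also have "\<dots> = (\<Sum>x<n. \<Sum>a<k. \<Sum>b<k. \<Sum>y<n. (u a x * u b x) * (u a y * u b y))"
    by (simp add: sum.swap[of _ "{..<k}" "{..<n}"])
  also have "\<dots> = (\<Sum>x<n. \<Sum>a<k. \<Sum>b<k. (u a x * u b x) * ip n (u a) (u b))"
    by (simp add: ip_def sum_distrib_left)
  also have "\<dots> = (\<Sum>a<k. \<Sum>b<k. \<Sum>x<n. (u a x * u b x) * ip n (u a) (u b))"
    by (simp add: sum.swap[of _ "{..<k}" "{..<n}"])
  also have "\<dots> = (\<Sum>a<k. \<Sum>b<k. ip n (u a) (u b) * ip n (u a) (u b))"
    by (simp add: ip_def sum_distrib_right)
  also have "\<dots> = (\<Sum>a<k. \<Sum>b<k. if a = b then 1 else 0)"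
    using assms by (intro sum.cong) (auto simp: orthonormal_def)
  finally show ?thesis by simp
qed

text \<open>The energy of \<open>v\<close> becomes linear in the outer product of \<open>v\<close>
  with itself, so sums and expectations over random \<open>v\<close> can be moved onto that outer
  product.\<close>

lemma sum_squared_gram:
  "(\<Sum>a<k. (ip n (u a) v)\<^sup>2) = (\<Sum>x<n. \<Sum>y<n. (\<Sum>a<k. u a x * u a y) * (v x * v y))"
proof -
  have "(\<Sum>a<k. (ip n (u a) v)\<^sup>2) = (\<Sum>a<k. \<Sum>x<n. \<Sum>y<n. (u a x * u a y) * (v x * v y))"
    by (simp add: ip_def power2_eq_square sum_product algebra_simps)
  also have "\<dots> = (\<Sum>x<n. \<Sum>y<n. \<Sum>a<k. (u a x * u a y) * (v x * v y))"
    by (simp add: sum.swap[of _ "{..<n}" "{..<k}"])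
  finally show ?thesis by (simp add: sum_distrib_right)
qed


section \<open>Singular vectors and low-rank matrices\<close>

text \<open>Weights in [0, 1] with total at most \<open>k\<close> do best on the \<open>k\<close>
  largest values. With the threshold \<open>l (k - 1)\<close>, moving the weights to the first
  \<open>k\<close> positions never loses, because \<open>l i - l (k - 1)\<close> and the change of
  weight at \<open>i\<close> have the same sign.\<close>

lemma sum_top_weights_le:
  fixes l c :: "nat \<Rightarrow> real"
  assumes "1 \<le> k" "k \<le> n" and mono: "\<And>i j. i \<le> j \<Longrightarrow> l j \<le> l i" and nonneg: "\<And>i. 0 \<le> l i"
    and c: "\<And>i. i < n \<Longrightarrow> 0 \<le> c i \<and> c i \<le> 1" and sum_c: "(\<Sum>i<n. c i) \<le> real k"
  shows "(\<Sum>i<n. l i * c i) \<le> (\<Sum>i<k. l i)"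
proof -
  let ?b = "\<lambda>i. if i < k then 1 else 0 :: real"
  have b: "(\<Sum>i<n. l i * ?b i) = (\<Sum>i<k. l i)" for l :: "nat \<Rightarrow> real"
  proof -
    have "(\<Sum>i<n. l i * ?b i) = (\<Sum>i\<in>{..<n} \<inter> {i. i < k}. l i)"
      by (subst sum.inter_restrict) (auto intro!: sum.cong)
    also have "{..<n} \<inter> {i. i < k} = {..<k}" using \<open>k \<le> n\<close> by auto
    finally show ?thesis .
  qed
  have "0 \<le> (\<Sum>i<n. (l i - l (k - 1)) * (?b i - c i))"
  proof (intro sum_nonneg)
    fix i assume "i \<in> {..<n}"
    then have ci: "0 \<le> c i" "c i \<le> 1" using c by auto
    show "0 \<le> (l i - l (k - 1)) * (?b i - c i)"
    proof (cases "i < k")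
      case True
      then have "l (k - 1) \<le> l i" by (intro mono) simp
      then show ?thesis using True ci by simp
    next
      case False
      then have "l i \<le> l (k - 1)" by (intro mono) simp
      then show ?thesis using False ci by (simp add: mult_nonpos_nonneg)
    qed
  qed
  also have "\<dots> = (\<Sum>i<k. l i) - (\<Sum>i<n. l i * c i) - l (k - 1) * (real k - (\<Sum>i<n. c i))"
  proof -
    have "(\<Sum>i<n. (l i - l (k - 1)) * (?b i - c i))
      = (\<Sum>i<n. l i * ?b i) - (\<Sum>i<n. l i * c i)
        - ((\<Sum>i<n. l (k - 1) * ?b i) - l (k - 1) * (\<Sum>i<n. c i))"
      by (simp only: left_diff_distrib right_diff_distrib sum_subtractf sum_distrib_left)
    then show ?thesis using b[of l] b[of "\<lambda>_. l (k - 1)"] by (simp add: algebra_simps)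
  qed
  finally show ?thesis using mult_nonneg_nonneg[OF nonneg[of "k - 1"], of "real k - (\<Sum>i<n. c i)"] sum_c
    by linarith
qed

section \<open>Ky Fan's principle for top left singular vectors\<close>

lemma mult_mat_entry:
  assumes "P \<in> carrier_mat n m" "Q \<in> carrier_mat m p" "i < n" "j < p"
  shows "(P * Q) $$ (i, j) = (\<Sum>a<m. P $$ (i, a) * Q $$ (a, j))"
  using assms by (auto simp: scalar_prod_def atLeast0LessThan)

lemma orthonormal_columns:
  assumes "U \<in> carrier_mat n m" and "transpose_mat U * U = 1\<^sub>m m" and "k \<le> m"
  shows "orthonormal n k (\<lambda>a i. U $$ (i, a))"
  unfolding orthonormal_def
proof (intro allI impI)
  fix a b assume "a < k" "b < k"
  then have ab: "a < m" "b < m" using \<open>k \<le> m\<close> by auto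
  have "(transpose_mat U * U) $$ (a, b) = (\<Sum>i<n. U $$ (i, a) * U $$ (i, b))"
    using ab assms(1) by (auto simp: scalar_prod_def atLeast0LessThan)
  then show "ip n (\<lambda>i. U $$ (i, a)) (\<lambda>i. U $$ (i, b)) = (if a = b then 1 else 0)"
    using ab unfolding assms(2) by (simp add: ip_def)
qed

lemma top_left_singular_vectors_carrier:
  "top_left_singular_vectors k M X \<Longrightarrow> X \<in> carrier_mat (dim_row M) k"
  by (auto simp: top_left_singular_vectors_def)

lemma top_left_singular_vectors_orthonormal:
  assumes "top_left_singular_vectors k M X"
  shows "orthonormal (dim_row M) k (\<lambda>a i. X $$ (i, a))"
proof -
  obtain U S V where svd: "is_svd M U S V" and k: "k \<le> dim_row M"
    and X: "X = mat (dim_row M) k (\<lambda>(i, j). U $$ (i, j))"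
    using assms by (auto simp: top_left_singular_vectors_def)
  have "U \<in> carrier_mat (dim_row M) (dim_row M)" "transpose_mat U * U = 1\<^sub>m (dim_row M)"
    using svd unfolding is_svd_def by blast+
  then have "orthonormal (dim_row M) k (\<lambda>a i. U $$ (i, a))"
    using k by (rule orthonormal_columns)
  then show ?thesis by (simp add: orthonormal_def ip_def X)
qed

text \<open>In the basis of left singular vectors the energy captured by \<open>w\<close> is a
  weighted sum of the squared singular values. Bessel's inequality for \<open>w\<close> bounds each
  weight by 1, and Bessel's inequality for the singular vectors bounds their total by
  \<open>l\<close>. The family \<open>w\<close> may have fewer than \<open>k\<close> members because
  it will come from a matrix whose rank can be below \<open>k\<close>.\<close>

lemma ky_fan:
  assumes svd: "top_left_singular_vectors k M X" and "1 \<le> k" and "l \<le> k"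
    and w: "orthonormal (dim_row M) l w"
  defines "cl j \<equiv> \<lambda>i. M $$ (i, j)"
  shows "(\<Sum>j<dim_col M. proj_form (dim_row M) l w (cl j) (cl j))
    \<le> (\<Sum>j<dim_col M. proj_form (dim_row M) k (\<lambda>a i. X $$ (i, a)) (cl j) (cl j))"
proof -
  let ?n = "dim_row M" and ?s = "dim_col M"
  obtain U S V where "is_svd M U S V" and k: "k \<le> ?n"
    and X: "X = mat ?n k (\<lambda>(i, j). U $$ (i, j))"
    using svd by (auto simp: top_left_singular_vectors_def)
  note svd' = \<open>is_svd M U S V\<close>[unfolded is_svd_def]
  have U: "U \<in> carrier_mat ?n ?n" "transpose_mat U * U = 1\<^sub>m ?n"
    and V: "V \<in> carrier_mat ?s ?s" "transpose_mat V * V = 1\<^sub>m ?s"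
    and S1: "S \<in> carrier_mat ?n ?s" and M: "M = U * S * transpose_mat V"
    using svd' by - (elim conjE, assumption)+
  have S2: "\<forall>i<?n. \<forall>j<?s. i \<noteq> j \<longrightarrow> S $$ (i, j) = 0"
    and S3: "\<forall>i<min ?n ?s. 0 \<le> S $$ (i, i)"
    and S4: "\<forall>i j. i \<le> j \<and> j < min ?n ?s \<longrightarrow> S $$ (j, j) \<le> S $$ (i, i)"
    using svd' by - (elim conjE, assumption)+
  define u where "u = (\<lambda>a i. U $$ (i, a))"
  \<comment> \<open>Padding with 0 gives every left singular vector a weight, also when
    \<open>M\<close> has fewer columns than rows.\<close>
  define lam where "lam i = (if i < min ?n ?s then (S $$ (i, i))\<^sup>2 else 0)" for i
  define T where "T i j = (if i < min ?n ?s then S $$ (i, i) * V $$ (j, i) else 0)" for i j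
  have u: "orthonormal ?n ?n u"
    unfolding u_def using U by (intro orthonormal_columns) auto
  have v: "orthonormal ?s ?s (\<lambda>a i. V $$ (i, a))"
    using V by (intro orthonormal_columns) auto
  have T: "(S * transpose_mat V) $$ (i, j) = T i j" if "i < ?n" "j < ?s" for i j
  proof -
    have "(S * transpose_mat V) $$ (i, j) = (\<Sum>q<?s. S $$ (i, q) * V $$ (j, q))"
      using that S1 V(1) by (auto simp: scalar_prod_def atLeast0LessThan)
    also have "\<dots> = (\<Sum>q<?s. if i = q then S $$ (i, i) * V $$ (j, i) else 0)"
      using that S2 by (intro sum.cong) auto
    also have "\<dots> = T i j" using that by (auto simp: T_def)
    finally show ?thesis .
  qed
  have M': "M = U * (S * transpose_mat V)"
    using assoc_mult_mat[OF U(1) S1, of "transpose_mat V" ?s] V(1) M by (metis transpose_carrier_mat)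
  have M_ent: "M $$ (i, j) = (\<Sum>a<?n. T a j * u a i)" if "i < ?n" "j < ?s" for i j
  proof -
    have "(U * (S * transpose_mat V)) $$ (i, j) = (\<Sum>a<?n. U $$ (i, a) * (S * transpose_mat V) $$ (a, j))"
      using that U(1) S1 V(1) by (intro mult_mat_entry[where p="?s"]) auto
    then have "M $$ (i, j) = (\<Sum>a<?n. U $$ (i, a) * (S * transpose_mat V) $$ (a, j))"
      by (rule trans[OF arg_cong[OF M', of "\<lambda>Z. Z $$ (i, j)"]])
    then show ?thesis using that by (simp add: T u_def mult.commute)
  qed
  have TT: "(\<Sum>j<?s. T a j * T b j) = (if a = b then lam a else 0)" for a b
  proof (cases "a < min ?n ?s \<and> b < min ?n ?s")
    case True
    have "(\<Sum>j<?s. T a j * T b j) = S $$ (a, a) * S $$ (b, b) * ip ?s (\<lambda>j. V $$ (j, a)) (\<lambda>j. V $$ (j, b))"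
      using True by (simp add: T_def ip_def sum_distrib_left algebra_simps)
    then show ?thesis using True orthonormal_ip[OF v, of a b] by (simp add: lam_def power2_eq_square)
  next
    case False
    then have "T a j * T b j = 0" for j by (auto simp: T_def)
    moreover have "a = b \<Longrightarrow> lam a = 0" using False by (auto simp: lam_def)
    ultimately show ?thesis by simp
  qed
  have ipz: "ip ?n z (cl j) = (\<Sum>a<?n. T a j * ip ?n z (u a))" if "j < ?s" for z j
  proof -
    have "ip ?n z (cl j) = ip ?n z (\<lambda>i. \<Sum>a<?n. T a j * u a i)"
      unfolding ip_def cl_def by (intro sum.cong refl) (simp only: M_ent[OF _ that] lessThan_iff)
    then show ?thesis by (simp add: ip_sum_right ip_scale_right)
  qed
  \<comment> \<open>By \<open>TT\<close> the rows of \<open>S\<close> times the transpose of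
    \<open>V\<close> are orthogonal, so all cross terms disappear.\<close>
  have energy: "(\<Sum>j<?s. (ip ?n z (cl j))\<^sup>2) = (\<Sum>a<?n. lam a * (ip ?n z (u a))\<^sup>2)" for z
  proof -
    have "(\<Sum>j<?s. (ip ?n z (cl j))\<^sup>2)
      = (\<Sum>j<?s. \<Sum>a<?n. \<Sum>b<?n. (ip ?n z (u a) * ip ?n z (u b)) * (T a j * T b j))"
      by (intro sum.cong refl) (simp add: ipz power2_eq_square sum_product algebra_simps)
    also have "\<dots> = (\<Sum>a<?n. \<Sum>b<?n. (ip ?n z (u a) * ip ?n z (u b)) * (\<Sum>j<?s. T a j * T b j))"
      by (simp add: sum.swap[of _ "{..<?n}" "{..<?s}"] sum_distrib_left)
    also have "\<dots> = (\<Sum>a<?n. \<Sum>b<?n. if a = b then lam a * (ip ?n z (u a))\<^sup>2 else 0)"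
      unfolding TT by (intro sum.cong refl) (simp add: power2_eq_square)
    finally show ?thesis by simp
  qed
  have swap: "(\<Sum>j<?s. proj_form ?n k' y (cl j) (cl j)) = (\<Sum>a<?n. lam a * (\<Sum>b<k'. (ip ?n (y b) (u a))\<^sup>2))"
    for k' y
  proof -
    have "(\<Sum>j<?s. proj_form ?n k' y (cl j) (cl j)) = (\<Sum>b<k'. \<Sum>j<?s. (ip ?n (y b) (cl j))\<^sup>2)"
      by (simp add: proj_form_self sum.swap[of _ "{..<k'}"])
    also have "\<dots> = (\<Sum>a<?n. lam a * (\<Sum>b<k'. (ip ?n (y b) (u a))\<^sup>2))"
      unfolding energy by (simp add: sum.swap[of _ "{..<k'}"] sum_distrib_left)
    finally show ?thesis .
  qed
  have c: "(\<Sum>b<l. (ip ?n (w b) (u a))\<^sup>2) \<le> 1" if "a < ?n" for a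
    using bessel[OF w, of "u a"] orthonormal_ip[OF u that that] by (simp add: proj_form_self)
  have "(\<Sum>a<?n. \<Sum>b<l. (ip ?n (w b) (u a))\<^sup>2) = (\<Sum>b<l. proj_form ?n ?n u (w b) (w b))"
    by (simp add: proj_form_self sum.swap[of _ "{..<?n}"] ip_commute[of _ "w _" "u _"])
  also have "\<dots> \<le> (\<Sum>b<l. ip ?n (w b) (w b))"
    by (intro sum_mono bessel[OF u])
  also have "\<dots> = real l" using orthonormal_ip[OF w] by simp
  finally have csum: "(\<Sum>a<?n. \<Sum>b<l. (ip ?n (w b) (u a))\<^sup>2) \<le> real k" using \<open>l \<le> k\<close> by simp
  have "(\<Sum>j<?s. proj_form ?n l w (cl j) (cl j)) \<le> (\<Sum>a<k. lam a)"
    unfolding swap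
  proof (rule sum_top_weights_le[OF \<open>1 \<le> k\<close> k])
    show "lam j \<le> lam i" if "i \<le> j" for i j
      using that S3[rule_format, of j] S4[rule_format, of i j] by (auto simp: lam_def intro!: power_mono)
  qed (use c csum in \<open>auto simp: lam_def sum_nonneg\<close>)
  also have "\<dots> = (\<Sum>a<k. \<Sum>j<?s. (ip ?n (u a) (cl j))\<^sup>2)"
  proof (intro sum.cong refl)
    fix a assume "a \<in> {..<k}"
    then have a: "a < ?n" using k by simp
    have "(\<Sum>j<?s. (ip ?n (u a) (cl j))\<^sup>2) = (\<Sum>b<?n. if a = b then lam b else 0)"
      unfolding energy using orthonormal_ip[OF u a] by (intro sum.cong) auto
    then show "lam a = (\<Sum>j<?s. (ip ?n (u a) (cl j))\<^sup>2)" using a by simp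
  qed
  also have "\<dots> = (\<Sum>j<?s. proj_form ?n k (\<lambda>a i. X $$ (i, a)) (cl j) (cl j))"
  proof -
    have "ip ?n (u a) v = ip ?n (\<lambda>i. X $$ (i, a)) v" if "a < k" for a v
      using that by (simp add: ip_def X u_def)
    then show ?thesis unfolding proj_form_self by (subst sum.swap) simp
  qed
  finally show ?thesis .
qed

text \<open>A maximal independent set of columns has at most \<open>k\<close> elements and, by
  maximality, spans every column; Gram-Schmidt and normalization turn it into the family
  \<open>u\<close>.\<close>

lemma rank_orthonormal_basis:
  assumes M: "M \<in> carrier_mat n m" and rank: "vec_space.rank n M \<le> k"
  shows "\<exists>l\<le>k. \<exists>u. orthonormal n l u \<and>
    (\<forall>j<m. \<exists>y. \<forall>i<n. M $$ (i, j) = (\<Sum>a<l. u a i * y a))"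
proof -
  interpret cof_vec_space n "TYPE(real)" .
  have C: "set (cols M) \<subseteq> carrier_vec n" using M cols_dim by blast
  obtain E where E: "finite E" "maximal E (\<lambda>T. T \<subseteq> set (cols M) \<and> lin_indpt T)"
    using maximal_exists_superset[of "set (cols M)" "\<lambda>T. T \<subseteq> set (cols M) \<and> lin_indpt T" "{}"]
    by (auto simp: lin_dep_def)
  then have EC: "E \<subseteq> set (cols M)" and Eind: "lin_indpt E" by (auto simp: maximal_def)
  have "card E \<le> k" using rank_card_indpt[OF M E(2)] rank by simp
  have span: "c \<in> span E" if c: "c \<in> set (cols M)" for c
  proof (rule ccontr)
    assume "c \<notin> span E"
    moreover have "E \<subseteq> carrier V" "c \<in> carrier V" using EC C c by auto
    ultimately have "lin_indpt (E \<union> {c})" "c \<notin> E"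
      using lin_dep_iff_in_span[of E c] Eind span_mem[of E c] by auto
    then have "E \<union> {c} \<subseteq> set (cols M) \<and> lin_indpt (E \<union> {c})" using EC c by auto
    with E(2) \<open>c \<notin> E\<close> show False unfolding maximal_def by blast
  qed
  obtain ws where ws: "set ws = E" "distinct ws" using finite_distinct_list[OF E(1)] by blast
  define us where "us = gram_schmidt n ws"
  have us: "span (set ws) = span (set us)" "corthogonal us" "set us \<subseteq> carrier_vec n"
    "length us = length ws" "distinct us"
    using gram_schmidt_result[of ws us] ws EC C Eind us_def by auto
  define l where "l = length us"
  have l: "l \<le> k" using us(4) ws \<open>card E \<le> k\<close> distinct_card[OF ws(2)] by (simp add: l_def)
  have us_carrier: "us ! a \<in> carrier_vec n" if "a < l" for a using that us(3) by (auto simp: l_def)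
  \<comment> \<open>Over the reals the conjugation in \<open>corthogonal\<close> is the
    identity.\<close>
  have conj: "us ! a \<bullet>c us ! b = ip n (\<lambda>i. us ! a $ i) (\<lambda>i. us ! b $ i)" if "a < l" "b < l" for a b
    using us_carrier[OF that(1)] us_carrier[OF that(2)] by (auto simp: scalar_prod_def ip_def atLeast0LessThan)
  define nu where "nu a = sqrt (ip n (\<lambda>i. us ! a $ i) (\<lambda>i. us ! a $ i))" for a
  have nu: "nu a \<noteq> 0" if "a < l" for a
    using corthogonalD[OF us(2), of a a] that conj[of a a] by (simp add: nu_def l_def)
  define u where "u a i = us ! a $ i / nu a" for a i
  have u_ip: "ip n (u a) (u b) = ip n (\<lambda>i. us ! a $ i) (\<lambda>i. us ! b $ i) / (nu a * nu b)" for a b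
    by (simp add: ip_def u_def sum_divide_distrib)
  have "orthonormal n l u"
    unfolding orthonormal_def
  proof (intro allI impI)
    fix a b assume ab: "a < l" "b < l"
    show "ip n (u a) (u b) = (if a = b then 1 else 0)"
    proof (cases "a = b")
      case True
      have "ip n (\<lambda>i. us ! a $ i) (\<lambda>i. us ! a $ i) = nu a * nu a"
        using ip_self_nonneg by (simp add: nu_def)
      then show ?thesis using True nu[OF ab(1)] by (simp add: u_ip)
    next
      case False
      then show ?thesis using corthogonalD[OF us(2), of a b] ab conj[OF ab] by (simp add: u_ip l_def)
    qed
  qed
  moreover have "\<exists>y. \<forall>i<n. M $$ (i, j) = (\<Sum>a<l. u a i * y a)" if j: "j < m" for j
  proof -
    have "col M j \<in> set (cols M)" using M j by (auto simp: cols_def)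
    then have "col M j \<in> span (set us)" using span us(1) ws by simp
    then obtain c where c: "col M j = lincomb c (set us)"
      using finite_in_span[of "set us" "col M j"] us(3) by (metis List.finite_set)
    show ?thesis
    proof (intro exI allI impI)
      fix i assume i: "i < n"
      have "M $$ (i, j) = (\<Sum>x\<in>set us. c x * x $ i)"
        using M i j arg_cong[OF c, of "\<lambda>v. v $ i"] lincomb_index[OF i us(3)] by auto
      also have "\<dots> = (\<Sum>a<l. c (us ! a) * (us ! a) $ i)"
        using us(5) by (intro sum.reindex_bij_betw[symmetric, where h="\<lambda>a. us ! a"])
          (auto simp: l_def intro: bij_betw_nth)
      also have "\<dots> = (\<Sum>a<l. u a i * (nu a * c (us ! a)))"
        using nu by (intro sum.cong) (auto simp: u_def)
      finally show "M $$ (i, j) = (\<Sum>a<l. u a i * (nu a * c (us ! a)))" .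
    qed
  qed
  ultimately show ?thesis using l by blast
qed

lemma frob_norm_sq: "(frob_norm M)\<^sup>2 = (\<Sum>i<dim_row M. \<Sum>j<dim_col M. (M $$ (i, j))\<^sup>2)"
  by (simp add: frob_norm_def sum_nonneg)

lemma frob_norm_cols:
  "M \<in> carrier_mat n m \<Longrightarrow> (frob_norm M)\<^sup>2 = (\<Sum>j<m. ip n (\<lambda>i. M $$ (i, j)) (\<lambda>i. M $$ (i, j)))"
  by (auto simp: frob_norm_sq ip_self sum.swap[of _ "{..<m}"])

text \<open>Once a column space is fixed, orthogonal projection gives the best coefficients; the
  coefficients of \<open>L\<close> can only add a nonnegative square in
  \<open>ip_residual\<close>.\<close>

lemma low_rank_residual:
  assumes A: "A \<in> carrier_mat n m" and L: "L \<in> carrier_mat n m" and rank: "vec_space.rank n L \<le> k"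
  obtains l u where "l \<le> k" "orthonormal n l u"
    "(frob_norm A)\<^sup>2 - (\<Sum>j<m. proj_form n l u (\<lambda>i. A $$ (i, j)) (\<lambda>i. A $$ (i, j))) \<le> (frob_norm (A - L))\<^sup>2"
proof -
  obtain l u where l: "l \<le> k" and u: "orthonormal n l u"
    and "\<forall>j<m. \<exists>y. \<forall>i<n. L $$ (i, j) = (\<Sum>a<l. u a i * y a)"
    using rank_orthonormal_basis[OF L rank] by blast
  then obtain y where y: "\<And>i j. i < n \<Longrightarrow> j < m \<Longrightarrow> L $$ (i, j) = (\<Sum>a<l. u a i * y j a)" by metis
  let ?col = "\<lambda>j i. A $$ (i, j)"
  have "(frob_norm (A - L))\<^sup>2 = (\<Sum>j<m. \<Sum>i<n. (A $$ (i, j) - (\<Sum>a<l. u a i * y j a))\<^sup>2)"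
    using A L y by (simp add: frob_norm_sq) (subst sum.swap, auto intro!: sum.cong)
  also have "\<dots> = (\<Sum>j<m. ip n (?col j) (?col j) - proj_form n l u (?col j) (?col j)
      + (\<Sum>a<l. (ip n (u a) (?col j) - y j a)\<^sup>2))"
    using ip_residual[OF u] by simp
  also have "\<dots> \<ge> (\<Sum>j<m. ip n (?col j) (?col j) - proj_form n l u (?col j) (?col j))"
    by (intro sum_mono) (simp add: sum_nonneg)
  finally show thesis using that[OF l u] by (simp add: frob_norm_cols[OF A] sum_subtractf)
qed


section \<open>Deviation of sums of independent samples\<close>

lemma expectation_bind_finite:
  fixes h :: "'b \<Rightarrow> real"
  assumes "finite (set_pmf p)" "\<And>x. x \<in> set_pmf p \<Longrightarrow> finite (set_pmf (f x))"
  shows "measure_pmf.expectation (bind_pmf p f) h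
    = measure_pmf.expectation p (\<lambda>x. measure_pmf.expectation (f x) h)"
  using assms
  by (simp add: pmf_expectation_bind[of "set_pmf p"] integral_measure_pmf[of "set_pmf p"])

lemma finite_set_replicate_pmf:
  "finite (set_pmf p) \<Longrightarrow> finite (set_pmf (replicate_pmf s p))"
  by (induction s) auto

lemma expectation_replicate_Suc:
  fixes h :: "'a list \<Rightarrow> real"
  assumes "finite (set_pmf p)"
  shows "measure_pmf.expectation (replicate_pmf (Suc s) p) h
    = measure_pmf.expectation p (\<lambda>x. measure_pmf.expectation (replicate_pmf s p) (\<lambda>xs. h (x # xs)))"
  using assms finite_set_replicate_pmf[OF assms, of s]
  by (simp add: expectation_bind_finite)

text \<open>Peeling off the first draw, independence lets the cross term of the square factor
  through the mean of \<open>z\<close>, which is 0. Both claims are proved together because the step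
  for the second uses the first.\<close>

lemma expectation_sum_replicate:
  fixes z :: "'a \<Rightarrow> real"
  assumes fin: "finite (set_pmf p)" and mean: "measure_pmf.expectation p z = 0"
  shows "measure_pmf.expectation (replicate_pmf s p) (\<lambda>xs. \<Sum>x\<leftarrow>xs. z x) = 0"
    and "measure_pmf.expectation (replicate_pmf s p) (\<lambda>xs. (\<Sum>x\<leftarrow>xs. z x)\<^sup>2)
      = real s * measure_pmf.expectation p (\<lambda>x. (z x)\<^sup>2)"
proof (induction s)
  case (Suc s)
  have int: "integrable (measure_pmf p) f" "integrable (measure_pmf (replicate_pmf s p)) g"
    for f :: "'a \<Rightarrow> real" and g :: "'a list \<Rightarrow> real"
    using fin finite_set_replicate_pmf[OF fin, of s] by (auto intro: integrable_measure_pmf_finite)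
  {
    case 1
    then show ?case using Suc mean by (subst expectation_replicate_Suc[OF fin]) (simp add: int)
  next
    case 2
    then show ?case using Suc mean
      by (subst expectation_replicate_Suc[OF fin]) (simp add: int power2_sum algebra_simps)
  }
qed simp_all

text \<open>The index \<open>\<kappa>\<close> runs over the entries of a random matrix, so the left
  side is an expected squared Frobenius deviation. Variances are replaced by second moments, which
  are larger and easier to compute.\<close>

lemma expectation_deviation:
  fixes z :: "'k \<Rightarrow> 'a \<Rightarrow> real"
  assumes fin: "finite (set_pmf p)"
    and V: "(\<Sum>\<kappa>\<in>K. measure_pmf.expectation p (\<lambda>x. (z \<kappa> x)\<^sup>2)) \<le> V"
  shows "measure_pmf.expectation (replicate_pmf s p)
    (\<lambda>xs. \<Sum>\<kappa>\<in>K. ((\<Sum>x\<leftarrow>xs. z \<kappa> x) - real s * measure_pmf.expectation p (z \<kappa>))\<^sup>2) \<le> real s * V"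
proof -
  have int: "integrable (measure_pmf p) f" "integrable (measure_pmf (replicate_pmf s p)) g"
    for f :: "'a \<Rightarrow> real" and g :: "'a list \<Rightarrow> real"
    using fin finite_set_replicate_pmf[OF fin, of s] by (auto intro: integrable_measure_pmf_finite)
  define mu where "mu \<kappa> = measure_pmf.expectation p (z \<kappa>)" for \<kappa>
  have dev: "measure_pmf.expectation (replicate_pmf s p) (\<lambda>xs. ((\<Sum>x\<leftarrow>xs. z \<kappa> x) - real s * mu \<kappa>)\<^sup>2)
    \<le> real s * measure_pmf.expectation p (\<lambda>x. (z \<kappa> x)\<^sup>2)" for \<kappa>
  proof -
    have "(\<Sum>x\<leftarrow>xs. z \<kappa> x) - real s * mu \<kappa> = (\<Sum>x\<leftarrow>xs. z \<kappa> x - mu \<kappa>)"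
      if "xs \<in> set_pmf (replicate_pmf s p)" for xs
      using that by (auto simp: set_replicate_pmf sum_list_subtractf sum_list_triv)
    then have "measure_pmf.expectation (replicate_pmf s p) (\<lambda>xs. ((\<Sum>x\<leftarrow>xs. z \<kappa> x) - real s * mu \<kappa>)\<^sup>2)
      = measure_pmf.expectation (replicate_pmf s p) (\<lambda>xs. (\<Sum>x\<leftarrow>xs. z \<kappa> x - mu \<kappa>)\<^sup>2)"
      by (intro integral_cong_AE) (auto simp: AE_measure_pmf_iff)
    also have "\<dots> = real s * measure_pmf.expectation p (\<lambda>x. (z \<kappa> x - mu \<kappa>)\<^sup>2)"
      by (rule expectation_sum_replicate(2)[OF fin]) (simp add: int mu_def)
    also have "measure_pmf.expectation p (\<lambda>x. (z \<kappa> x - mu \<kappa>)\<^sup>2)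
      = measure_pmf.expectation p (\<lambda>x. (z \<kappa> x)\<^sup>2) - (mu \<kappa>)\<^sup>2"
      by (simp add: power2_diff int mu_def) (simp add: power2_eq_square)
    finally show ?thesis by (simp add: mult_left_mono)
  qed
  have "measure_pmf.expectation (replicate_pmf s p)
      (\<lambda>xs. \<Sum>\<kappa>\<in>K. ((\<Sum>x\<leftarrow>xs. z \<kappa> x) - real s * mu \<kappa>)\<^sup>2)
    = (\<Sum>\<kappa>\<in>K. measure_pmf.expectation (replicate_pmf s p) (\<lambda>xs. ((\<Sum>x\<leftarrow>xs. z \<kappa> x) - real s * mu \<kappa>)\<^sup>2))"
    by (simp add: int)
  also have "\<dots> \<le> (\<Sum>\<kappa>\<in>K. real s * measure_pmf.expectation p (\<lambda>x. (z \<kappa> x)\<^sup>2))"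
    by (intro sum_mono dev)
  also have "\<dots> \<le> real s * V" using V by (simp add: sum_distrib_left[symmetric] mult_left_mono)
  finally show ?thesis by (simp add: mu_def)
qed

text \<open>Markov's inequality divides by \<open>m\<close>, hence the separate case
  \<open>m = 0\<close>, which does occur for a zero matrix: there \<open>h\<close> vanishes almost
  surely. The factor 10 is what yields 9/10.\<close>

lemma markov_pmf:
  fixes h :: "'a \<Rightarrow> real"
  assumes fin: "finite (set_pmf p)" and nonneg: "\<And>x. 0 \<le> h x"
    and le: "measure_pmf.expectation p h \<le> m"
  shows "9 / 10 \<le> measure_pmf.prob p {x. h x \<le> 10 * m}"
proof -
  have int: "integrable (measure_pmf p) h" using fin by (rule integrable_measure_pmf_finite)
  have "0 \<le> measure_pmf.expectation p h" by (intro integral_nonneg_AE) (simp add: nonneg)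
  then consider "m = 0" "measure_pmf.expectation p h = 0" | "0 < m" using le by linarith
  then show ?thesis
  proof cases
    case 1
    then have "AE x in measure_pmf p. h x = 0"
      using integral_nonneg_eq_0_iff_AE[OF int] nonneg by simp
    then have "AE x in measure_pmf p. x \<in> {x. h x \<le> 10 * m}" using 1 by (auto elim: AE_mp)
    then have "measure_pmf.prob p {x. h x \<le> 10 * m} = 1" by (subst measure_pmf.prob_eq_1) auto
    then show ?thesis by simp
  next
    case 2
    have "measure_pmf.prob p {x. 10 * m \<le> h x} \<le> measure_pmf.expectation p h / (10 * m)"
      using integral_Markov_inequality_measure[OF int, of "{}" "10 * m"] 2 nonneg by simp
    also have "\<dots> \<le> 1 / 10" using 2 le by (simp add: field_simps)
    finally have "measure_pmf.prob p {x. 10 * m \<le> h x} \<le> 1 / 10" .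
    moreover have "measure_pmf.prob p {x. \<not> h x \<le> 10 * m} \<le> measure_pmf.prob p {x. 10 * m \<le> h x}"
      by (intro measure_pmf.finite_measure_mono) auto
    moreover have "measure_pmf.prob p {x. h x \<le> 10 * m} = 1 - measure_pmf.prob p {x. \<not> h x \<le> 10 * m}"
      using measure_pmf.prob_compl[of "{x. \<not> h x \<le> 10 * m}" p] by (simp add: Compl_eq_Diff_UNIV[symmetric] Collect_neg_eq[symmetric])
    ultimately show ?thesis by simp
  qed
qed

lemma sample_deviation:
  fixes z :: "'k \<Rightarrow> 'a \<Rightarrow> real"
  assumes "finite (set_pmf p)" "(\<Sum>\<kappa>\<in>K. measure_pmf.expectation p (\<lambda>x. (z \<kappa> x)\<^sup>2)) \<le> V"
  shows "9 / 10 \<le> measure_pmf.prob (replicate_pmf s p)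
    {xs. (\<Sum>\<kappa>\<in>K. ((\<Sum>x\<leftarrow>xs. z \<kappa> x) - real s * measure_pmf.expectation p (z \<kappa>))\<^sup>2) \<le> 10 * (real s * V)}"
  using assms by (intro markov_pmf finite_set_replicate_pmf expectation_deviation sum_nonneg) auto

text \<open>Success probabilities of consecutive stages multiply, even though the law of the second
  stage depends on the outcome of the first.\<close>

lemma prob_bind_ge:
  assumes G: "a \<le> measure_pmf.prob p G" and b: "0 \<le> b"
    and "\<And>x. x \<in> set_pmf p \<Longrightarrow> x \<in> G \<Longrightarrow> b \<le> measure_pmf.prob (f x) A"
  shows "a * b \<le> measure_pmf.prob (bind_pmf p f) A"
proof -
  have "ennreal (a * b) \<le> ennreal (b * measure_pmf.prob p G)"
    using mult_left_mono[OF G b] by (intro ennreal_leI) (simp add: mult.commute)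
  also have "\<dots> = (\<integral>\<^sup>+x. ennreal b * indicator G x \<partial>measure_pmf p)"
    using b by (simp add: nn_integral_cmult measure_pmf.emeasure_eq_measure ennreal_mult)
  also have "\<dots> \<le> (\<integral>\<^sup>+x. emeasure (measure_pmf (f x)) A \<partial>measure_pmf p)"
    using assms(3) by (intro nn_integral_mono_AE)
      (auto simp: AE_measure_pmf_iff measure_pmf.emeasure_eq_measure intro!: ennreal_leI split: split_indicator)
  also have "\<dots> = ennreal (measure_pmf.prob (bind_pmf p f) A)"
    by (simp add: measure_pmf.emeasure_eq_measure[symmetric])
  finally show ?thesis by (simp add: measure_nonneg)
qed


section \<open>Results and expected costs of programs\<close>

text \<open>The law of the output alone; correctness is argued about this, cost about
  \<open>ecost\<close>.\<close>

definition result :: "'a prog \<Rightarrow> 'a spmf" where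
  "result m = map_spmf fst m"

lemma result_ret [simp]: "result (ret x) = return_spmf x"
  by (simp add: result_def ret_def)

lemma result_charge [simp]: "result (charge c x) = return_spmf x"
  by (simp add: result_def charge_def)

lemma result_make_table [simp]: "result (make_table n p) = return_spmf (table_pmf n p)"
  by (simp add: make_table_def)

lemma result_mult_prog [simp]: "result (mult_prog mm_ops M L) = return_spmf (M * L)"
  by (simp add: mult_prog_def)

lemma result_draw [simp]: "result (draw D) = spmf_of_pmf D"
  by (simp add: result_def draw_def pmf.map_comp o_def pmf.map_ident)

lemma result_return_spmf [simp]: "result (return_spmf (x, q, a)) = return_spmf x"
  by (simp add: result_def)

lemma result_bind [simp]: "result (bind_prog m f) = bind_spmf (result m) (\<lambda>x. result (f x))"
proof -
  have "fst \<circ> (\<lambda>(y, q', a'). (y, q + q', a + a')) = (fst :: 'a \<times> nat \<times> nat \<Rightarrow> 'a)" for q a :: nat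
    by auto
  then show ?thesis
    by (auto simp: result_def bind_prog_def map_spmf_bind_spmf bind_map_spmf spmf.map_comp o_def
        split_def intro!: bind_spmf_cong)
qed

lemma result_for_each_return:
  assumes "\<And>x. x \<in> set xs \<Longrightarrow> result (f x) = return_spmf (g x)"
  shows "result (for_each xs f) = return_spmf (map g xs)"
  using assms by (induction xs) auto

lemma result_for_each_const:
  assumes "result m = spmf_of_pmf P"
  shows "result (for_each xs (\<lambda>_. m)) = spmf_of_pmf (replicate_pmf (length xs) P)"
  by (induction xs) (simp_all add: assms spmf_of_pmf_bind)

lemma result_for_each_charge:
  "result (for_each xs (\<lambda>x. charge c (g x))) = return_spmf (map g xs)"
  by (intro result_for_each_return) simp

lemma in_set_result: "z \<in> set_spmf m \<Longrightarrow> fst z \<in> set_spmf (result m)"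
  by (simp add: result_def)

section \<open>Fixed and expected costs\<close>

definition shift :: "nat \<Rightarrow> nat \<Rightarrow> 'a prog \<Rightarrow> 'a prog" where
  "shift cq ca m = map_spmf (\<lambda>(y, q, a). (y, cq + q, ca + a)) m"

lemma shift_shift: "shift q a (shift q' a' m) = shift (q + q') (a + a') m"
  by (simp add: shift_def spmf.map_comp o_def split_def add.assoc)

lemma shift_bind_pmf: "shift q a (bind_pmf p f) = bind_pmf p (\<lambda>x. shift q a (f x))"
  by (simp add: shift_def map_bind_pmf)

lemma bind_prog_shift: "bind_prog m f = bind_spmf m (\<lambda>(x, q, a). shift q a (f x))"
  by (simp add: bind_prog_def shift_def)

lemma bind_prog_return: "bind_prog (return_spmf (x, q, a)) f = shift q a (f x)"
  by (simp add: bind_prog_shift)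

lemma bind_prog_draw: "bind_prog (draw D) f = bind_pmf D (\<lambda>i. shift 0 1 (f i))"
  by (simp add: bind_prog_shift draw_def bind_map_pmf)

lemma bind_prog_flip: "bind_prog (flip p) f = bind_pmf (bernoulli_pmf p) (\<lambda>b. shift 0 1 (f b))"
  by (simp add: bind_prog_shift flip_def bind_map_pmf)

text \<open>The weights 1, 0 count queries and 0, 1 count operations, so a single analysis covers
  both.\<close>

definition ecost :: "nat \<Rightarrow> nat \<Rightarrow> 'a prog \<Rightarrow> ennreal" where
  "ecost u v m = (\<integral>\<^sup>+ (x, q, a). ennreal (real (u * q + v * a)) \<partial>measure_spmf m)"

lemma expected_queries_ecost: "expected_queries m = ecost 1 0 m"
  by (simp add: expected_queries_def ecost_def)

lemma expected_ops_ecost: "expected_ops m = ecost 0 1 m"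
  by (simp add: expected_ops_def ecost_def)

lemma nn_integral_bind_spmf:
  "(\<integral>\<^sup>+x. g x \<partial>measure_spmf (bind_spmf p f)) = (\<integral>\<^sup>+x. \<integral>\<^sup>+y. g y \<partial>measure_spmf (f x) \<partial>measure_spmf p)"
  unfolding measure_spmf_bind
  by (subst nn_integral_bind[where B="count_space UNIV"]) (auto simp: o_def)

text \<open>An inequality, since the total mass of a subdistribution may be below 1.\<close>

lemma nn_integral_spmf_add_const:
  "(\<integral>\<^sup>+x. c + g x \<partial>measure_spmf p) \<le> c + (\<integral>\<^sup>+x. g x \<partial>measure_spmf p)"
proof -
  have "(\<integral>\<^sup>+x. c + g x \<partial>measure_spmf p)
    = c * emeasure (measure_spmf p) (space (measure_spmf p)) + (\<integral>\<^sup>+x. g x \<partial>measure_spmf p)"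
    by (subst nn_integral_add) auto
  also have "\<dots> \<le> c * 1 + (\<integral>\<^sup>+x. g x \<partial>measure_spmf p)"
    by (intro add_mono mult_left_mono measure_spmf.emeasure_space_le_1) auto
  finally show ?thesis by simp
qed

lemma nn_integral_spmf_le_const:
  assumes "\<And>x. x \<in> set_spmf p \<Longrightarrow> g x \<le> c"
  shows "(\<integral>\<^sup>+x. g x \<partial>measure_spmf p) \<le> c"
proof -
  have "(\<integral>\<^sup>+x. g x \<partial>measure_spmf p) \<le> (\<integral>\<^sup>+x. c + 0 \<partial>measure_spmf p)"
    using assms by (intro nn_integral_mono_AE) auto
  also have "\<dots> \<le> c" using nn_integral_spmf_add_const[where c=c and g="\<lambda>_. 0" and p=p] by simp
  finally show ?thesis .
qed

text \<open>The continuation is bounded only at results that can occur; this is how the lengths of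
  the sampled index lists become available later.\<close>

lemma ecost_bind:
  assumes m: "ecost u v m \<le> ennreal c" and f: "\<And>x. x \<in> set_spmf (result m) \<Longrightarrow> ecost u v (f x) \<le> ennreal d"
    and "0 \<le> c" "0 \<le> d"
  shows "ecost u v (bind_prog m f) \<le> ennreal (c + d)"
proof -
  have inner: "(\<integral>\<^sup>+y. (case y of (x, q, a) \<Rightarrow> ennreal (real (u * q + v * a)))
      \<partial>measure_spmf (map_spmf (\<lambda>(y, q', a'). (y, q + q', a + a')) (f x)))
    \<le> ennreal (real (u * q + v * a)) + ecost u v (f x)" for x q a
  proof -
    have "(\<integral>\<^sup>+y. (case y of (x, q, a) \<Rightarrow> ennreal (real (u * q + v * a)))
      \<partial>measure_spmf (map_spmf (\<lambda>(y, q', a'). (y, q + q', a + a')) (f x)))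
      = (\<integral>\<^sup>+y. ennreal (real (u * q + v * a)) + (case y of (x, q, a) \<Rightarrow> ennreal (real (u * q + v * a)))
        \<partial>measure_spmf (f x))"
      by (simp add: o_def split_def algebra_simps flip: ennreal_plus)
    then show ?thesis unfolding ecost_def by (simp only: nn_integral_spmf_add_const)
  qed
  have "ecost u v (bind_prog m f)
    \<le> (\<integral>\<^sup>+z. ecost u v (f (fst z)) + (case z of (x, q, a) \<Rightarrow> ennreal (real (u * q + v * a))) \<partial>measure_spmf m)"
    unfolding bind_prog_def ecost_def[of u v "bind_spmf _ _"] nn_integral_bind_spmf
  proof (intro nn_integral_mono)
    fix z :: "'a \<times> nat \<times> nat"
    obtain x q a where z: "z = (x, q, a)" by (cases z)
    show "(\<integral>\<^sup>+y. (case y of (x, q, a) \<Rightarrow> ennreal (real (u * q + v * a)))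
        \<partial>measure_spmf (case z of (x, q, a) \<Rightarrow> map_spmf (\<lambda>(y, q', a'). (y, q + q', a + a')) (f x)))
      \<le> ecost u v (f (fst z)) + (case z of (x, q, a) \<Rightarrow> ennreal (real (u * q + v * a)))"
      using inner[of q a x] unfolding z prod.case fst_conv by (simp only: add.commute)
  qed
  also have "\<dots> \<le> (\<integral>\<^sup>+z. ennreal d + (case z of (x, q, a) \<Rightarrow> ennreal (real (u * q + v * a))) \<partial>measure_spmf m)"
    using in_set_result by (intro nn_integral_mono_AE) (auto simp: AE_measure_spmf_iff intro!: f add_right_mono)
  also have "\<dots> \<le> ennreal d + ecost u v m"
    unfolding ecost_def by (rule nn_integral_spmf_add_const)
  also have "\<dots> \<le> ennreal d + ennreal c" using m by (rule add_left_mono)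
  also have "\<dots> = ennreal (c + d)" using assms(3,4) by (simp add: add.commute)
  finally show ?thesis .
qed

lemma ecost_return: "ecost u v (return_spmf (x, q, a)) = ennreal (real (u * q + v * a))"
  by (simp add: ecost_def measure_spmf_return_spmf nn_integral_return)

lemma ecost_ret: "ecost u v (ret x) \<le> ennreal 0"
  by (simp add: ret_def ecost_return)

lemma ecost_charge: "ecost u v (charge c x) \<le> ennreal (real v * real c)"
  by (simp add: charge_def ecost_return)

lemma ecost_charge_pair:
  assumes "ecost u v (F s t) \<le> ennreal d" "0 \<le> d"
  shows "ecost u v (bind_prog (charge c (s, t)) (\<lambda>(s, t). F s t)) \<le> ennreal (real v * real c + d)"
  using assms by (intro ecost_bind ecost_charge) auto

lemma ecost_make_table: "ecost u v (make_table n p) \<le> ennreal (real v * real n)"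
  by (simp add: make_table_def ecost_charge)

lemma ecost_draw: "ecost u v (draw D) \<le> ennreal (real v)"
  unfolding draw_def ecost_def by (intro nn_integral_spmf_le_const) auto

lemma ecost_for_each:
  assumes "\<And>x. x \<in> set xs \<Longrightarrow> ecost u v (f x) \<le> ennreal c" "0 \<le> c"
  shows "ecost u v (for_each xs f) \<le> ennreal (real (length xs) * c)"
  using assms(1)
proof (induction xs)
  case (Cons x xs)
  have "ecost u v (for_each (x # xs) f) \<le> ennreal (c + (real (length xs) * c + 0))"
    unfolding for_each.simps using Cons assms(2) by (intro ecost_bind ecost_ret) auto
  then show ?case by (simp add: algebra_simps)
qed (simp add: ret_def ecost_return)


section \<open>Rejection sampling\<close>

text \<open>Comparing point masses in the equation determines \<open>r\<close>. With
  \<open>q\<close> the probability of a rejection, the mass \<open>m\<close> of nontermination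
  satisfies \<open>(1 - q) * m = 0\<close>, so the loop terminates almost surely, and the results
  follow the law of one round conditioned on acceptance.\<close>

lemma retry_result:
  assumes r: "r = bind_pmf Q (\<lambda>x. case x of None \<Rightarrow> r | Some i \<Rightarrow> return_spmf i)"
    and Q: "pmf Q None < 1"
  obtains P where "r = spmf_of_pmf P" "\<And>i. (1 - pmf Q None) * pmf P i = pmf Q (Some i)"
proof -
  have eq: "pmf r y = (case y of None \<Rightarrow> 0 | Some i \<Rightarrow> pmf Q (Some i)) + pmf Q None * pmf r y" for y
  proof -
    have "pmf r y = measure_pmf.expectation Q (\<lambda>x. pmf (case x of None \<Rightarrow> r | Some i \<Rightarrow> return_spmf i) y)"
      by (subst r) (simp add: pmf_bind)
    also have "\<dots> = measure_pmf.expectation Q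
      (\<lambda>x. (case y of None \<Rightarrow> 0 | Some i \<Rightarrow> indicator {Some i} x) + pmf r y * indicator {None} x)"
      by (intro Bochner_Integration.integral_cong) (auto split: option.splits split_indicator)
    also have "\<dots> = (case y of None \<Rightarrow> 0 | Some i \<Rightarrow> pmf Q (Some i)) + pmf Q None * pmf r y"
    proof (cases y)
      case (Some i)
      have "integrable (measure_pmf Q) (indicator {x} :: _ \<Rightarrow> real)" for x
        by (intro measure_pmf.integrable_const_bound[where B=1]) (auto split: split_indicator)
      then show ?thesis using Some by (simp add: measure_pmf_single)
    qed (simp add: measure_pmf_single)
    finally show ?thesis .
  qed
  have "(1 - pmf Q None) * pmf r None = 0" using eq[of None] by (simp add: algebra_simps)
  then have "lossless_spmf r" using Q by (simp add: lossless_iff_pmf_None)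
  then obtain P where P: "r = spmf_of_pmf P" by (auto simp: lossless_spmf_conv_spmf_of_pmf)
  moreover have "(1 - pmf Q None) * pmf P i = pmf Q (Some i)" for i
    using eq[of "Some i"] by (simp add: P algebra_simps)
  ultimately show thesis using that by blast
qed

text \<open>The recursive equation bounds the cost only if the cost is known to be finite, hence the
  truncation at \<open>N\<close>.\<close>

lemma retry_cost:
  assumes L: "L = bind_pmf Q (\<lambda>x. shift cq ca
      (case x of None \<Rightarrow> L | Some i \<Rightarrow> return_spmf (i, 0, 0)))"
    and Q: "pmf Q None < 1"
  shows "ecost u v L \<le> ennreal (real (u * cq + v * ca) / (1 - pmf Q None))"
proof -
  define c where "c = real (u * cq + v * ca)"
  define h where "h z = (case z of (x, q, a) \<Rightarrow> ennreal (real (u * q + v * a)))" for z :: "'a \<times> nat \<times> nat"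
  define T where "T N = (\<integral>\<^sup>+z. min (of_nat N) (h z) \<partial>measure_spmf L)" for N :: nat
  have T: "T N \<le> ennreal (c / (1 - pmf Q None))" for N
  proof -
    have "T N \<le> of_nat N" unfolding T_def by (intro nn_integral_spmf_le_const) auto
    then have fin: "T N < \<top>" using of_nat_less_top by (rule le_less_trans)
    \<comment> \<open>Truncation at \<open>N\<close> after adding \<open>c\<close> exceeds the
      truncated value by at most \<open>c\<close>, so the fixed cost of a round can be split
      off.\<close>
    have step: "(\<integral>\<^sup>+z. min (of_nat N) (h z)
        \<partial>measure_spmf (shift cq ca m))
      \<le> ennreal c + (\<integral>\<^sup>+z. min (of_nat N) (h z) \<partial>measure_spmf m)" for m
    proof -
      have h: "h (y, cq + q, ca + a) = ennreal c + h (y, q, a)" for y q a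
        by (simp add: h_def c_def algebra_simps flip: ennreal_plus)
      have "(\<integral>\<^sup>+z. min (of_nat N) (h z) \<partial>measure_spmf (shift cq ca m))
        \<le> (\<integral>\<^sup>+z. ennreal c + min (of_nat N) (h z) \<partial>measure_spmf m)"
        by (auto simp: shift_def o_def split_def h intro!: nn_integral_mono)
          (auto simp: min_def add_increasing)
      also have "\<dots> \<le> ennreal c + (\<integral>\<^sup>+z. min (of_nat N) (h z) \<partial>measure_spmf m)"
        by (rule nn_integral_spmf_add_const)
      finally show ?thesis .
    qed
    have "T N = (\<integral>\<^sup>+x. \<integral>\<^sup>+z. min (of_nat N) (h z) \<partial>measure_spmf (shift cq ca
      (case x of None \<Rightarrow> L | Some i \<Rightarrow> return_spmf (i, 0, 0))) \<partial>measure_pmf Q)"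
      unfolding T_def
      by (subst L) (simp only: nn_integral_bind_spmf bind_spmf_of_pmf[symmetric] measure_spmf_spmf_of_pmf)
    also have "\<dots> \<le> (\<integral>\<^sup>+x. ennreal c + T N * indicator {None} x \<partial>measure_pmf Q)"
    proof (intro nn_integral_mono)
      fix x
      have "(\<integral>\<^sup>+z. min (of_nat N) (h z) \<partial>measure_spmf (return_spmf (i, 0, 0))) = 0" for i
        by (simp add: measure_spmf_return_spmf nn_integral_return h_def)
      then show "(\<integral>\<^sup>+z. min (of_nat N) (h z) \<partial>measure_spmf (shift cq ca
          (case x of None \<Rightarrow> L | Some i \<Rightarrow> return_spmf (i, 0, 0)))) \<le> ennreal c + T N * indicator {None} x"
        using step[of L] step[of "return_spmf (the x, 0, 0)"]
        by (cases x) (simp_all add: T_def)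
    qed
    also have "\<dots> = ennreal c + T N * ennreal (pmf Q None)"
      by (simp add: nn_integral_add nn_integral_cmult emeasure_pmf_single)
    finally have le: "T N \<le> ennreal c + T N * ennreal (pmf Q None)" .
    obtain r where r: "T N = ennreal r" "0 \<le> r" using fin by (cases "T N") auto
    have "r \<le> c + r * pmf Q None"
      using le r by (simp add: c_def ennreal_le_iff flip: ennreal_mult ennreal_plus)
    then have "r \<le> c / (1 - pmf Q None)" using Q by (simp add: field_simps)
    then show ?thesis using r by (simp add: ennreal_leI)
  qed
  have "h z = (SUP N. min (of_nat N) (h z))" for z
  proof -
    obtain r where r: "h z = ennreal r" "0 \<le> r"
      by (rule that[of "real (u * fst (snd z) + v * snd (snd z))"])
        (simp_all only: h_def split_def of_nat_0_le_iff)
    obtain N where "r \<le> real N" using real_arch_simple by blast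
    then have "h z = min (of_nat N) (h z)"
      using r by (simp add: min_def ennreal_of_nat_eq_real_of_nat ennreal_leI)
    then have "h z \<le> (SUP N. min (of_nat N) (h z))" by (metis SUP_upper UNIV_I)
    then show ?thesis by (rule antisym[OF _ SUP_least[OF min.cobounded2]])
  qed
  then have "ecost u v L = (\<integral>\<^sup>+z. (SUP N. min (of_nat N) (h z)) \<partial>measure_spmf L)"
    by (simp add: ecost_def h_def[abs_def])
  also have "\<dots> = (SUP N. T N)"
    unfolding T_def
    by (intro nn_integral_monotone_convergence_SUP)
      (auto simp: incseq_def le_fun_def intro!: min.coboundedI1 of_nat_mono)
  also have "\<dots> \<le> ennreal (c / (1 - pmf Q None))" by (intro SUP_least T)
  finally show ?thesis by (simp add: c_def)
qed

lemma pmf_table_pmf: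
  assumes "\<And>i. i < n \<Longrightarrow> 0 \<le> p i" "(\<Sum>i<n. p i) = 1"
  shows "pmf (table_pmf n p) i = (if i < n then p i else 0)"
  unfolding table_pmf_def
proof (rule pmf_embed_pmf)
  have "(\<integral>\<^sup>+i. ennreal (if i < n then p i else 0) \<partial>count_space UNIV)
    = (\<Sum>i<n. ennreal (if i < n then p i else 0))"
    by (subst nn_integral_count_space'[of "{..<n}"]) auto
  also have "\<dots> = (\<Sum>i<n. ennreal (p i))" by (intro sum.cong) auto
  also have "\<dots> = ennreal (\<Sum>i<n. p i)" using assms(1) by (intro sum_ennreal) simp
  finally show "(\<integral>\<^sup>+i. ennreal (if i < n then p i else 0) \<partial>count_space UNIV) = 1"
    using assms(2) by simp
qed (use assms in auto)

lemma set_table_pmf: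
  assumes "\<And>i. i < n \<Longrightarrow> 0 \<le> p i" "(\<Sum>i<n. p i) = 1"
  shows "set_pmf (table_pmf n p) \<subseteq> {..<n}"
proof
  fix i assume "i \<in> set_pmf (table_pmf n p)"
  then have "pmf (table_pmf n p) i \<noteq> 0" by (simp add: set_pmf_iff)
  then show "i \<in> {..<n}" by (auto simp: pmf_table_pmf[OF assms] split: if_splits)
qed

text \<open>A single round of the loop without its cost; \<open>None\<close> stands for a
  rejection.\<close>

definition proposal :: "real \<Rightarrow> (nat \<Rightarrow> nat \<Rightarrow> real) \<Rightarrow> real list \<Rightarrow> nat pmf \<Rightarrow> nat option pmf" where
  "proposal \<phi> b dg D = bind_pmf D (\<lambda>I. bind_pmf D (\<lambda>J.
     map_pmf (\<lambda>acc. if acc then Some I else None)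
       (bernoulli_pmf ((b I J)\<^sup>2 / (\<phi>\<^sup>2 * \<bar>dg ! I\<bar> * \<bar>dg ! J\<bar>)))))"

text \<open>Each round costs the same whatever it draws: 3 queries, and 18 operations made up of two
  draws, 8 for the clipped entry, 7 for the quotient and 1 for the coin. So the cost separates from
  the randomness and the loop has the form of the retry lemmas.\<close>

lemma rejection_loop_unfold:
  assumes entry: "\<And>i j. entry i j = return_spmf (b i j, 3, 8)"
  shows "rejection_loop entry \<phi> dg D = bind_pmf (proposal \<phi> b dg D)
    (\<lambda>x. shift 3 18
      (case x of None \<Rightarrow> rejection_loop entry \<phi> dg D | Some i \<Rightarrow> return_spmf (i, 0, 0)))"
  (is "?L = _")
proof -
  have "?L = bind_pmf D (\<lambda>I. bind_pmf D (\<lambda>J.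
     bind_pmf (bernoulli_pmf ((b I J)\<^sup>2 / (\<phi>\<^sup>2 * \<bar>dg ! I\<bar> * \<bar>dg ! J\<bar>))) (\<lambda>acc.
       shift 3 18 (if acc then return_spmf (I, 0, 0) else ?L))))"
    by (subst rejection_loop.simps)
      (simp add: bind_prog_draw bind_prog_flip bind_prog_return charge_def ret_def entry
        shift_bind_pmf shift_shift cong: if_cong)
  also have "\<dots> = bind_pmf (proposal \<phi> b dg D)
    (\<lambda>x. shift 3 18
      (case x of None \<Rightarrow> ?L | Some i \<Rightarrow> return_spmf (i, 0, 0)))"
    unfolding proposal_def
    by (simp add: bind_assoc_pmf bind_map_pmf) (intro bind_pmf_cong refl, auto)
  finally show ?thesis .
qed

lemma pmf_proposal:
  assumes D: "set_pmf D \<subseteq> {..<n}"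
    and acc: "\<And>i j. i < n \<Longrightarrow> j < n \<Longrightarrow> (b i j)\<^sup>2 / (\<phi>\<^sup>2 * \<bar>dg ! i\<bar> * \<bar>dg ! j\<bar>) \<le> 1" and i: "i < n"
  shows "pmf (proposal \<phi> b dg D) (Some i)
    = (\<Sum>j<n. pmf D i * pmf D j * ((b i j)\<^sup>2 / (\<phi>\<^sup>2 * \<bar>dg ! i\<bar> * \<bar>dg ! j\<bar>)))"
proof -
  define r where "r i j = (b i j)\<^sup>2 / (\<phi>\<^sup>2 * \<bar>dg ! i\<bar> * \<bar>dg ! j\<bar>)" for i j
  have r: "0 \<le> r i j" "i < n \<Longrightarrow> j < n \<Longrightarrow> r i j \<le> 1" for i j
    using acc by (auto simp: r_def)
  have bern: "pmf (map_pmf (\<lambda>acc. if acc then Some I else None) (bernoulli_pmf (r I J))) (Some i)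
    = (if I = i then r i J else 0)" if "I < n" "J < n" for I J
  proof -
    have "(\<lambda>acc. if acc then Some I else None) -` {Some i} = (if I = i then {True} else {})"
      by (auto split: if_splits)
    then show ?thesis using r that by (simp add: pmf_map measure_pmf_single)
  qed
  have E: "measure_pmf.expectation D f = (\<Sum>j<n. f j * pmf D j)" for f :: "nat \<Rightarrow> real"
    using D by (subst integral_measure_pmf_real[where A="{..<n}"]) auto
  have "pmf (proposal \<phi> b dg D) (Some i) = (\<Sum>I<n. (\<Sum>J<n. (if I = i then r i J else 0) * pmf D J) * pmf D I)"
    unfolding proposal_def r_def[symmetric] pmf_bind E
    by (intro sum.cong refl arg_cong2[where f="(*)"] bern) auto
  also have "\<dots> = (\<Sum>I<n. if I = i then (\<Sum>J<n. r i J * pmf D J) * pmf D i else 0)"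
    by (intro sum.cong) auto
  also have "\<dots> = (\<Sum>J<n. pmf D i * pmf D J * r i J)"
    using i by (simp add: sum_distrib_left ac_simps)
  finally show ?thesis by (simp add: r_def)
qed

lemma set_proposal:
  assumes "set_pmf D \<subseteq> {..<n}"
  shows "set_pmf (proposal \<phi> b dg D) \<subseteq> insert None (Some ` {..<n})"
  using assms by (auto simp: proposal_def split: if_splits)

text \<open>The diagonal cancels between the proposal and the acceptance probability: a round
  accepts the pair \<open>i\<close>, \<open>j\<close> with probability
  \<open>(b i j)\<^sup>2 / (\<phi>\<^sup>2 * d\<^sup>2)\<close>. Summing over \<open>j\<close> gives
  row-norm sampling, and summing over all pairs gives the acceptance rate
  \<open>R2 / (\<phi>\<^sup>2 * d\<^sup>2)\<close>.\<close>

lemma rejection_loop_correct: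
  fixes b :: "nat \<Rightarrow> nat \<Rightarrow> real"
  assumes entry: "\<And>i j. entry i j = return_spmf (b i j, 3, 8)"
    and bound: "\<And>i j. i < n \<Longrightarrow> j < n \<Longrightarrow> (b i j)\<^sup>2 \<le> \<phi>\<^sup>2 * (\<bar>b i i\<bar> * \<bar>b j j\<bar>)"
    and dg: "\<And>i. i < n \<Longrightarrow> dg ! i = b i i" and \<phi>: "0 < \<phi>"
    and d: "d = (\<Sum>i<n. \<bar>b i i\<bar>)" "d \<noteq> 0"
    and D: "\<And>i. pmf D i = (if i < n then \<bar>b i i\<bar> / d else 0)"
  defines "R2 \<equiv> \<Sum>i<n. \<Sum>j<n. (b i j)\<^sup>2"
  shows "\<exists>P. result (rejection_loop entry \<phi> dg D) = spmf_of_pmf P \<and> set_pmf P \<subseteq> {..<n} \<and>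
      (\<forall>i<n. R2 * pmf P i = (\<Sum>j<n. (b i j)\<^sup>2))"
    and "ecost u v (rejection_loop entry \<phi> dg D) \<le> ennreal ((3 * real u + 18 * real v) * (\<phi>\<^sup>2 * real n))"
proof -
  let ?L = "rejection_loop entry \<phi> dg D" and ?Q = "proposal \<phi> b dg D"
  have "0 \<le> d" unfolding d by (intro sum_nonneg) simp
  then have "0 < d" using d(2) by linarith
  have setD: "set_pmf D \<subseteq> {..<n}" using D by (auto simp: set_pmf_iff split: if_splits)
  have acc: "(b i j)\<^sup>2 / (\<phi>\<^sup>2 * \<bar>dg ! i\<bar> * \<bar>dg ! j\<bar>) \<le> 1" if "i < n" "j < n" for i j
    using bound[OF that] that by (intro divide_le_eq_1[THEN iffD2]) (auto simp: dg mult.assoc zero_less_mult_iff \<phi>)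
  have Some: "pmf ?Q (Some i) = (\<Sum>j<n. (b i j)\<^sup>2) / (\<phi>\<^sup>2 * d\<^sup>2)" if "i < n" for i
  proof -
    have "pmf D i * pmf D j * ((b i j)\<^sup>2 / (\<phi>\<^sup>2 * \<bar>dg ! i\<bar> * \<bar>dg ! j\<bar>)) = (b i j)\<^sup>2 / (\<phi>\<^sup>2 * d\<^sup>2)" if "j < n" for j
    proof (cases "b i i = 0 \<or> b j j = 0")
      case True
      \<comment> \<open>A vanishing diagonal entry forces \<open>b i j = 0\<close>, so both sides
        are 0 and the division by 0 does no harm.\<close>
      then show ?thesis using bound[OF \<open>i < n\<close> that] that \<open>i < n\<close> by (auto simp: dg)
    next
      case False
      then show ?thesis using that \<open>i < n\<close> \<open>0 < d\<close> \<phi> by (auto simp: D dg field_simps power2_eq_square)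
    qed
    then show ?thesis
      by (subst pmf_proposal[OF setD acc that]) (auto simp: sum_divide_distrib)
  qed
  have "(\<Sum>x\<in>insert None (Some ` {..<n}). pmf ?Q x) = 1"
    using set_proposal[OF setD] by (intro sum_pmf_eq_1) auto
  then have None: "1 - pmf ?Q None = R2 / (\<phi>\<^sup>2 * d\<^sup>2)"
    by (simp add: sum.reindex Some R2_def sum_divide_distrib)
  have "R2 \<noteq> 0"
  proof
    assume "R2 = 0"
    then have "\<forall>i<n. \<forall>j<n. b i j = 0" by (simp add: R2_def sum_nonneg_eq_0_iff sum_nonneg)
    then show False using d by simp
  qed
  moreover have "0 \<le> R2" by (simp add: R2_def sum_nonneg)
  ultimately have "0 < R2" by simp
  then have pos: "pmf ?Q None < 1"
    using None \<open>0 < d\<close> \<phi> by (smt (verit) divide_pos_pos mult_pos_pos zero_less_power)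
  note unfold = rejection_loop_unfold[where entry=entry and b=b and \<phi>=\<phi> and dg=dg and D=D, OF entry]
  have "result ?L = bind_pmf ?Q (\<lambda>x. case x of None \<Rightarrow> result ?L | Some i \<Rightarrow> return_spmf i)"
    by (subst unfold)
      (auto simp: result_def shift_def map_bind_pmf spmf.map_comp o_def split_def
        intro!: bind_pmf_cong split: option.split)
  then obtain P where P: "result ?L = spmf_of_pmf P" "\<And>i. (1 - pmf ?Q None) * pmf P i = pmf ?Q (Some i)"
    using pos by (rule retry_result) blast
  have "set_pmf P \<subseteq> {..<n}"
  proof
    fix i assume "i \<in> set_pmf P"
    then have "pmf P i \<noteq> 0" by (simp add: set_pmf_iff)
    then have "pmf ?Q (Some i) \<noteq> 0" using P(2)[of i] pos by auto
    then have "Some i \<in> set_pmf ?Q" by (simp add: set_pmf_iff)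
    then show "i \<in> {..<n}" using set_proposal[OF setD] by auto
  qed
  moreover have "R2 * pmf P i = (\<Sum>j<n. (b i j)\<^sup>2)" if "i < n" for i
    using P(2)[of i] Some[OF that] \<open>0 < d\<close> \<phi> by (simp add: None field_simps)
  ultimately show "\<exists>P. result ?L = spmf_of_pmf P \<and> set_pmf P \<subseteq> {..<n} \<and>
      (\<forall>i<n. R2 * pmf P i = (\<Sum>j<n. (b i j)\<^sup>2))"
    using P(1) by blast
  have "d\<^sup>2 \<le> real n * R2"
  proof -
    have "d\<^sup>2 = (\<Sum>i<n. \<bar>b i i\<bar> * 1)\<^sup>2" by (simp add: d)
    also have "\<dots> \<le> (\<Sum>i<n. \<bar>b i i\<bar>\<^sup>2) * (\<Sum>i<n. 1\<^sup>2)" by (rule Cauchy_Schwarz_ineq_sum)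
    also have "\<dots> = real n * (\<Sum>i<n. (b i i)\<^sup>2)" by simp
    also have "\<dots> \<le> real n * R2"
      unfolding R2_def by (intro mult_left_mono sum_mono) (auto intro: member_le_sum)
    finally show ?thesis .
  qed
  have "ecost u v ?L \<le> ennreal (real (u * 3 + v * 18) / (1 - pmf ?Q None))"
    using unfold pos by (rule retry_cost)
  also have "\<dots> \<le> ennreal ((3 * real u + 18 * real v) * (\<phi>\<^sup>2 * real n))"
  proof (rule ennreal_leI)
    have "real (u * 3 + v * 18) / (1 - pmf ?Q None) = (3 * real u + 18 * real v) * (\<phi>\<^sup>2 * (d\<^sup>2 / R2))"
      unfolding None using \<open>0 < R2\<close> by (simp add: field_simps)
    also have "\<dots> \<le> (3 * real u + 18 * real v) * (\<phi>\<^sup>2 * real n)"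
      using \<open>d\<^sup>2 \<le> real n * R2\<close> \<open>0 < R2\<close> by (intro mult_left_mono) (auto simp: field_simps)
    finally show "real (u * 3 + v * 18) / (1 - pmf ?Q None) \<le> (3 * real u + 18 * real v) * (\<phi>\<^sup>2 * real n)" .
  qed
  finally show "ecost u v ?L \<le> ennreal ((3 * real u + 18 * real v) * (\<phi>\<^sup>2 * real n))" .
qed

text \<open>The law is stated without dividing by \<open>R2\<close>, so it also makes sense for the
  zero matrix. If the diagonal vanishes, \<open>bound\<close> makes the whole matrix 0, and the
  index 0 returned by the program satisfies the identity trivially.\<close>

lemma robust_sample_correct:
  fixes b :: "nat \<Rightarrow> nat \<Rightarrow> real"
  assumes entry: "\<And>i j. entry i j = return_spmf (b i j, 3, 8)"
    and bound: "\<And>i j. i < n \<Longrightarrow> j < n \<Longrightarrow> (b i j)\<^sup>2 \<le> \<phi>\<^sup>2 * (\<bar>b i i\<bar> * \<bar>b j j\<bar>)"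
    and \<phi>: "1 \<le> \<phi>" and n: "1 \<le> n"
  defines "R2 \<equiv> \<Sum>i<n. \<Sum>j<n. (b i j)\<^sup>2"
  shows "\<exists>P. result (robust_sample entry \<phi> n) = spmf_of_pmf P \<and> set_pmf P \<subseteq> {..<n} \<and>
      (\<forall>i<n. R2 * pmf P i = (\<Sum>j<n. (b i j)\<^sup>2))"
    and "ecost u v (robust_sample entry \<phi> n) \<le> ennreal ((6 * real u + 32 * real v) * (\<phi>\<^sup>2 * real n))"
proof -
  define dg where "dg = map (\<lambda>i. b i i) [0..<n]"
  define d where "d = (\<Sum>i<n. \<bar>b i i\<bar>)"
  define p where "p = (\<lambda>i. \<bar>b i i\<bar> / d)"
  have dg: "dg ! i = b i i" if "i < n" for i using that by (simp add: dg_def)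
  have read: "result (for_each [0..<n] (\<lambda>i. entry i i)) = return_spmf dg"
    unfolding dg_def by (intro result_for_each_return) (simp add: entry)
  have dsum: "(\<Sum>i<n. \<bar>dg ! i\<bar>) = d" by (simp add: d_def dg)
  have table: "table_pmf n (\<lambda>i. \<bar>dg ! i\<bar> / d) = table_pmf n p"
    by (simp add: table_pmf_def p_def dg cong: if_cong)
  have D: "pmf (table_pmf n p) i = (if i < n then \<bar>b i i\<bar> / d else 0)" if "d \<noteq> 0" for i
  proof -
    have "0 \<le> d" by (simp add: d_def sum_nonneg)
    then show ?thesis using that
      by (subst pmf_table_pmf) (auto simp: p_def d_def sum_divide_distrib[symmetric])
  qed
  have loop: "d \<noteq> 0 \<Longrightarrow> \<exists>P. result (rejection_loop entry \<phi> dg (table_pmf n p)) = spmf_of_pmf P \<and>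
      set_pmf P \<subseteq> {..<n} \<and> (\<forall>i<n. R2 * pmf P i = (\<Sum>j<n. (b i j)\<^sup>2))"
    "d \<noteq> 0 \<Longrightarrow> ecost u v (rejection_loop entry \<phi> dg (table_pmf n p))
      \<le> ennreal ((3 * real u + 18 * real v) * (\<phi>\<^sup>2 * real n))"
    unfolding R2_def using \<phi> D
    by (auto intro!: rejection_loop_correct[where b=b and n=n and d=d] simp: entry dg bound d_def)
  have res: "result (robust_sample entry \<phi> n)
    = (if d = 0 then return_spmf 0 else result (rejection_loop entry \<phi> dg (table_pmf n p)))"
    by (simp add: robust_sample_def read dsum table)
  show "\<exists>P. result (robust_sample entry \<phi> n) = spmf_of_pmf P \<and> set_pmf P \<subseteq> {..<n} \<and>
      (\<forall>i<n. R2 * pmf P i = (\<Sum>j<n. (b i j)\<^sup>2))"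
  proof (cases "d = 0")
    case True
    then have "\<forall>i<n. b i i = 0" by (simp add: d_def sum_nonneg_eq_0_iff)
    then have "b i j = 0" if "i < n" "j < n" for i j using bound[OF that] that by simp
    then have "R2 * pmf (return_pmf 0) i = (\<Sum>j<n. (b i j)\<^sup>2)" if "i < n" for i
      using that by (simp add: R2_def)
    then show ?thesis using True n by (intro exI[of _ "return_pmf 0"]) (simp add: res)
  next
    case False
    then show ?thesis using loop(1) by (simp add: res)
  qed
  let ?n = "real n" and ?u = "real u" and ?v = "real v"
  let ?l = "(3 * ?u + 18 * ?v) * (\<phi>\<^sup>2 * ?n)"
  have "ecost u v (robust_sample entry \<phi> n)
    \<le> ennreal (?n * (3 * ?u + 8 * ?v) + (?v * real (2 * n) + (?v * real 1 + (?v * real (2 * n) + (?v * ?n + ?l)))))"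
    unfolding robust_sample_def
  proof (intro ecost_bind)
    show "ecost u v (for_each [0..<n] (\<lambda>i. entry i i)) \<le> ennreal (?n * (3 * ?u + 8 * ?v))"
      using ecost_for_each[of "[0..<n]" u v "\<lambda>i. entry i i" "3 * ?u + 8 * ?v"]
      by (simp add: entry ecost_return mult.commute)
  next
    fix dg' d' zero
    assume "dg' \<in> set_spmf (result (for_each [0..<n] (\<lambda>i. entry i i)))"
      and "d' \<in> set_spmf (result (charge (2 * n) (\<Sum>i<n. \<bar>dg' ! i\<bar>)))"
      and "zero \<in> set_spmf (result (charge 1 (d' = 0)))"
    then have *: "dg' = dg" "d' = d" "zero = (d = 0)" by (simp_all add: read dsum)
    show "ecost u v (if zero then ret 0 else bind_prog (charge (2 * n) (\<lambda>i. \<bar>dg' ! i\<bar> / d'))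
        (\<lambda>p. bind_prog (make_table n p) (rejection_loop entry \<phi> dg')))
      \<le> ennreal (?v * real (2 * n) + (?v * ?n + ?l))"
    proof (cases "d = 0")
      case True
      then show ?thesis using ecost_ret[of u v "0::nat"] by (simp add: *)
    next
      case False
      have "ecost u v (bind_prog (charge (2 * n) (\<lambda>i. \<bar>dg' ! i\<bar> / d'))
          (\<lambda>p. bind_prog (make_table n p) (rejection_loop entry \<phi> dg')))
        \<le> ennreal (?v * real (2 * n) + (?v * ?n + ?l))"
        using loop(2)[OF False] by (intro ecost_bind ecost_charge ecost_make_table) (auto simp: * table)
      then show ?thesis using False by (simp add: *)
    qed
  qed (auto intro!: ecost_charge[THEN order_trans] add_nonneg_nonneg mult_nonneg_nonneg)
  also have "\<dots> \<le> ennreal ((6 * ?u + 32 * ?v) * (\<phi>\<^sup>2 * ?n))"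
  proof (rule ennreal_leI)
    \<comment> \<open>Preparing the diagonal and the table costs at most \<open>3 * n\<close>
      queries and \<open>14 * n\<close> operations; \<open>n \<le> \<phi>\<^sup>2 * n\<close> adds
      them to the 3 and 18 of the loop, giving 6 and 32.\<close>
    have "1 \<le> \<phi>\<^sup>2" using \<phi> by simp
    then have le: "?n \<le> \<phi>\<^sup>2 * ?n" using mult_right_mono[of 1 "\<phi>\<^sup>2" ?n] by simp
    have "?n * (3 * ?u + 8 * ?v) + (?v * real (2 * n) + (?v * real 1 + (?v * real (2 * n) + (?v * ?n + ?l))))
      \<le> (3 * ?u + 14 * ?v) * ?n + ?l"
      using n mult_left_mono[of 1 ?n ?v] by (simp add: algebra_simps)
    also have "\<dots> \<le> (3 * ?u + 14 * ?v) * (\<phi>\<^sup>2 * ?n) + ?l"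
      using le by (intro add_right_mono mult_left_mono) auto
    also have "\<dots> = (6 * ?u + 32 * ?v) * (\<phi>\<^sup>2 * ?n)" by (simp add: algebra_simps)
    finally show "?n * (3 * ?u + 8 * ?v) + (?v * real (2 * n) + (?v * real 1 + (?v * real (2 * n) + (?v * ?n + ?l))))
      \<le> (6 * ?u + 32 * ?v) * (\<phi>\<^sup>2 * ?n)" .
  qed
  finally show "ecost u v (robust_sample entry \<phi> n) \<le> ennreal ((6 * ?u + 32 * ?v) * (\<phi>\<^sup>2 * ?n))" .
qed


section \<open>Output distribution and cost of the algorithm\<close>

definition list_vec :: "nat \<Rightarrow> (nat \<Rightarrow> real) \<Rightarrow> real vec" where
  "list_vec n f = vec_of_list (map f [0..<n])"

lemma list_vec_index: "i < n \<Longrightarrow> list_vec n f $ i = f i"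
  unfolding list_vec_def vec_of_list_index by simp

lemma list_vec_carrier: "list_vec n f \<in> carrier_vec n"
  by (intro carrier_vecI) (simp add: list_vec_def)

definition normalized_col :: "nat \<Rightarrow> (nat \<Rightarrow> nat \<Rightarrow> real) \<Rightarrow> nat \<Rightarrow> real vec" where
  "normalized_col n b j =
     (1 / euclid_norm (list_vec n (\<lambda>i. b i j))) \<cdot>\<^sub>v list_vec n (\<lambda>i. b i j)"

definition row_pmf :: "nat \<Rightarrow> nat \<Rightarrow> real mat \<Rightarrow> nat pmf" where
  "row_pmf n k X = table_pmf n (\<lambda>i. (euclid_norm (row X i))\<^sup>2 / real k)"

definition right_factor :: "nat \<Rightarrow> (nat \<Rightarrow> nat \<Rightarrow> real) \<Rightarrow> nat \<Rightarrow> nat \<Rightarrow> real mat \<Rightarrow> nat list \<Rightarrow> real mat" where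
  "right_factor n b k t X Js = (1 / real t) \<cdot>\<^sub>m
     (transpose_mat (mat_of_rows n (map (\<lambda>i. list_vec n (b i)) Js)) *
      mat_of_rows k (map (\<lambda>i. (1 / ((euclid_norm (row X i))\<^sup>2 / real k)) \<cdot>\<^sub>v row X i) Js))"

text \<open>The output law of the algorithm with all costs removed: two samples of independent
  indices, where the first determines \<open>X\<close> and thereby the law of the second.\<close>

definition factors_pmf ::
  "nat \<Rightarrow> (nat \<Rightarrow> nat \<Rightarrow> real) \<Rightarrow> nat pmf \<Rightarrow> (real mat \<Rightarrow> real mat) \<Rightarrow> nat \<Rightarrow> nat \<Rightarrow> nat \<Rightarrow> (real mat \<times> real mat) pmf"
  where
  "factors_pmf n b P lsv k s t = bind_pmf (replicate_pmf s P) (\<lambda>Is.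
     let X = lsv (mat_of_cols n (map (normalized_col n b) Is))
     in map_pmf (\<lambda>Js. (X, right_factor n b k t X Js)) (replicate_pmf t (row_pmf n k X)))"

context
  fixes entry :: "nat \<Rightarrow> nat \<Rightarrow> real prog" and b :: "nat \<Rightarrow> nat \<Rightarrow> real"
  assumes entry: "\<And>i j. entry i j = return_spmf (b i j, 3, 8)"
begin

lemma result_read_line:
  "result (for_each [0..<n] (\<lambda>i. entry (f i) (g i))) = return_spmf (map (\<lambda>i. b (f i) (g i)) [0..<n])"
  by (intro result_for_each_return) (simp add: entry)

lemma result_read_cols:
  "result (for_each Is (\<lambda>j. run es \<leftarrow> for_each [0..<n] (\<lambda>i. entry i j);
      charge c ((1 / euclid_norm (vec_of_list es)) \<cdot>\<^sub>v vec_of_list es)))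
   = return_spmf (map (normalized_col n b) Is)"
  by (intro result_for_each_return) (simp add: result_read_line normalized_col_def list_vec_def)

lemma result_read_rows:
  "result (for_each Js (\<lambda>i. run es \<leftarrow> for_each [0..<n] (\<lambda>j. entry i j); ret (vec_of_list es)))
   = return_spmf (map (\<lambda>i. list_vec n (b i)) Js)"
  by (intro result_for_each_return) (simp add: result_read_line list_vec_def)

lemma result_low_rank_approx:
  assumes "result sampler = spmf_of_pmf P"
  shows "result (low_rank_approx entry sampler svd svd_ops mm_ops C C' n k \<epsilon>)
    = spmf_of_pmf (factors_pmf n b P (svd k) k (nat \<lceil>C * real k / \<epsilon>\<^sup>2\<rceil>) (nat \<lceil>C' * real k / \<epsilon>\<rceil>))"
  unfolding low_rank_approx_def factors_pmf_def
  by (simp add: result_for_each_const[OF assms] result_for_each_const result_read_cols result_read_rows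
      result_for_each_charge spmf_of_pmf_bind row_pmf_def[symmetric] right_factor_def
      map_pmf_def Let_def)

lemma ecost_read_line:
  "ecost u v (for_each [0..<n] (\<lambda>i. entry (f i) (g i))) \<le> ennreal (real n * (3 * real u + 8 * real v))"
  using ecost_for_each[of "[0..<n]" u v "\<lambda>i. entry (f i) (g i)" "3 * real u + 8 * real v"]
  by (simp add: entry ecost_return mult.commute)

text \<open>The bound is left as a nested sum with one summand per statement of the program, so that
  repeated use of \<open>ecost_bind\<close> matches it. The result laws of the sampling steps show
  that the index lists have lengths \<open>s\<close> and \<open>t\<close>.\<close>

lemma ecost_low_rank_approx:
  fixes C C' \<epsilon> c\<^sub>s :: real and n k u v :: nat
  assumes res: "result sampler = spmf_of_pmf P"
    and sampler: "ecost u v sampler \<le> ennreal c\<^sub>s" and "0 \<le> c\<^sub>s"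
  defines "s \<equiv> nat \<lceil>C * real k / \<epsilon>\<^sup>2\<rceil>" and "t \<equiv> nat \<lceil>C' * real k / \<epsilon>\<rceil>"
    and "c\<^sub>l \<equiv> real n * (3 * real u + 8 * real v)"
  shows "ecost u v (low_rank_approx entry sampler svd svd_ops mm_ops C C' n k \<epsilon>)
    \<le> ennreal (real v * real 7 + (real s * c\<^sub>s + (real s * (c\<^sub>l + real v * real (3 * n)) + (real v * real (svd_ops n s)
      + (real v * real (2 * n * k) + (real v * real n + (real t * real v + (real t * (c\<^sub>l + 0)
      + (real t * (real v * real (3 * k)) + (real v * real (rect_mult_ops mm_ops n t k)
      + (real v * real (n * k) + 0)))))))))))"
proof -
  have cl: "0 \<le> c\<^sub>l" by (simp add: c\<^sub>l_def)
  show ?thesis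
    unfolding low_rank_approx_def s_def[symmetric] t_def[symmetric]
  proof (rule ecost_charge_pair, intro ecost_bind, goal_cases)
    case 1
    show ?case using ecost_for_each[of "[0..<s]" u v "\<lambda>_. sampler"] sampler \<open>0 \<le> c\<^sub>s\<close> by simp
  next
    case (2 Is)
    then have len: "length Is = s"
      by (simp add: result_for_each_const[OF res] set_replicate_pmf)
    show ?case
      unfolding len[symmetric] using cl
      by (intro ecost_for_each ecost_bind ecost_charge) (auto simp: c\<^sub>l_def ecost_read_line)
  next
    case (3 Is cs)
    show ?case by (rule ecost_charge)
  next
    case (4 Is cs X)
    show ?case by (rule ecost_charge)
  next
    case (5 Is cs X p)
    show ?case by (rule ecost_make_table)
  next
    case (6 Is cs X p S)
    show ?case using ecost_for_each[of "[0..<t]" u v "\<lambda>_. draw S" "real v"] ecost_draw by simp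
  next
    case (7 Is cs X p S Js)
    then have len: "length Js = t" by (simp add: result_for_each_const set_replicate_pmf)
    show ?case
      unfolding len[symmetric] using cl
      by (intro ecost_for_each ecost_bind ecost_ret) (auto simp: c\<^sub>l_def ecost_read_line)
  next
    case (8 Is cs X p S Js rs)
    then have len: "length Js = t" by (simp add: result_for_each_const set_replicate_pmf)
    show ?case
      unfolding len[symmetric] by (intro ecost_for_each ecost_charge) auto
  next
    case (9 Is cs X p S Js rs zs)
    then have len: "length Js = t" by (simp add: result_for_each_const set_replicate_pmf)
    from 9 have "length rs = t" by (simp add: result_read_rows len)
    then show ?case unfolding mult_prog_def using ecost_charge by (simp add: mat_of_rows_def)
  next
    case (10 Is cs X p S Js rs zs R)
    show ?case by (rule ecost_charge)
  next
    case (11 Is cs X p S Js rs zs R Y)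
    show ?case by (rule ecost_ret)
  qed (use \<open>0 \<le> c\<^sub>s\<close> cl in \<open>simp_all add: add_nonneg_nonneg\<close>)
qed

end


section \<open>Error analysis\<close>

text \<open>Built on \<open>L2_set\<close> over index pairs, from which it inherits the triangle
  inequality.\<close>

definition fro :: "nat \<Rightarrow> nat \<Rightarrow> (nat \<Rightarrow> nat \<Rightarrow> real) \<Rightarrow> real" where
  "fro n m f = L2_set (\<lambda>(i, j). f i j) ({..<n} \<times> {..<m})"

lemma fro_nonneg [simp]: "0 \<le> fro n m f"
  by (simp add: fro_def)

lemma fro_sq: "(fro n m f)\<^sup>2 = (\<Sum>i<n. \<Sum>j<m. (f i j)\<^sup>2)"
  by (simp add: fro_def L2_set_def sum_nonneg split_def sum.cartesian_product)

lemma fro_sq_ip: "(fro n m f)\<^sup>2 = (\<Sum>i<n. ip m (f i) (f i))"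
  by (simp add: fro_sq ip_self)

lemma fro_cong: "(\<And>i j. i < n \<Longrightarrow> j < m \<Longrightarrow> f i j = g i j) \<Longrightarrow> fro n m f = fro n m g"
  unfolding fro_def by (intro L2_set_cong) auto

lemma fro_swap: "fro n m (\<lambda>i j. f j i) = fro m n f"
  by (rule power2_eq_imp_eq) (simp_all add: fro_sq, rule sum.swap)

lemma fro_triangle: "fro n m (\<lambda>i j. f i j + g i j) \<le> fro n m f + fro n m g"
  unfolding fro_def
  using L2_set_triangle_ineq[of "\<lambda>(i, j). f i j" "\<lambda>(i, j). g i j" "{..<n} \<times> {..<m}"]
  by (simp add: split_def)

lemma fro_minus_commute: "fro n m (\<lambda>i j. f i j - g i j) = fro n m (\<lambda>i j. g i j - f i j)"
  by (rule power2_eq_imp_eq) (simp_all add: fro_sq power2_commute)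

lemma fro_le_fro_diff: "fro n m f \<le> fro n m g + fro n m (\<lambda>i j. f i j - g i j)"
  using fro_triangle[of n m g "\<lambda>i j. f i j - g i j"] by simp

lemma L2_set_le_diff:
  fixes f g :: "'a \<Rightarrow> real"
  shows "L2_set f A \<le> L2_set g A + L2_set (\<lambda>i. f i - g i) A"
  using L2_set_triangle_ineq[of g "\<lambda>i. f i - g i" A] by simp

lemma L2_set_diff_commute: "L2_set (\<lambda>i. f i - g i) A = L2_set (\<lambda>i. g i - f i) A"
  by (simp add: L2_set_def power2_commute)

lemma abs_L2_set_diff_le:
  "\<bar>L2_set f A - L2_set g A\<bar> \<le> L2_set (\<lambda>i. f i - g i) A"
  using L2_set_le_diff[of f A g] L2_set_le_diff[of g A f] L2_set_diff_commute[of f g A] by linarith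

section \<open>Row norms against column norms\<close>

definition col_norm :: "nat \<Rightarrow> (nat \<Rightarrow> nat \<Rightarrow> real) \<Rightarrow> nat \<Rightarrow> real" where
  "col_norm n b i = L2_set (\<lambda>x. b x i) {..<n}"

definition unit_col :: "nat \<Rightarrow> (nat \<Rightarrow> nat \<Rightarrow> real) \<Rightarrow> nat \<Rightarrow> nat \<Rightarrow> real" where
  "unit_col n b i x = b x i / col_norm n b i"

text \<open>Sampling by row norms but reading columns amounts, for nonsymmetric \<open>b\<close>, to length-squared
  sampling of this matrix (here indexed by column first).\<close>

definition mixed_col :: "nat \<Rightarrow> (nat \<Rightarrow> nat \<Rightarrow> real) \<Rightarrow> nat \<Rightarrow> nat \<Rightarrow> real" where
  "mixed_col n b i x = L2_set (b i) {..<n} * unit_col n b i x"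

lemma col_norm_eq_0: "col_norm n b i = 0 \<Longrightarrow> x < n \<Longrightarrow> b x i = 0"
  by (simp add: col_norm_def L2_set_eq_0_iff)

text \<open>An inequality, because a zero column remains zero when divided by its norm.\<close>

lemma unit_col_norm_le: "(\<Sum>x<n. (unit_col n b i x)\<^sup>2) \<le> 1"
proof -
  have "(\<Sum>x<n. (unit_col n b i x)\<^sup>2) = (\<Sum>x<n. (b x i)\<^sup>2) / (col_norm n b i)\<^sup>2"
    by (simp add: unit_col_def power_divide sum_divide_distrib)
  also have "\<dots> \<le> 1" by (simp add: col_norm_def L2_set_def sum_nonneg)
  finally show ?thesis .
qed

text \<open>The mixed column is the true column rescaled from its own length to the length of row
  \<open>i\<close>, so the two differ by at most the difference of these lengths. For a zero column
  both vanish.\<close>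

lemma mixed_col_dist:
  "L2_set (\<lambda>x. mixed_col n b i x - b x i) {..<n} \<le> \<bar>L2_set (b i) {..<n} - col_norm n b i\<bar>"
proof -
  let ?r = "L2_set (b i) {..<n}" and ?c = "col_norm n b i"
  have "mixed_col n b i x - b x i = (?r - ?c) * unit_col n b i x" if "x < n" for x
  proof (cases "?c = 0")
    case True
    then show ?thesis using col_norm_eq_0[OF True that] by (simp add: mixed_col_def unit_col_def)
  next
    case False
    then show ?thesis by (simp add: mixed_col_def unit_col_def left_diff_distrib diff_divide_distrib)
  qed
  then have "L2_set (\<lambda>x. mixed_col n b i x - b x i) {..<n} = L2_set (\<lambda>x. (?r - ?c) * unit_col n b i x) {..<n}"
    by (intro L2_set_cong) auto
  also have "\<dots> = \<bar>?r - ?c\<bar> * sqrt (\<Sum>x<n. (unit_col n b i x)\<^sup>2)"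
    by (simp add: L2_set_def power_mult_distrib sum_distrib_left[symmetric] real_sqrt_mult)
  also have "\<dots> \<le> \<bar>?r - ?c\<bar> * 1"
    using unit_col_norm_le[of n b i] by (intro mult_left_mono) auto
  finally show ?thesis by simp
qed

lemma fro_mixed_col_le: "fro n n (mixed_col n b) \<le> fro n n b"
proof (rule power2_le_imp_le)
  have "(fro n n (mixed_col n b))\<^sup>2 = (\<Sum>i<n. (L2_set (b i) {..<n})\<^sup>2 * (\<Sum>x<n. (unit_col n b i x)\<^sup>2))"
    by (simp add: fro_sq mixed_col_def power_mult_distrib sum_distrib_left)
  also have "\<dots> \<le> (\<Sum>i<n. (L2_set (b i) {..<n})\<^sup>2 * 1)"
    by (intro sum_mono mult_left_mono unit_col_norm_le) auto
  also have "\<dots> = (fro n n b)\<^sup>2" by (simp add: fro_sq L2_set_def sum_nonneg)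
  finally show "(fro n n (mixed_col n b))\<^sup>2 \<le> (fro n n b)\<^sup>2" .
qed simp

text \<open>The factor 3 arises line by line. The columns themselves differ by \<open>q i\<close>.
  Rows and columns of the symmetric \<open>a\<close> have equal norms, so a row norm and a column
  norm of \<open>b\<close> differ by at most \<open>p i + q i\<close>. Both \<open>p\<close> and
  \<open>q\<close> have the noise as their total norm.\<close>

lemma mixed_col_diff_le:
  assumes sym: "\<And>i j. i < n \<Longrightarrow> j < n \<Longrightarrow> a i j = a j i"
  shows "fro n n (\<lambda>i x. mixed_col n b i x - a i x) \<le> 3 * fro n n (\<lambda>i j. b i j - a i j)"
proof -
  define p where "p i = L2_set (\<lambda>j. b i j - a i j) {..<n}" for i
  define q where "q i = L2_set (\<lambda>j. b j i - a j i) {..<n}" for i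
  have psum: "L2_set p {..<n} = fro n n (\<lambda>i j. b i j - a i j)"
    by (rule power2_eq_imp_eq) (simp_all add: p_def L2_set_def fro_sq sum_nonneg)
  have qsum: "L2_set q {..<n} = fro n n (\<lambda>i j. b i j - a i j)"
    by (subst fro_swap[symmetric], rule power2_eq_imp_eq)
      (simp_all add: q_def L2_set_def fro_sq sum_nonneg)
  have row: "L2_set (\<lambda>x. mixed_col n b i x - a i x) {..<n} \<le> (p i + q i) + q i" if "i < n" for i
  proof -
    have col_a: "L2_set (\<lambda>x. a x i) {..<n} = L2_set (a i) {..<n}"
      using sym that by (intro L2_set_cong) auto
    have "L2_set (\<lambda>x. mixed_col n b i x - a i x) {..<n}
      = L2_set (\<lambda>x. (mixed_col n b i x - b x i) + (b x i - a x i)) {..<n}"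
      using sym that by (intro L2_set_cong) auto
    also have "\<dots> \<le> L2_set (\<lambda>x. mixed_col n b i x - b x i) {..<n} + q i"
      unfolding q_def by (rule L2_set_triangle_ineq)
    also have "\<dots> \<le> \<bar>L2_set (b i) {..<n} - col_norm n b i\<bar> + q i"
      using mixed_col_dist by simp
    also have "\<bar>L2_set (b i) {..<n} - col_norm n b i\<bar> \<le> p i + q i"
      using abs_L2_set_diff_le[of "b i" "{..<n}" "a i"]
        abs_L2_set_diff_le[of "\<lambda>x. b x i" "{..<n}" "\<lambda>x. a x i"]
      unfolding col_a by (simp add: p_def q_def col_norm_def)
    finally show ?thesis by simp
  qed
  have "fro n n (\<lambda>i x. mixed_col n b i x - a i x)
    = L2_set (\<lambda>i. L2_set (\<lambda>x. mixed_col n b i x - a i x) {..<n}) {..<n}"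
    by (rule power2_eq_imp_eq) (simp_all add: L2_set_def fro_sq sum_nonneg)
  also have "\<dots> \<le> L2_set (\<lambda>i. (p i + q i) + q i) {..<n}"
    using row by (intro L2_set_mono) auto
  also have "\<dots> \<le> L2_set (\<lambda>i. p i + q i) {..<n} + L2_set q {..<n}"
    by (rule L2_set_triangle_ineq)
  also have "\<dots> \<le> (L2_set p {..<n} + L2_set q {..<n}) + L2_set q {..<n}"
    using L2_set_triangle_ineq[of p q "{..<n}"] by simp
  finally show ?thesis by (simp add: psum qsum)
qed

text \<open>For a symmetric form, the values at \<open>v\<close> and \<open>w\<close> differ by the
  mixed value at \<open>v - w\<close> and \<open>v + w\<close>. Treating both projections together
  keeps the constant 1, where separate estimates would give 2, and no factor depending on
  \<open>k\<close> appears.\<close>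

lemma proj_form_perturbation:
  assumes u: "orthonormal n k u" and x: "orthonormal n l x"
  shows "(\<Sum>j<m. proj_form n k u (v j) (v j) - proj_form n l x (v j) (v j))
    \<le> (\<Sum>j<m. proj_form n k u (w j) (w j) - proj_form n l x (w j) (w j))
      + fro m n (\<lambda>j i. v j i - w j i) * fro m n (\<lambda>j i. v j i + w j i)"
proof -
  let ?d = "\<lambda>v w. proj_form n k u v w - proj_form n l x v w"
  let ?S = "\<Sum>j<m. ?d (\<lambda>i. v j i - w j i) (\<lambda>i. v j i + w j i)"
  have "?S\<^sup>2 \<le> (fro m n (\<lambda>j i. v j i - w j i))\<^sup>2 * (fro m n (\<lambda>j i. v j i + w j i))\<^sup>2"
    using proj_form_diff_bound[OF u x, where v="\<lambda>j i. v j i - w j i" and w="\<lambda>j i. v j i + w j i"]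
    by (simp only: fro_sq_ip)
  then have "?S\<^sup>2 \<le> (fro m n (\<lambda>j i. v j i - w j i) * fro m n (\<lambda>j i. v j i + w j i))\<^sup>2"
    by (simp add: power_mult_distrib)
  then have "?S \<le> fro m n (\<lambda>j i. v j i - w j i) * fro m n (\<lambda>j i. v j i + w j i)"
    by (rule power2_le_imp_le) simp
  moreover have "?S = (\<Sum>j<m. ?d (v j) (v j)) - (\<Sum>j<m. ?d (w j) (w j))"
    by (simp add: proj_form_difference[symmetric] sum_subtractf)
  ultimately show ?thesis by simp
qed

section \<open>Error of column sampling\<close>

definition gram_deviation :: "nat \<Rightarrow> (nat \<Rightarrow> nat \<Rightarrow> real) \<Rightarrow> nat pmf \<Rightarrow> nat \<Rightarrow> nat list \<Rightarrow> real" where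
  "gram_deviation n b P s Is = (\<Sum>(x, y)\<in>{..<n} \<times> {..<n}. ((\<Sum>i\<leftarrow>Is. unit_col n b i x * unit_col n b i y)
     - real s * measure_pmf.expectation P (\<lambda>i. unit_col n b i x * unit_col n b i y))\<^sup>2)"

text \<open>The outer product of a vector of norm at most 1 with itself has Frobenius norm at most
  1. So one sample has second moment at most 1, independently of the dimension.\<close>

lemma prob_gram_deviation:
  assumes P: "finite (set_pmf P)"
  shows "9 / 10 \<le> measure_pmf.prob (replicate_pmf s P) {Is. gram_deviation n b P s Is \<le> 10 * real s}"
proof -
  have int: "integrable (measure_pmf P) f" for f :: "nat \<Rightarrow> real"
    using P by (rule integrable_measure_pmf_finite)
  have le: "(\<Sum>(x, y)\<in>{..<n} \<times> {..<n}. (unit_col n b i x * unit_col n b i y)\<^sup>2) \<le> 1" for i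
  proof -
    have "(\<Sum>(x, y)\<in>{..<n} \<times> {..<n}. (unit_col n b i x * unit_col n b i y)\<^sup>2)
      = (\<Sum>x<n. (unit_col n b i x)\<^sup>2) * (\<Sum>x<n. (unit_col n b i x)\<^sup>2)"
      by (simp add: sum.cartesian_product[symmetric] sum_product power_mult_distrib)
    also have "\<dots> \<le> 1 * 1"
      using unit_col_norm_le by (intro mult_mono) (auto simp: sum_nonneg)
    finally show ?thesis by simp
  qed
  have "(\<Sum>\<kappa>\<in>{..<n} \<times> {..<n}. measure_pmf.expectation P (\<lambda>i. (unit_col n b i (fst \<kappa>) * unit_col n b i (snd \<kappa>))\<^sup>2))
    = measure_pmf.expectation P (\<lambda>i. \<Sum>\<kappa>\<in>{..<n} \<times> {..<n}. (unit_col n b i (fst \<kappa>) * unit_col n b i (snd \<kappa>))\<^sup>2)"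
    by (simp add: int)
  also have "\<dots> \<le> measure_pmf.expectation P (\<lambda>i. 1)"
    using le by (intro integral_mono int) (simp add: split_def)
  finally have "(\<Sum>\<kappa>\<in>{..<n} \<times> {..<n}. measure_pmf.expectation P (\<lambda>i. (unit_col n b i (fst \<kappa>) * unit_col n b i (snd \<kappa>))\<^sup>2)) \<le> 1"
    by simp
  from sample_deviation[OF P this, of s] show ?thesis
    by (simp add: gram_deviation_def split_def)
qed

text \<open>The deviation of the energy is the entrywise inner product of the projection matrix with
  the deviation of the Gram matrix. By Cauchy-Schwarz its square is at most \<open>k\<close> times
  \<open>10 * s\<close>. Since only \<open>dev\<close> refers to the sample, \<open>u\<close> may
  depend on it.\<close>

lemma sampled_energy:
  assumes P: "finite (set_pmf P)" and u: "orthonormal n l u" and "l \<le> k"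
    and dev: "gram_deviation n b P s Is \<le> 10 * real s"
  shows "\<bar>(\<Sum>i\<leftarrow>Is. proj_form n l u (unit_col n b i) (unit_col n b i))
    - real s * measure_pmf.expectation P (\<lambda>i. proj_form n l u (unit_col n b i) (unit_col n b i))\<bar>
    \<le> sqrt (10 * real k * real s)"
proof -
  let ?c = "unit_col n b" and ?N = "{..<n} \<times> {..<n}"
  define G where "G x y = (\<Sum>a<l. u a x * u a y)" for x y
  define d where "d x y = (\<Sum>i\<leftarrow>Is. ?c i x * ?c i y) - real s * measure_pmf.expectation P (\<lambda>i. ?c i x * ?c i y)" for x y
  have int: "integrable (measure_pmf P) f" for f :: "nat \<Rightarrow> real"
    using P by (rule integrable_measure_pmf_finite)
  have q: "proj_form n l u v v = (\<Sum>(x, y)\<in>?N. G x y * (v x * v y))" for v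
    by (simp add: proj_form_self sum_squared_gram G_def sum.cartesian_product)
  have sum_list: "(\<Sum>i\<leftarrow>Is. \<Sum>\<kappa>\<in>K. h \<kappa> i) = (\<Sum>\<kappa>\<in>K. \<Sum>i\<leftarrow>Is. h \<kappa> i)" for K :: "(nat \<times> nat) set" and h :: "_ \<Rightarrow> nat \<Rightarrow> real"
    by (induction Is) (simp_all add: sum.distrib)
  have "(\<Sum>i\<leftarrow>Is. proj_form n l u (?c i) (?c i))
      - real s * measure_pmf.expectation P (\<lambda>i. proj_form n l u (?c i) (?c i))
    = (\<Sum>(x, y)\<in>?N. G x y * d x y)"
    by (simp add: q split_def sum_list int sum_list_const_mult d_def sum_subtractf right_diff_distrib
        sum_distrib_left mult.left_commute)
  then have "((\<Sum>i\<leftarrow>Is. proj_form n l u (?c i) (?c i))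
      - real s * measure_pmf.expectation P (\<lambda>i. proj_form n l u (?c i) (?c i)))\<^sup>2
    \<le> (\<Sum>(x, y)\<in>?N. (G x y)\<^sup>2) * (\<Sum>(x, y)\<in>?N. (d x y)\<^sup>2)"
    using Cauchy_Schwarz_ineq_sum[of "\<lambda>\<kappa>. G (fst \<kappa>) (snd \<kappa>)" "\<lambda>\<kappa>. d (fst \<kappa>) (snd \<kappa>)" ?N]
    by (simp add: split_def)
  also have "(\<Sum>(x, y)\<in>?N. (G x y)\<^sup>2) = real l"
    using gram_frobenius[OF u] by (simp add: G_def sum.cartesian_product)
  also have "real l * (\<Sum>(x, y)\<in>?N. (d x y)\<^sup>2) \<le> real k * (10 * real s)"
    using dev \<open>l \<le> k\<close> by (intro mult_mono) (auto simp: gram_deviation_def d_def intro!: sum_nonneg)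
  finally show ?thesis
    by (intro real_le_rsqrt) (simp add: mult_ac)
qed

text \<open>Multiplied by \<open>R\<^sup>2\<close>, the probability of \<open>i\<close> becomes the
  squared length of row \<open>i\<close>, which is the square of the factor between the unit column
  and the mixed column.\<close>

lemma sampled_columns_energy:
  fixes b P n
  defines "R \<equiv> fro n n b"
  assumes P: "set_pmf P \<subseteq> {..<n}" "\<And>i. i < n \<Longrightarrow> R\<^sup>2 * pmf P i = (\<Sum>j<n. (b i j)\<^sup>2)"
  shows "R\<^sup>2 * measure_pmf.expectation P (\<lambda>i. proj_form n l u (unit_col n b i) (unit_col n b i))
    = (\<Sum>i<n. proj_form n l u (mixed_col n b i) (mixed_col n b i))"
proof -
  have "R\<^sup>2 * measure_pmf.expectation P (\<lambda>i. proj_form n l u (unit_col n b i) (unit_col n b i))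
    = (\<Sum>i<n. (R\<^sup>2 * pmf P i) * proj_form n l u (unit_col n b i) (unit_col n b i))"
    using P(1) by (subst integral_measure_pmf_real[where A="{..<n}"]) (auto simp: sum_distrib_left mult_ac)
  also have "\<dots> = (\<Sum>i<n. proj_form n l u (mixed_col n b i) (mixed_col n b i))"
  proof (intro sum.cong refl)
    fix i assume "i \<in> {..<n}"
    then have "R\<^sup>2 * pmf P i = (L2_set (b i) {..<n})\<^sup>2"
      using P(2) by (simp add: L2_set_def sum_nonneg)
    then show "(R\<^sup>2 * pmf P i) * proj_form n l u (unit_col n b i) (unit_col n b i)
      = proj_form n l u (mixed_col n b i) (mixed_col n b i)"
      by (simp add: mixed_col_def[abs_def] proj_form_self ip_scale_right power_mult_distrib sum_distrib_left)
  qed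
  finally show ?thesis .
qed

lemma normalized_col_index:
  assumes "x < n"
  shows "normalized_col n b i $ x = unit_col n b i x"
proof -
  have "euclid_norm (list_vec n (\<lambda>x. b x i)) = col_norm n b i"
    using list_vec_carrier[of n "\<lambda>x. b x i"]
    by (auto simp: euclid_norm_def scalar_prod_def list_vec_index col_norm_def L2_set_def
        power2_eq_square atLeast0LessThan)
  then show ?thesis
    using assms list_vec_carrier[of n "\<lambda>x. b x i"] by (simp add: normalized_col_def unit_col_def list_vec_index)
qed

text \<open>Ky Fan's principle compares \<open>u\<close> and \<open>X\<close> on the sample; passing
  to the mean costs one deviation \<open>\<delta>\<close> for each of them. Dividing
  \<open>2 * \<delta>\<close> by \<open>s\<close> gives the square root on the right.\<close>

lemma column_sampling_error:
  fixes b P n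
  defines "R \<equiv> fro n n b"
  assumes P: "set_pmf P \<subseteq> {..<n}" "\<And>i. i < n \<Longrightarrow> R\<^sup>2 * pmf P i = (\<Sum>j<n. (b i j)\<^sup>2)"
    and u: "orthonormal n l u" and "l \<le> k" "1 \<le> k" and s: "length Is = s" "1 \<le> s"
    and X: "top_left_singular_vectors k (mat_of_cols n (map (normalized_col n b) Is)) X"
    and dev: "gram_deviation n b P s Is \<le> 10 * real s"
  shows "(\<Sum>i<n. proj_form n l u (mixed_col n b i) (mixed_col n b i)
      - proj_form n k (\<lambda>a x. X $$ (x, a)) (mixed_col n b i) (mixed_col n b i))
    \<le> 2 * R\<^sup>2 * sqrt (10 * real k / real s)"
proof -
  let ?M = "mat_of_cols n (map (normalized_col n b) Is)" and ?x = "\<lambda>a x. X $$ (x, a)"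
  let ?q = "\<lambda>l u i. proj_form n l u (unit_col n b i) (unit_col n b i)"
  define \<delta> where "\<delta> = sqrt (10 * real k * real s)"
  have fin: "finite (set_pmf P)" using P(1) by (rule finite_subset) simp
  have x: "orthonormal n k ?x" using top_left_singular_vectors_orthonormal[OF X] by simp
  have sum_cols: "(\<Sum>j<length Is. proj_form n l u (\<lambda>x. ?M $$ (x, j)) (\<lambda>x. ?M $$ (x, j))) = (\<Sum>i\<leftarrow>Is. ?q l u i)" for l u
  proof -
    have "ip n v (\<lambda>x. ?M $$ (x, j)) = ip n v (unit_col n b (Is ! j))" if "j < s" for v j
      using that s by (simp add: ip_def mat_of_cols_index normalized_col_index)
    then show ?thesis using s
      by (simp add: proj_form_def sum_list_sum_nth atLeast0LessThan)
  qed
  have "(\<Sum>i\<leftarrow>Is. ?q l u i) \<le> (\<Sum>i\<leftarrow>Is. ?q k ?x i)"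
    using ky_fan[OF X \<open>1 \<le> k\<close> \<open>l \<le> k\<close>, of u] u by (simp add: sum_cols)
  moreover have "\<bar>(\<Sum>i\<leftarrow>Is. ?q l u i) - real s * measure_pmf.expectation P (?q l u)\<bar> \<le> \<delta>"
    unfolding \<delta>_def by (rule sampled_energy[OF fin u \<open>l \<le> k\<close> dev])
  moreover have "\<bar>(\<Sum>i\<leftarrow>Is. ?q k ?x i) - real s * measure_pmf.expectation P (?q k ?x)\<bar> \<le> \<delta>"
    unfolding \<delta>_def by (rule sampled_energy[OF fin x order_refl dev])
  ultimately have "real s * (measure_pmf.expectation P (?q l u) - measure_pmf.expectation P (?q k ?x)) \<le> 2 * \<delta>"
    unfolding right_diff_distrib by linarith
  then have "measure_pmf.expectation P (?q l u) - measure_pmf.expectation P (?q k ?x) \<le> 2 * \<delta> / real s"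
    using s(2) by (simp add: field_simps)
  also have "2 * \<delta> / real s = 2 * sqrt (10 * real k / real s)"
    using s(2) by (simp add: \<delta>_def real_sqrt_mult real_sqrt_divide real_div_sqrt)
      (simp add: field_simps)
  finally have "R\<^sup>2 * (measure_pmf.expectation P (?q l u) - measure_pmf.expectation P (?q k ?x))
    \<le> R\<^sup>2 * (2 * sqrt (10 * real k / real s))" by (rule mult_left_mono) simp
  then show ?thesis
    using sampled_columns_energy[of P n b l u] sampled_columns_energy[of P n b k ?x] P
    by (simp add: R_def right_diff_distrib sum_subtractf mult_ac)
qed

section \<open>Error of row sampling\<close>

lemma euclid_norm_row: "(euclid_norm (row X i))\<^sup>2 = (\<Sum>a<dim_col X. (X $$ (i, a))\<^sup>2)"
  by (simp add: euclid_norm_def scalar_prod_def row_def sum_nonneg power2_eq_square atLeast0LessThan)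

lemma right_factor_carrier: "right_factor n b k t X Js \<in> carrier_mat n k"
  unfolding right_factor_def
  by (intro smult_carrier_mat mult_carrier_mat[where n="length Js"]) (auto simp: mat_of_rows_def)

lemma right_factor_index:
  assumes X: "X \<in> carrier_mat n k" and j: "j < n" and a: "a < k"
  shows "right_factor n b k t X Js $$ (j, a)
    = (\<Sum>i\<leftarrow>Js. b i j * (real k / (euclid_norm (row X i))\<^sup>2 * X $$ (i, a))) / real t"
proof -
  let ?R = "mat_of_rows n (map (\<lambda>i. list_vec n (b i)) Js)"
  let ?Z = "mat_of_rows k (map (\<lambda>i. (1 / ((euclid_norm (row X i))\<^sup>2 / real k)) \<cdot>\<^sub>v row X i) Js)"
  let ?h = "\<lambda>i. b i j * (real k / (euclid_norm (row X i))\<^sup>2 * X $$ (i, a))"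
  have R: "?R \<in> carrier_mat (length Js) n" and Z: "?Z \<in> carrier_mat (length Js) k"
    by (simp_all add: mat_of_rows_def)
  have "(transpose_mat ?R * ?Z) $$ (j, a) = (\<Sum>r<length Js. transpose_mat ?R $$ (j, r) * ?Z $$ (r, a))"
    using R Z j a by (intro mult_mat_entry[where p=k]) auto
  also have "\<dots> = (\<Sum>r<length Js. ?h (Js ! r))"
  proof (intro sum.cong refl)
    fix r assume "r \<in> {..<length Js}"
    then have r: "r < length Js" by simp
    have "transpose_mat ?R $$ (j, r) = b (Js ! r) j"
      using r j R by (simp add: mat_of_rows_index list_vec_index)
    moreover have "?Z $$ (r, a) = real k / (euclid_norm (row X (Js ! r)))\<^sup>2 * X $$ (Js ! r, a)"
      using r a X by (simp add: mat_of_rows_index row_def)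
    ultimately show "transpose_mat ?R $$ (j, r) * ?Z $$ (r, a) = ?h (Js ! r)" by simp
  qed
  also have "\<dots> = (\<Sum>i\<leftarrow>Js. ?h i)" by (simp add: sum_list_sum_nth atLeast0LessThan)
  finally have "(transpose_mat ?R * ?Z) $$ (j, a) = (\<Sum>i\<leftarrow>Js. ?h i)" .
  moreover have "transpose_mat ?R * ?Z \<in> carrier_mat n k" using R Z by auto
  ultimately show ?thesis using j a unfolding right_factor_def by simp
qed

text \<open>Importance sampling: drawing row \<open>i\<close> with probability
  \<open>w i / k\<close> and weighting it by \<open>k / w i\<close> is unbiased. Summed over
  \<open>a\<close>, the second moment contains the squared norm \<open>w i\<close> of a row of
  \<open>X\<close>, which cancels the weight; what remains is at most \<open>k\<close> times the
  squared norm of row \<open>i\<close> of \<open>b\<close>.\<close>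

lemma row_sampling_error:
  assumes X: "X \<in> carrier_mat n k" and orth: "orthonormal n k (\<lambda>a i. X $$ (i, a))" and "1 \<le> k" "1 \<le> t"
  shows "9 / 10 \<le> measure_pmf.prob (replicate_pmf t (row_pmf n k X))
    {Js. (\<Sum>j<n. \<Sum>a<k. (right_factor n b k t X Js $$ (j, a) - ip n (\<lambda>i. X $$ (i, a)) (\<lambda>i. b i j))\<^sup>2)
      \<le> 10 * real k * (fro n n b)\<^sup>2 / real t}"
proof -
  define w where "w i = (\<Sum>a<k. (X $$ (i, a))\<^sup>2)" for i
  define z where "z \<kappa> i = b i (fst \<kappa>) * (real k / w i * X $$ (i, snd \<kappa>))" for \<kappa> :: "nat \<times> nat" and i
  let ?D = "row_pmf n k X" and ?K = "{..<n} \<times> {..<k}"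
  have w: "(euclid_norm (row X i))\<^sup>2 = w i" for i using X by (simp add: euclid_norm_row w_def)
  have "(\<Sum>i<n. w i) = (\<Sum>a<k. ip n (\<lambda>i. X $$ (i, a)) (\<lambda>i. X $$ (i, a)))"
    unfolding w_def ip_self by (rule sum.swap)
  also have "\<dots> = real k" using orthonormal_ip[OF orth] by simp
  finally have wsum: "(\<Sum>i<n. w i / real k) = 1" using \<open>1 \<le> k\<close> by (simp add: sum_divide_distrib[symmetric])
  have wpos: "0 \<le> w i / real k" for i by (simp add: w_def sum_nonneg)
  \<comment> \<open>A row that is never drawn is zero in \<open>X\<close>, so the estimate stays
    unbiased although its weight divides by 0.\<close>
  have w0: "X $$ (i, a) = 0" if "w i = 0" "a < k" for i a
    using that by (simp add: w_def sum_nonneg_eq_0_iff)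
  have D: "pmf ?D i = (if i < n then w i / real k else 0)" for i
    unfolding row_pmf_def w using wpos wsum by (rule pmf_table_pmf)
  have setD: "set_pmf ?D \<subseteq> {..<n}"
    unfolding row_pmf_def w using wpos wsum by (rule set_table_pmf)
  then have fin: "finite (set_pmf ?D)" by (rule finite_subset) simp
  have E: "measure_pmf.expectation ?D f = (\<Sum>i<n. w i / real k * f i)" for f :: "nat \<Rightarrow> real"
    using setD by (subst integral_measure_pmf_real[where A="{..<n}"]) (auto simp: D mult.commute)
  have mean: "measure_pmf.expectation ?D (z (j, a)) = ip n (\<lambda>i. X $$ (i, a)) (\<lambda>i. b i j)" if "a < k" for j a
    unfolding E ip_def
  proof (intro sum.cong refl)
    fix i
    show "w i / real k * z (j, a) i = X $$ (i, a) * b i j"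
      using w0[OF _ that, of i] \<open>1 \<le> k\<close> by (cases "w i = 0") (simp_all add: z_def)
  qed
  have "(\<Sum>\<kappa>\<in>?K. measure_pmf.expectation ?D (\<lambda>i. (z \<kappa> i)\<^sup>2)) = (\<Sum>i<n. \<Sum>\<kappa>\<in>?K. w i / real k * (z \<kappa> i)\<^sup>2)"
    unfolding E by (rule sum.swap)
  also have "\<dots> \<le> (\<Sum>i<n. real k * (\<Sum>j<n. (b i j)\<^sup>2))"
  proof (intro sum_mono)
    fix i
    have "(\<Sum>\<kappa>\<in>?K. w i / real k * (z \<kappa> i)\<^sup>2) = w i / real k * (real k / w i)\<^sup>2 * (\<Sum>\<kappa>\<in>?K. (b i (fst \<kappa>))\<^sup>2 * (X $$ (i, snd \<kappa>))\<^sup>2)"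
    proof -
      have "(z \<kappa> i)\<^sup>2 = (real k / w i)\<^sup>2 * ((b i (fst \<kappa>))\<^sup>2 * (X $$ (i, snd \<kappa>))\<^sup>2)" for \<kappa>
        by (simp add: z_def power_mult_distrib power_divide)
      then show ?thesis by (simp only: sum_distrib_left mult.assoc)
    qed
    also have "(\<Sum>\<kappa>\<in>?K. (b i (fst \<kappa>))\<^sup>2 * (X $$ (i, snd \<kappa>))\<^sup>2) = (\<Sum>j<n. (b i j)\<^sup>2) * w i"
      by (simp add: w_def sum_product sum.cartesian_product split_def)
    \<comment> \<open>Equality holds except for \<open>w i = 0\<close>, where the left side is
      0.\<close>
    also have "w i / real k * (real k / w i)\<^sup>2 * ((\<Sum>j<n. (b i j)\<^sup>2) * w i) \<le> real k * (\<Sum>j<n. (b i j)\<^sup>2)"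
      using \<open>1 \<le> k\<close> by (cases "w i = 0") (simp_all add: power2_eq_square sum_nonneg)
    finally show "(\<Sum>\<kappa>\<in>?K. w i / real k * (z \<kappa> i)\<^sup>2) \<le> real k * (\<Sum>j<n. (b i j)\<^sup>2)" .
  qed
  also have "\<dots> = real k * (fro n n b)\<^sup>2" by (simp add: fro_sq sum_distrib_left)
  finally have "9 / 10 \<le> measure_pmf.prob (replicate_pmf t ?D)
    {Js. (\<Sum>\<kappa>\<in>?K. ((\<Sum>i\<leftarrow>Js. z \<kappa> i) - real t * measure_pmf.expectation ?D (z \<kappa>))\<^sup>2) \<le> 10 * (real t * (real k * (fro n n b)\<^sup>2))}"
    by (rule sample_deviation[OF fin])
  also have "\<dots> \<le> measure_pmf.prob (replicate_pmf t ?D)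
    {Js. (\<Sum>j<n. \<Sum>a<k. (right_factor n b k t X Js $$ (j, a) - ip n (\<lambda>i. X $$ (i, a)) (\<lambda>i. b i j))\<^sup>2)
      \<le> 10 * real k * (fro n n b)\<^sup>2 / real t}"
  proof (intro measure_pmf.finite_measure_mono, intro subsetI, unfold mem_Collect_eq)
    fix Js
    let ?dev = "\<Sum>\<kappa>\<in>?K. ((\<Sum>i\<leftarrow>Js. z \<kappa> i) - real t * measure_pmf.expectation ?D (z \<kappa>))\<^sup>2"
    assume dev: "?dev \<le> 10 * (real t * (real k * (fro n n b)\<^sup>2))"
    have "(\<Sum>j<n. \<Sum>a<k. (right_factor n b k t X Js $$ (j, a) - ip n (\<lambda>i. X $$ (i, a)) (\<lambda>i. b i j))\<^sup>2)
      = (\<Sum>j<n. \<Sum>a<k. ((\<Sum>i\<leftarrow>Js. z (j, a) i) - real t * measure_pmf.expectation ?D (z (j, a)))\<^sup>2 / (real t)\<^sup>2)"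
    proof (intro sum.cong refl)
      fix j a assume "j \<in> {..<n}" "a \<in> {..<k}"
      then have ja: "j < n" "a < k" by auto
      have "right_factor n b k t X Js $$ (j, a) - ip n (\<lambda>i. X $$ (i, a)) (\<lambda>i. b i j)
        = ((\<Sum>i\<leftarrow>Js. z (j, a) i) - real t * measure_pmf.expectation ?D (z (j, a))) / real t"
        using \<open>1 \<le> t\<close> by (simp add: right_factor_index[OF X ja] w z_def mean[OF ja(2)] diff_divide_distrib)
      then show "(right_factor n b k t X Js $$ (j, a) - ip n (\<lambda>i. X $$ (i, a)) (\<lambda>i. b i j))\<^sup>2
        = ((\<Sum>i\<leftarrow>Js. z (j, a) i) - real t * measure_pmf.expectation ?D (z (j, a)))\<^sup>2 / (real t)\<^sup>2"
        by (simp add: power_divide)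
    qed
    also have "\<dots> = ?dev / (real t)\<^sup>2"
      by (simp add: sum.cartesian_product sum_divide_distrib split_def)
    also have "\<dots> \<le> 10 * (real t * (real k * (fro n n b)\<^sup>2)) / (real t)\<^sup>2"
      using dev by (rule divide_right_mono) simp
    also have "\<dots> = 10 * real k * (fro n n b)\<^sup>2 / real t"
      using \<open>1 \<le> t\<close> by (simp add: power2_eq_square)
    finally show "(\<Sum>j<n. \<Sum>a<k. (right_factor n b k t X Js $$ (j, a) - ip n (\<lambda>i. X $$ (i, a)) (\<lambda>i. b i j))\<^sup>2)
      \<le> 10 * real k * (fro n n b)\<^sup>2 / real t" .
  qed simp
  finally show ?thesis .
qed

section \<open>Combination of the errors\<close>

lemma factorization_error:
  assumes A: "A \<in> carrier_mat n m" and X: "X \<in> carrier_mat n k" and Y: "Y \<in> carrier_mat m k"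
    and orth: "orthonormal n k (\<lambda>a i. X $$ (i, a))"
  shows "(frob_norm (A - X * transpose_mat Y))\<^sup>2
    = (frob_norm A)\<^sup>2 - (\<Sum>j<m. proj_form n k (\<lambda>a i. X $$ (i, a)) (\<lambda>i. A $$ (i, j)) (\<lambda>i. A $$ (i, j)))
      + (fro m k (\<lambda>j a. ip n (\<lambda>i. X $$ (i, a)) (\<lambda>i. A $$ (i, j)) - Y $$ (j, a)))\<^sup>2"
proof -
  define Z where "Z = X * transpose_mat Y"
  have Z: "Z \<in> carrier_mat n m" using X Y by (auto simp: Z_def)
  have "Z $$ (i, j) = (\<Sum>a<k. X $$ (i, a) * Y $$ (j, a))" if "i < n" "j < m" for i j
    unfolding Z_def using mult_mat_entry[OF X, of "transpose_mat Y" m i j] Y that by simp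
  then have "(frob_norm (A - X * transpose_mat Y))\<^sup>2
    = (\<Sum>j<m. \<Sum>i<n. (A $$ (i, j) - (\<Sum>a<k. X $$ (i, a) * Y $$ (j, a)))\<^sup>2)"
    unfolding Z_def[symmetric] using A Z by (simp add: frob_norm_sq) (subst sum.swap, auto intro!: sum.cong)
  also have "\<dots> = (\<Sum>j<m. ip n (\<lambda>i. A $$ (i, j)) (\<lambda>i. A $$ (i, j))
      - proj_form n k (\<lambda>a i. X $$ (i, a)) (\<lambda>i. A $$ (i, j)) (\<lambda>i. A $$ (i, j))
      + (\<Sum>a<k. (ip n (\<lambda>i. X $$ (i, a)) (\<lambda>i. A $$ (i, j)) - Y $$ (j, a))\<^sup>2))"
    by (simp add: ip_residual[OF orth])
  finally show ?thesis
    by (simp add: frob_norm_cols[OF A] fro_sq sum.distrib sum_subtractf)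
qed

text \<open>Here \<open>Qu\<close> and \<open>Qx\<close> are the energies of \<open>A\<close>
  captured by the competitor and by \<open>X\<close>, \<open>h\<close> is the column sampling error,
  \<open>e\<close> the relative noise, and \<open>g\<close> the error of \<open>Y\<close> with
  sampling part \<open>f\<close>. In units of \<open>\<alpha>\<^sup>2\<close>, the noise contributes
  \<open>6 * e + 3 * e * e\<close> through \<open>Q\<close>, \<open>e * e\<close> through
  \<open>g\<close>, and \<open>e / 5\<close> through the cross term in the square of
  \<open>g\<close>.\<close>

lemma error_budget:
  fixes \<alpha> L Qu Qx g f e \<epsilon> h :: real
  assumes \<alpha>: "0 \<le> \<alpha>" and e: "0 \<le> e" "e \<le> 1" and \<epsilon>: "0 < \<epsilon>" "\<epsilon> < 1" and "0 \<le> L" "0 \<le> Qx"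
    and L: "\<alpha>\<^sup>2 - Qu \<le> L" and h: "h \<le> \<epsilon> / 2 * \<alpha>\<^sup>2"
    and Q: "Qu - Qx \<le> h + (3 * e * \<alpha>) * ((2 + e) * \<alpha>)"
    and g: "0 \<le> g" "g \<le> e * \<alpha> + f" and f: "0 \<le> f" "f\<^sup>2 \<le> \<epsilon> / 100 * \<alpha>\<^sup>2"
  shows "\<alpha>\<^sup>2 - Qx + g\<^sup>2 \<le> L + (\<epsilon> + 9 * e) * \<alpha>\<^sup>2"
proof -
  \<comment> \<open>Only the cross term needs this weaker bound, which turns a product of noise and
    sampling error into pure noise.\<close>
  have "f\<^sup>2 \<le> (\<alpha> / 10)\<^sup>2"
    using f(2) mult_right_mono[of \<epsilon> 1 "\<alpha>\<^sup>2"] \<epsilon> by (simp add: power_divide)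
  then have f': "f \<le> \<alpha> / 10" by (rule power2_le_imp_le) (use \<alpha> in simp)
  have "g\<^sup>2 \<le> (e * \<alpha> + f)\<^sup>2" using g by (intro power_mono) auto
  also have "\<dots> = e * e * \<alpha>\<^sup>2 + 2 * (e * \<alpha>) * f + f\<^sup>2" by (simp add: power2_eq_square algebra_simps)
  also have "\<dots> \<le> e * e * \<alpha>\<^sup>2 + 2 * (e * \<alpha>) * (\<alpha> / 10) + \<epsilon> / 100 * \<alpha>\<^sup>2"
    using f' f e \<alpha> by (intro add_mono mult_left_mono) auto
  also have "\<dots> = (e * e + e / 5 + \<epsilon> / 100) * \<alpha>\<^sup>2" by (simp add: power2_eq_square algebra_simps)
  finally have g2: "g\<^sup>2 \<le> (e * e + e / 5 + \<epsilon> / 100) * \<alpha>\<^sup>2" .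
  show ?thesis
  proof (cases "e \<le> 1 / 2")
    case True
    \<comment> \<open>This turns \<open>4 * (e * e)\<close> into \<open>2 * e\<close>, so the noise
      terms add up to at most 8.2 times \<open>e\<close>.\<close>
    have ee: "e * e \<le> e / 2" using mult_left_mono[OF True e(1)] by simp
    have "\<alpha>\<^sup>2 - Qx + g\<^sup>2 \<le> L + (\<epsilon> / 2 * \<alpha>\<^sup>2 + (3 * e * \<alpha>) * ((2 + e) * \<alpha>)) + (e * e + e / 5 + \<epsilon> / 100) * \<alpha>\<^sup>2"
      using L h Q g2 by linarith
    also have "\<dots> = L + (\<epsilon> / 2 + \<epsilon> / 100 + 6 * e + 4 * (e * e) + e / 5) * \<alpha>\<^sup>2"
      by (simp add: power2_eq_square algebra_simps)
    also have "\<dots> \<le> L + (\<epsilon> + 9 * e) * \<alpha>\<^sup>2"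
      using ee e \<epsilon> by (intro add_left_mono mult_right_mono) auto
    finally show ?thesis .
  next
    case False
    \<comment> \<open>Dropping \<open>Qx\<close>, what has to be covered is about
      \<open>1 + 1.2 * e\<close>, and for \<open>e\<close> above 1/2 this is below
      \<open>9 * e\<close>.\<close>
    have ee: "e * e \<le> e" using mult_left_mono[OF e(2) e(1)] by simp
    have "\<alpha>\<^sup>2 - Qx + g\<^sup>2 \<le> (1 + e * e + e / 5 + \<epsilon> / 100) * \<alpha>\<^sup>2"
      using g2 \<open>0 \<le> Qx\<close> by (simp add: algebra_simps)
    also have "\<dots> \<le> (\<epsilon> + 9 * e) * \<alpha>\<^sup>2"
      by (intro mult_right_mono) (use ee False \<epsilon> in linarith, simp)
    finally show ?thesis using \<open>0 \<le> L\<close> by simp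
  qed
qed

lemma set_factors_pmf:
  assumes "(X, Y) \<in> set_pmf (factors_pmf n b P lsv k s t)"
  obtains Is where "X = lsv (mat_of_cols n (map (normalized_col n b) Is))" "Y \<in> carrier_mat n k"
  using assms right_factor_carrier by (auto simp: factors_pmf_def Let_def)

lemma factors_pmf_error:
  fixes A L :: "real mat" and b :: "nat \<Rightarrow> nat \<Rightarrow> real"
  assumes A: "A \<in> carrier_mat n n" and sym: "\<And>i j. i < n \<Longrightarrow> j < n \<Longrightarrow> A $$ (i, j) = A $$ (j, i)"
    and L: "L \<in> carrier_mat n n" "vec_space.rank n L \<le> k"
    and diff: "fro n n (\<lambda>i j. b i j - A $$ (j, i)) \<le> e * frob_norm A"
    and e: "0 \<le> e" "e \<le> 1" and \<epsilon>: "0 < \<epsilon>" "\<epsilon> < 1"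
    and P: "set_pmf P \<subseteq> {..<n}" "\<And>i. i < n \<Longrightarrow> (fro n n b)\<^sup>2 * pmf P i = (\<Sum>j<n. (b i j)\<^sup>2)"
    and k: "1 \<le> k" and s: "2560 * real k / \<epsilon>\<^sup>2 \<le> real s" and t: "4000 * real k / \<epsilon> \<le> real t"
    and lsv: "\<And>M. dim_row M = n \<Longrightarrow> top_left_singular_vectors k M (lsv M)"
  shows "2 / 3 \<le> measure_pmf.prob (factors_pmf n b P lsv k s t)
    {(X, Y). (frob_norm (A - X * transpose_mat Y))\<^sup>2
      \<le> (frob_norm (A - L))\<^sup>2 + (\<epsilon> + 9 * e) * (frob_norm A)\<^sup>2}"
proof -
  define \<alpha> where "\<alpha> = frob_norm A"
  \<comment> \<open>\<open>a j\<close> is column \<open>j\<close> of \<open>A\<close>, in the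
    column-first indexing of \<open>mixed_col\<close>.\<close>
  define a where "a j i = A $$ (i, j)" for i j
  define R where "R = fro n n b"
  have \<alpha>0: "0 \<le> \<alpha>" by (simp add: \<alpha>_def frob_norm_def sum_nonneg)
  have "0 < 2560 * real k / \<epsilon>\<^sup>2" "0 < 4000 * real k / \<epsilon>" using k \<epsilon> by simp_all
  then have spos: "0 < real s" and tpos: "0 < real t" using s t by linarith+
  have fro_a: "fro n n a = \<alpha>"
    by (rule power2_eq_imp_eq[OF _ fro_nonneg \<alpha>0])
      (simp only: \<alpha>_def frob_norm_cols[OF A] fro_sq_ip a_def[abs_def])
  have diff': "fro n n (\<lambda>i j. b i j - a i j) \<le> e * \<alpha>" using diff by (simp add: a_def \<alpha>_def)
  have R: "R \<le> (1 + e) * \<alpha>"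
    using fro_le_fro_diff[of n n b a] diff' by (simp add: R_def fro_a algebra_simps)
  also have "\<dots> \<le> 2 * \<alpha>" using e \<alpha>0 by (intro mult_right_mono) auto
  finally have "R\<^sup>2 \<le> (2 * \<alpha>)\<^sup>2" by (intro power_mono) (simp_all add: R_def)
  then have R2: "R\<^sup>2 \<le> 4 * \<alpha>\<^sup>2" by (simp add: power_mult_distrib)
  have mixed: "fro n n (\<lambda>j i. a j i - mixed_col n b j i) \<le> 3 * e * \<alpha>"
    using mixed_col_diff_le[of n a b] sym diff' by (subst fro_minus_commute) (simp add: a_def)
  have mixed': "fro n n (\<lambda>j i. a j i + mixed_col n b j i) \<le> (2 + e) * \<alpha>"
    using fro_triangle[of n n a "mixed_col n b"] fro_mixed_col_le[of n b] R
    by (simp add: fro_a R_def algebra_simps)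
  obtain l u where l: "l \<le> k" and u: "orthonormal n l u"
    and "(frob_norm A)\<^sup>2 - (\<Sum>j<n. proj_form n l u (\<lambda>i. A $$ (i, j)) (\<lambda>i. A $$ (i, j))) \<le> (frob_norm (A - L))\<^sup>2"
    using low_rank_residual[OF A L] by blast
  then have opt: "\<alpha>\<^sup>2 - (\<Sum>j<n. proj_form n l u (a j) (a j)) \<le> (frob_norm (A - L))\<^sup>2"
    by (simp add: \<alpha>_def a_def[abs_def])
  have h: "2 * R\<^sup>2 * sqrt (10 * real k / real s) \<le> \<epsilon> / 2 * \<alpha>\<^sup>2"
  proof -
    \<comment> \<open>Origin of 2560 = 10 * 16 * 16: together with
      \<open>R\<^sup>2 \<le> 4 * \<alpha>\<^sup>2\<close>, the value \<open>\<epsilon> / 16\<close>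
      for the root leaves half of the allowed \<open>\<epsilon>\<close>.\<close>
    have "10 * real k / real s \<le> (\<epsilon> / 16)\<^sup>2"
      using s spos \<epsilon> by (simp add: field_simps power2_eq_square)
    then have "sqrt (10 * real k / real s) \<le> \<epsilon> / 16"
      using \<epsilon> by (intro real_le_lsqrt) auto
    then have "2 * R\<^sup>2 * sqrt (10 * real k / real s) \<le> 2 * (4 * \<alpha>\<^sup>2) * (\<epsilon> / 16)"
      using R2 by (intro mult_mono) auto
    then show ?thesis by simp
  qed
  define f where "f = sqrt (10 * real k * R\<^sup>2 / real t)"
  have f: "0 \<le> f" "f\<^sup>2 \<le> \<epsilon> / 100 * \<alpha>\<^sup>2"
  proof -
    have "f\<^sup>2 = 10 * real k / real t * R\<^sup>2" by (simp add: f_def)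
    \<comment> \<open>Origin of 4000 = 10 * 400: the factor 4 from \<open>R2\<close> reduces 1/400
      to the required 1/100.\<close>
    also have "\<dots> \<le> \<epsilon> / 400 * (4 * \<alpha>\<^sup>2)"
      using R2 t tpos \<epsilon> by (intro mult_mono) (auto simp: field_simps)
    finally show "f\<^sup>2 \<le> \<epsilon> / 100 * \<alpha>\<^sup>2" by simp
  qed (simp add: f_def)
  let ?good = "{(X, Y). (frob_norm (A - X * transpose_mat Y))\<^sup>2
      \<le> (frob_norm (A - L))\<^sup>2 + (\<epsilon> + 9 * e) * (frob_norm A)\<^sup>2}"
  have "9 / 10 * (9 / 10) \<le> measure_pmf.prob (factors_pmf n b P lsv k s t) ?good"
    unfolding factors_pmf_def
  proof (rule prob_bind_ge)
    show "9 / 10 \<le> measure_pmf.prob (replicate_pmf s P) {Is. gram_deviation n b P s Is \<le> 10 * real s}"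
      using P(1) by (intro prob_gram_deviation) (rule finite_subset, auto)
  next
    fix Is
    assume "Is \<in> set_pmf (replicate_pmf s P)" and "Is \<in> {Is. gram_deviation n b P s Is \<le> 10 * real s}"
    then have len: "length Is = s" and dev: "gram_deviation n b P s Is \<le> 10 * real s"
      by (auto simp: set_replicate_pmf)
    define X where "X = lsv (mat_of_cols n (map (normalized_col n b) Is))"
    have sv: "top_left_singular_vectors k (mat_of_cols n (map (normalized_col n b) Is)) X"
      unfolding X_def by (intro lsv) simp
    let ?x = "\<lambda>a i. X $$ (i, a)"
    have X: "X \<in> carrier_mat n k" using top_left_singular_vectors_carrier[OF sv] by simp
    have x: "orthonormal n k ?x" using top_left_singular_vectors_orthonormal[OF sv] by simp
    have "(\<Sum>i<n. proj_form n l u (mixed_col n b i) (mixed_col n b i) - proj_form n k ?x (mixed_col n b i) (mixed_col n b i))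
      \<le> 2 * R\<^sup>2 * sqrt (10 * real k / real s)"
      unfolding R_def using P spos by (intro column_sampling_error[OF _ _ u l k len _ sv dev]) auto
    then have "(\<Sum>j<n. proj_form n l u (a j) (a j) - proj_form n k ?x (a j) (a j))
      \<le> 2 * R\<^sup>2 * sqrt (10 * real k / real s)
        + fro n n (\<lambda>j i. a j i - mixed_col n b j i) * fro n n (\<lambda>j i. a j i + mixed_col n b j i)"
      using proj_form_perturbation[OF u x, where m=n and v=a and w="mixed_col n b"] by linarith
    also have "\<dots> \<le> 2 * R\<^sup>2 * sqrt (10 * real k / real s) + (3 * e * \<alpha>) * ((2 + e) * \<alpha>)"
      using mixed mixed' e \<alpha>0 by (intro add_left_mono mult_mono) auto
    finally have Q: "(\<Sum>j<n. proj_form n l u (a j) (a j)) - (\<Sum>j<n. proj_form n k ?x (a j) (a j))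
      \<le> 2 * R\<^sup>2 * sqrt (10 * real k / real s) + (3 * e * \<alpha>) * ((2 + e) * \<alpha>)"
      by (simp add: sum_subtractf)
    \<comment> \<open>By Bessel's inequality in each column, projecting the noise onto the columns
      of \<open>X\<close> does not increase its Frobenius norm.\<close>
    have ab: "fro n k (\<lambda>j c. ip n (?x c) (\<lambda>i. a j i - b i j)) \<le> e * \<alpha>"
    proof -
      have "fro n k (\<lambda>j c. ip n (?x c) (\<lambda>i. a j i - b i j)) \<le> fro n n (\<lambda>j i. a j i - b i j)"
      proof (rule power2_le_imp_le)
        show "(fro n k (\<lambda>j c. ip n (?x c) (\<lambda>i. a j i - b i j)))\<^sup>2 \<le> (fro n n (\<lambda>j i. a j i - b i j))\<^sup>2"
          unfolding fro_sq_ip[of n n] unfolding fro_sq proj_form_self[symmetric]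
          by (intro sum_mono bessel[OF x])
      qed simp
      also have "\<dots> = fro n n (\<lambda>j i. a i j - b i j)"
        using sym by (intro fro_cong) (simp add: a_def)
      also have "\<dots> = fro n n (\<lambda>i j. b i j - a i j)"
        by (subst fro_minus_commute) (rule fro_swap)
      finally show ?thesis using diff' by simp
    qed
    have good: "(X, right_factor n b k t X Js) \<in> ?good"
      if Js: "(\<Sum>j<n. \<Sum>c<k. (right_factor n b k t X Js $$ (j, c) - ip n (?x c) (\<lambda>i. b i j))\<^sup>2)
        \<le> 10 * real k * (fro n n b)\<^sup>2 / real t" for Js
    proof -
      let ?Y = "right_factor n b k t X Js"
      have "(fro n k (\<lambda>j c. ip n (?x c) (\<lambda>i. b i j) - ?Y $$ (j, c)))\<^sup>2 \<le> 10 * real k * R\<^sup>2 / real t"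
        unfolding R_def using Js by (subst fro_minus_commute) (simp add: fro_sq)
      then have "fro n k (\<lambda>j c. ip n (?x c) (\<lambda>i. b i j) - ?Y $$ (j, c)) \<le> f"
        unfolding f_def by (rule real_le_rsqrt)
      moreover have "fro n k (\<lambda>j c. ip n (?x c) (a j) - ?Y $$ (j, c))
        \<le> fro n k (\<lambda>j c. ip n (?x c) (\<lambda>i. a j i - b i j)) + fro n k (\<lambda>j c. ip n (?x c) (\<lambda>i. b i j) - ?Y $$ (j, c))"
        using fro_triangle[of n k "\<lambda>j c. ip n (?x c) (\<lambda>i. a j i - b i j)" "\<lambda>j c. ip n (?x c) (\<lambda>i. b i j) - ?Y $$ (j, c)"]
        by (simp add: ip_diff_right)
      ultimately have g: "fro n k (\<lambda>j c. ip n (?x c) (a j) - ?Y $$ (j, c)) \<le> e * \<alpha> + f"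
        using ab by linarith
      have "\<alpha>\<^sup>2 - (\<Sum>j<n. proj_form n k ?x (a j) (a j)) + (fro n k (\<lambda>j c. ip n (?x c) (a j) - ?Y $$ (j, c)))\<^sup>2
        \<le> (frob_norm (A - L))\<^sup>2 + (\<epsilon> + 9 * e) * \<alpha>\<^sup>2"
        by (rule error_budget[OF \<alpha>0 e \<epsilon> _ _ opt h Q _ g f]) (simp_all add: sum_nonneg proj_form_self_nonneg)
      then show ?thesis
        using factorization_error[where Y="right_factor n b k t X Js", OF A X right_factor_carrier x] by (simp add: \<alpha>_def a_def[abs_def])
    qed
    have "9 / 10 \<le> measure_pmf.prob (replicate_pmf t (row_pmf n k X))
      {Js. (\<Sum>j<n. \<Sum>c<k. (right_factor n b k t X Js $$ (j, c) - ip n (?x c) (\<lambda>i. b i j))\<^sup>2)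
        \<le> 10 * real k * (fro n n b)\<^sup>2 / real t}"
      using tpos by (intro row_sampling_error X x k) simp
    also have "\<dots> \<le> measure_pmf.prob (replicate_pmf t (row_pmf n k X)) ((\<lambda>Js. (X, right_factor n b k t X Js)) -` ?good)"
      using good by (intro measure_pmf.finite_measure_mono) auto
    finally show "9 / 10 \<le> measure_pmf.prob (let X = lsv (mat_of_cols n (map (normalized_col n b) Is))
      in map_pmf (\<lambda>Js. (X, right_factor n b k t X Js)) (replicate_pmf t (row_pmf n k X))) ?good"
      by (simp only: Let_def X_def[symmetric] measure_map_pmf)
  qed simp
  then show ?thesis by simp
qed


section \<open>Clipping\<close>

lemma abs_clip_le: "0 \<le> a \<Longrightarrow> \<bar>clip x a\<bar> \<le> a"
  by (auto simp: clip_def)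

lemma clip_id: "\<bar>x\<bar> \<le> a \<Longrightarrow> clip x a = x"
  by (auto simp: clip_def)

lemma clip_dist_le: "\<bar>y\<bar> \<le> a \<Longrightarrow> \<bar>clip x a - y\<bar> \<le> \<bar>x - y\<bar>"
  by (auto simp: clip_def)

section \<open>Entries of positive semidefinite matrices\<close>

lemma psd_mat_sym:
  assumes "psd_mat A" "A \<in> carrier_mat n n" "i < n" "j < n"
  shows "A $$ (i, j) = A $$ (j, i)"
proof -
  have "transpose_mat A $$ (i, j) = A $$ (i, j)" using assms(1) by (simp add: psd_mat_def)
  then show ?thesis using assms by simp
qed

lemma psd_mat_quadratic:
  assumes psd: "psd_mat A" and A: "A \<in> carrier_mat n n" and ij: "i < n" "j < n"
  shows "0 \<le> c\<^sup>2 * A $$ (i, i) + 2 * c * d * A $$ (i, j) + d\<^sup>2 * A $$ (j, j)"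
proof -
  \<comment> \<open>A sum of two indicators instead of a case distinction, so that
    \<open>i = j\<close> is covered and also yields the diagonal entries.\<close>
  define x where "x p = c * (if p = i then 1 else 0) + d * (if p = j then 1 else 0)" for p :: nat
  have sum_x: "(\<Sum>p<n. x p * h p) = c * h i + d * h j" for h :: "nat \<Rightarrow> real"
  proof -
    have "(\<Sum>p<n. x p * h p) = (\<Sum>p<n. if p = i then c * h i else 0) + (\<Sum>p<n. if p = j then d * h j else 0)"
      unfolding sum.distrib[symmetric] by (intro sum.cong) (auto simp: x_def algebra_simps)
    then show ?thesis using ij by simp
  qed
  have "0 \<le> scalar_prod (vec n x) (A *\<^sub>v vec n x)"
    using psd A by (auto simp: psd_mat_def)
  also have "\<dots> = (\<Sum>p<n. x p * (\<Sum>q<n. x q * A $$ (p, q)))"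
    using A by (auto simp: scalar_prod_def atLeast0LessThan mult.commute intro!: sum.cong)
  also have "\<dots> = c\<^sup>2 * A $$ (i, i) + 2 * c * d * A $$ (i, j) + d\<^sup>2 * A $$ (j, j)"
    unfolding sum_x psd_mat_sym[OF psd A ij(2,1)] by (simp add: algebra_simps power2_eq_square)
  finally show ?thesis .
qed

lemma psd_mat_diag_nonneg:
  "psd_mat A \<Longrightarrow> A \<in> carrier_mat n n \<Longrightarrow> i < n \<Longrightarrow> 0 \<le> A $$ (i, i)"
  using psd_mat_quadratic[of A n i i 1 0] by simp

lemma psd_mat_entry_bound:
  assumes "psd_mat A" "A \<in> carrier_mat n n" "i < n" "j < n"
  shows "(A $$ (i, j))\<^sup>2 \<le> A $$ (i, i) * A $$ (j, j)"
proof (rule quadratic_bound)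
  fix c
  show "2 * c * A $$ (i, j) \<le> c\<^sup>2 * A $$ (i, i) + A $$ (j, j)"
    using psd_mat_quadratic[OF assms, of c "-1"] by simp
qed (use assms psd_mat_diag_nonneg in blast)

section \<open>The clipping threshold and the clipped matrix\<close>

lemma phi_max_ge_1: "1 \<le> phi_max A B"
  by (simp add: phi_max_def)

text \<open>If the diagonal entry of \<open>B\<close> is 0, its quotient contributes 0 to
  \<open>phi_max\<close> and says nothing about \<open>A\<close>; the second hypothesis settles this
  case.\<close>

lemma diag_le_phi_max:
  assumes "i < dim_row A" "B $$ (i, i) = 0 \<longrightarrow> A $$ (i, i) = 0"
  shows "A $$ (i, i) \<le> phi_max A B * \<bar>B $$ (i, i)\<bar>"
proof (cases "B $$ (i, i) = 0")
  case False
  have "A $$ (i, i) / \<bar>B $$ (i, i)\<bar> \<le> (MAX i\<in>{..<dim_row A}. A $$ (i, i) / \<bar>B $$ (i, i)\<bar>)"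
    using assms(1) by (intro Max_ge) auto
  then have "A $$ (i, i) / \<bar>B $$ (i, i)\<bar> \<le> phi_max A B" by (simp add: phi_max_def)
  then show ?thesis using False by (simp add: field_simps)
qed (use assms in simp)

text \<open>A total function of the indices, since the lemmas about programs describe
  \<open>entry\<close> at all indices and not only at those in range.\<close>

definition clipped :: "real \<Rightarrow> real mat \<Rightarrow> nat \<Rightarrow> nat \<Rightarrow> real" where
  "clipped \<phi> B i j = clip (B $$ (i, j)) (\<phi> * sqrt (\<bar>B $$ (i, i)\<bar> * \<bar>B $$ (j, j)\<bar>))"

lemma clipped_entry_clipped: "clipped_entry (query B) \<phi> i j = return_spmf (clipped \<phi> B i j, 3, 8)"
  by (simp add: clipped_entry_def clipped_def query_def charge_def bind_prog_def)

lemma clipped_diag: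
  assumes "1 \<le> \<phi>"
  shows "clipped \<phi> B i i = B $$ (i, i)"
  using mult_right_mono[OF assms, of "\<bar>B $$ (i, i)\<bar>"] by (simp add: clipped_def clip_id)

text \<open>Because \<open>\<phi>\<close> is at least 1, clipping leaves the diagonal unchanged. So
  the threshold can be expressed by the clipped diagonal, and the quotient used by the sampler is at
  most 1.\<close>

lemma clipped_sq_le:
  assumes "1 \<le> \<phi>"
  shows "(clipped \<phi> B i j)\<^sup>2 \<le> \<phi>\<^sup>2 * (\<bar>clipped \<phi> B i i\<bar> * \<bar>clipped \<phi> B j j\<bar>)"
proof -
  have "\<bar>clipped \<phi> B i j\<bar> \<le> \<phi> * sqrt (\<bar>B $$ (i, i)\<bar> * \<bar>B $$ (j, j)\<bar>)"
    using assms unfolding clipped_def by (intro abs_clip_le) simp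
  then have "\<bar>clipped \<phi> B i j\<bar>\<^sup>2 \<le> (\<phi> * sqrt (\<bar>B $$ (i, i)\<bar> * \<bar>B $$ (j, j)\<bar>))\<^sup>2"
    by (rule power_mono) simp
  then show ?thesis using assms by (simp add: clipped_diag power_mult_distrib)
qed

text \<open>An entry of \<open>A\<close> is bounded by the geometric mean of two diagonal entries,
  hence by \<open>\<phi>\<close> times that of \<open>B\<close>, so it lies in the clipping
  interval. The transposed index of \<open>A\<close>, harmless by symmetry, is the column-first form
  of the error analysis.\<close>

lemma clipped_diff_le:
  assumes A: "A \<in> carrier_mat n n" "psd_mat A" and N: "N \<in> carrier_mat n n"
    and \<eta>: "(frob_norm N)\<^sup>2 \<le> \<eta> * (frob_norm A)\<^sup>2" "0 \<le> \<eta>"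
    and zero: "\<forall>i<n. (A + N) $$ (i, i) = 0 \<longrightarrow> A $$ (i, i) = 0"
  shows "fro n n (\<lambda>i j. clipped (phi_max A (A + N)) (A + N) i j - A $$ (j, i)) \<le> sqrt \<eta> * frob_norm A"
proof -
  let ?B = "A + N"
  define \<phi> where "\<phi> = phi_max A ?B"
  have entry: "\<bar>clipped \<phi> ?B i j - A $$ (j, i)\<bar> \<le> \<bar>N $$ (i, j)\<bar>" if ij: "i < n" "j < n" for i j
  proof -
    have diag: "A $$ (i, i) \<le> \<phi> * \<bar>?B $$ (i, i)\<bar>" if "i < n" for i
      unfolding \<phi>_def using A that zero by (intro diag_le_phi_max) auto
    have "(A $$ (i, j))\<^sup>2 \<le> A $$ (i, i) * A $$ (j, j)" by (rule psd_mat_entry_bound[OF A(2,1) ij])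
    also have "\<dots> \<le> (\<phi> * \<bar>?B $$ (i, i)\<bar>) * (\<phi> * \<bar>?B $$ (j, j)\<bar>)"
      using diag ij psd_mat_diag_nonneg[OF A(2,1)] phi_max_ge_1[of A ?B]
      by (intro mult_mono) (auto simp: \<phi>_def)
    also have "\<dots> = (\<phi> * sqrt (\<bar>?B $$ (i, i)\<bar> * \<bar>?B $$ (j, j)\<bar>))\<^sup>2"
      by (simp add: power_mult_distrib power2_eq_square[of \<phi>])
    finally have "\<bar>A $$ (i, j)\<bar>\<^sup>2 \<le> (\<phi> * sqrt (\<bar>?B $$ (i, i)\<bar> * \<bar>?B $$ (j, j)\<bar>))\<^sup>2" by simp
    then have "\<bar>A $$ (i, j)\<bar> \<le> \<phi> * sqrt (\<bar>?B $$ (i, i)\<bar> * \<bar>?B $$ (j, j)\<bar>)"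
      using phi_max_ge_1[of A ?B] by - (rule power2_le_imp_le, auto simp: \<phi>_def)
    then have "\<bar>clipped \<phi> ?B i j - A $$ (i, j)\<bar> \<le> \<bar>?B $$ (i, j) - A $$ (i, j)\<bar>"
      unfolding clipped_def by (rule clip_dist_le)
    then show ?thesis using A N ij psd_mat_sym[OF A(2,1) ij] by simp
  qed
  have "(fro n n (\<lambda>i j. clipped \<phi> ?B i j - A $$ (j, i)))\<^sup>2 \<le> (\<Sum>i<n. \<Sum>j<n. (N $$ (i, j))\<^sup>2)"
    unfolding fro_sq by (intro sum_mono abs_le_square_iff[THEN iffD1] entry) auto
  also have "\<dots> \<le> (sqrt \<eta> * frob_norm A)\<^sup>2"
    using \<eta> N by (auto simp: frob_norm_sq power_mult_distrib)
  finally have "fro n n (\<lambda>i j. clipped \<phi> ?B i j - A $$ (j, i)) \<le> sqrt \<eta> * frob_norm A"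
    by (rule power2_le_imp_le) (simp add: \<eta> frob_norm_def sum_nonneg)
  then show ?thesis by (simp add: \<phi>_def)
qed


section \<open>Cost bounds\<close>

text \<open>The smallest dimension is \<open>k\<close>, so the blocks have side \<open>k\<close>.
  Rounding up at most doubles \<open>n / k\<close> and \<open>t / k\<close>, whence the factor 4;
  \<open>2 \<le> \<omega>\<close> lets the cost of one block product absorb the
  \<open>k\<^sup>2\<close> for accumulating it.\<close>

lemma rect_mult_ops_le:
  assumes k: "1 \<le> k" "k \<le> n" "k \<le> t" and "0 \<le> c" and mm: "real (mm_ops k) \<le> c * real k powr \<omega>" and \<omega>: "2 \<le> \<omega>"
  shows "real (rect_mult_ops mm_ops n t k) \<le> 4 * (c + 1) * (real n * real t * real k powr (\<omega> - 2))"
proof -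
  have m: "min n (min t k) = k" using k by simp
  have blocks: "real (nat \<lceil>real x / real k\<rceil>) \<le> 2 * real x / real k" if "k \<le> x" for x
  proof -
    have "1 \<le> real x / real k" using that k by simp
    then have "real (nat \<lceil>real x / real k\<rceil>) \<le> real x / real k + real x / real k" by linarith
    also have "\<dots> = 2 * real x / real k" by (simp add: field_simps)
    finally show ?thesis .
  qed
  have "(real k)\<^sup>2 = real k powr 2" using k by (simp add: powr_numeral)
  also have "\<dots> \<le> real k powr \<omega>" using k \<omega> by (intro powr_mono) auto
  finally have cost: "real (mm_ops k) + (real k)\<^sup>2 \<le> (c + 1) * real k powr \<omega>"
    using mm by (simp add: algebra_simps)
  have "real (rect_mult_ops mm_ops n t k)
    = real (nat \<lceil>real n / real k\<rceil>) * real (nat \<lceil>real t / real k\<rceil>) * (real (mm_ops k) + (real k)\<^sup>2)"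
    using k by (simp add: rect_mult_ops_def m Let_def)
  also have "\<dots> \<le> (2 * real n / real k) * (2 * real t / real k) * ((c + 1) * real k powr \<omega>)"
    using k by (intro mult_mono blocks cost mult_nonneg_nonneg of_nat_0_le_iff) auto
  also have "real k powr \<omega> = real k powr (\<omega> - 2) * (real k)\<^sup>2"
    using k by (simp add: powr_diff powr_numeral)
  also have "(2 * real n / real k) * (2 * real t / real k) * ((c + 1) * (real k powr (\<omega> - 2) * (real k)\<^sup>2))
    = 4 * (c + 1) * (real n * real t * real k powr (\<omega> - 2))"
    using k by (simp add: power2_eq_square)
  finally show ?thesis .
qed

text \<open>As \<open>y\<close> is at least 1, rounding up only adds 1 to the constant.\<close>

lemma nat_ceiling_bounds:
  assumes "0 \<le> x" "1 \<le> y" "x \<le> c * y"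
  shows "x \<le> real (nat \<lceil>x\<rceil>)" and "real (nat \<lceil>x\<rceil>) \<le> (c + 1) * y"
  using assms by (auto simp: algebra_simps) linarith+

lemma query_budget:
  fixes n s t p \<kappa> c d :: real
  assumes "0 \<le> n" "0 \<le> \<kappa>" "1 \<le> p" "s \<le> c * \<kappa>" "t \<le> d * \<kappa>" "0 \<le> c" "0 \<le> d"
  shows "s * (6 * (p * n)) + (s * (3 * n) + t * (3 * n)) \<le> (9 * c + 3 * d) * (p * n * \<kappa>)"
proof -
  have np: "n \<le> p * n" using assms mult_right_mono[of 1 p n] by simp
  have s: "s * (p * n) \<le> c * (p * n * \<kappa>)" and t: "t * (p * n) \<le> d * (p * n * \<kappa>)"
    using mult_right_mono[OF \<open>s \<le> c * \<kappa>\<close>, of "p * n"] mult_right_mono[OF \<open>t \<le> d * \<kappa>\<close>, of "p * n"] assms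
    by (simp_all add: mult_ac)
  have "s * n \<le> c * (p * n * \<kappa>)"
  proof -
    have "s * n \<le> c * \<kappa> * n" using assms by (intro mult_right_mono) auto
    also have "\<dots> \<le> c * \<kappa> * (p * n)" using np assms by (intro mult_left_mono) auto
    finally show ?thesis by (simp add: mult_ac)
  qed
  moreover have "t * n \<le> d * (p * n * \<kappa>)"
  proof -
    have "t * n \<le> d * \<kappa> * n" using assms by (intro mult_right_mono) auto
    also have "\<dots> \<le> d * \<kappa> * (p * n)" using np assms by (intro mult_left_mono) auto
    finally show ?thesis by (simp add: mult_ac)
  qed
  ultimately show ?thesis using s by (simp add: distrib_right)
qed

text \<open>The constants collect coefficients: 43 = 32 + 8 + 3 from the terms with
  \<open>s\<close>, 12 = 1 + 8 + 3 from those with \<open>t\<close>, and 11 = 7 + 2 + 1 + 1 from the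
  rest. The singular vectors and the matrix product are the terms charged to
  \<open>W\<close>.\<close>

lemma operation_budget:
  fixes n k s t p \<kappa> c d v r W :: real
  assumes "1 \<le> n" "1 \<le> k" "k \<le> n" "k \<le> \<kappa>" "1 \<le> p" "0 \<le> s" "0 \<le> t" "s \<le> c * \<kappa>" "t \<le> d * \<kappa>" "0 \<le> c" "0 \<le> d"
    and "v \<le> cv * W" "r \<le> cr * W"
  shows "7 + (s * (32 * (p * n)) + (s * (n * 8 + 3 * n) + (v + (2 * n * k + (n + (t + (t * (n * 8)
      + (t * (3 * k) + (r + n * k)))))))))
    \<le> (11 + 43 * c + 12 * d) * (p * n * \<kappa>) + (cv + cr) * W"
proof -
  let ?Z = "p * n * \<kappa>"
  have "1 \<le> \<kappa>" using assms by simp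
  have np: "n \<le> p * n" using assms mult_right_mono[of 1 p n] by simp
  have nk: "n * \<kappa> \<le> ?Z" using mult_right_mono[OF np, of \<kappa>] \<open>1 \<le> \<kappa>\<close> by simp
  have n1: "n \<le> n * \<kappa>" using assms \<open>1 \<le> \<kappa>\<close> by simp
  have 1: "s * (p * n) \<le> c * ?Z"
    using mult_right_mono[OF \<open>s \<le> c * \<kappa>\<close>, of "p * n"] assms by (simp add: mult_ac)
  have 2: "s * n \<le> c * ?Z"
    using mult_left_mono[OF np, of s] assms 1 by linarith
  have 3: "t * n \<le> d * ?Z"
  proof -
    have "t * n \<le> t * (p * n)" using np assms by (intro mult_left_mono) auto
    also have "\<dots> \<le> d * ?Z"
      using mult_right_mono[OF \<open>t \<le> d * \<kappa>\<close>, of "p * n"] assms by (simp add: mult_ac)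
    finally show ?thesis .
  qed
  have 4: "t * k \<le> t * n" "t \<le> t * n" using assms mult_left_mono[of 1 n t] by (auto intro: mult_left_mono)
  have 5: "n * k \<le> ?Z" using mult_left_mono[OF \<open>k \<le> \<kappa>\<close>, of n] assms nk by linarith
  have 6: "n \<le> ?Z" "1 \<le> ?Z" using n1 nk assms by linarith+
  show ?thesis using 1 2 3 4 5 6 assms(12,13) by (simp add: algebra_simps)
qed

text \<open>This fits the product that forms \<open>Y\<close> into the cost of the singular vectors:
  both \<open>k / \<epsilon>\<close> and \<open>k\<close> are at most
  \<open>k / \<epsilon>\<^sup>2\<close>, and the exponents 1 and \<open>\<omega> - 2\<close> add up
  to \<open>\<omega> - 1\<close>.\<close>

lemma powr_budget:
  assumes "1 \<le> k" "0 < \<epsilon>" "\<epsilon> < 1" "2 \<le> \<omega>"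
  shows "real k / \<epsilon> * real k powr (\<omega> - 2) \<le> (real k / \<epsilon>\<^sup>2) powr (\<omega> - 1)"
proof -
  let ?\<kappa> = "real k / \<epsilon>\<^sup>2"
  have "\<epsilon>\<^sup>2 \<le> \<epsilon>" "\<epsilon>\<^sup>2 \<le> 1" using assms by (auto simp: power2_eq_square mult_le_one)
  then have le: "real k / \<epsilon> \<le> ?\<kappa>" "real k \<le> ?\<kappa>"
    using assms divide_left_mono[of "\<epsilon>\<^sup>2" \<epsilon> "real k"] divide_left_mono[of "\<epsilon>\<^sup>2" 1 "real k"] by auto
  have "0 < ?\<kappa>" using assms by simp
  have "real k / \<epsilon> * real k powr (\<omega> - 2) \<le> ?\<kappa> * ?\<kappa> powr (\<omega> - 2)"
    using le assms by (intro mult_mono powr_mono2) auto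
  also have "\<dots> = ?\<kappa> powr (1 + (\<omega> - 2))"
    using \<open>0 < ?\<kappa>\<close> by (subst powr_add) simp
  finally show ?thesis by (simp add: add.commute)
qed

section \<open>Correctness and cost of the robust algorithm\<close>

context
  fixes A N B :: "real mat" and n k :: nat and \<epsilon> \<eta> :: real
  assumes A: "A \<in> carrier_mat n n" "psd_mat A" and N: "N \<in> carrier_mat n n" and B: "B = A + N"
    and \<eta>: "0 \<le> \<eta>" "\<eta> \<le> 1" "(frob_norm N)\<^sup>2 \<le> \<eta> * (frob_norm A)\<^sup>2"
    and zero: "\<forall>i<n. B $$ (i, i) = 0 \<longrightarrow> A $$ (i, i) = 0"
    and k: "1 \<le> k" "k \<le> n" and \<epsilon>: "0 < \<epsilon>" "\<epsilon> < 1"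
begin

lemma robust_sampler:
  shows "\<exists>P. result (robust_sample (clipped_entry (query B) (phi_max A B)) (phi_max A B) n) = spmf_of_pmf P \<and>
      set_pmf P \<subseteq> {..<n} \<and>
      (\<forall>i<n. (fro n n (clipped (phi_max A B) B))\<^sup>2 * pmf P i = (\<Sum>j<n. (clipped (phi_max A B) B i j)\<^sup>2))"
    and "ecost u v (robust_sample (clipped_entry (query B) (phi_max A B)) (phi_max A B) n)
      \<le> ennreal ((6 * real u + 32 * real v) * ((phi_max A B)\<^sup>2 * real n))"
  unfolding fro_sq
  using robust_sample_correct[where entry="clipped_entry (query B) (phi_max A B)" and b="clipped (phi_max A B) B",
      OF clipped_entry_clipped clipped_sq_le[OF phi_max_ge_1] phi_max_ge_1] k
  by simp_all

lemma robust_low_rank_approx_correct: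
  fixes svd svd_ops mm_ops C C'
  defines "res \<equiv> robust_low_rank_approx (query B) (phi_max A B) svd svd_ops mm_ops C C' n k \<epsilon>"
  assumes svd: "\<forall>k M. 1 \<le> k \<and> k \<le> dim_row M \<longrightarrow> top_left_singular_vectors k M (svd k M)"
    and C: "2560 \<le> C" "4000 \<le> C'"
  shows "lossless_spmf res"
    and "\<forall>((X, Y), _) \<in> set_spmf res. X \<in> carrier_mat n k \<and> Y \<in> carrier_mat n k"
    and "best_rank_approx k A Ak \<Longrightarrow> 2 / 3 \<le> measure (measure_spmf res)
      {((X, Y), _). (frob_norm (A - X * transpose_mat Y))\<^sup>2
        \<le> (frob_norm (A - Ak))\<^sup>2 + (\<epsilon> + 9 * sqrt \<eta>) * (frob_norm A)\<^sup>2}"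
proof -
  define b where "b = clipped (phi_max A B) B"
  define s where "s = nat \<lceil>C * real k / \<epsilon>\<^sup>2\<rceil>"
  define t where "t = nat \<lceil>C' * real k / \<epsilon>\<rceil>"
  have sv: "top_left_singular_vectors k M (svd k M)" if "dim_row M = n" for M
    using svd k that by simp
  obtain P where res_P: "result (robust_sample (clipped_entry (query B) (phi_max A B)) (phi_max A B) n) = spmf_of_pmf P"
    and P: "set_pmf P \<subseteq> {..<n}" "\<And>i. i < n \<Longrightarrow> (fro n n b)\<^sup>2 * pmf P i = (\<Sum>j<n. (b i j)\<^sup>2)"
    using robust_sampler(1) unfolding b_def by blast
  have result: "result res = spmf_of_pmf (factors_pmf n b P (svd k) k s t)"
    unfolding res_def robust_low_rank_approx_def s_def t_def b_def
    by (rule result_low_rank_approx[OF clipped_entry_clipped res_P])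
  have "lossless_spmf (result res)" by (simp add: result)
  then show "lossless_spmf res" by (simp add: result_def)
  show "\<forall>((X, Y), _) \<in> set_spmf res. X \<in> carrier_mat n k \<and> Y \<in> carrier_mat n k"
  proof (intro ballI, clarify)
    fix X Y q a assume "((X, Y), q, a) \<in> set_spmf res"
    then have "(X, Y) \<in> set_pmf (factors_pmf n b P (svd k) k s t)"
      using in_set_result[of _ res] by (fastforce simp: result)
    then obtain Is where X: "X = svd k (mat_of_cols n (map (normalized_col n b) Is))" and Y: "Y \<in> carrier_mat n k"
      by (rule set_factors_pmf)
    show "X \<in> carrier_mat n k \<and> Y \<in> carrier_mat n k"
      using top_left_singular_vectors_carrier[OF sv[of "mat_of_cols n (map (normalized_col n b) Is)"]] X Y by simp
  qed
  assume best: "best_rank_approx k A Ak"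
  let ?good = "{(X, Y). (frob_norm (A - X * transpose_mat Y))\<^sup>2
        \<le> (frob_norm (A - Ak))\<^sup>2 + (\<epsilon> + 9 * sqrt \<eta>) * (frob_norm A)\<^sup>2}"
  have "2 / 3 \<le> measure_pmf.prob (factors_pmf n b P (svd k) k s t) ?good"
  proof (rule factors_pmf_error[OF A(1) psd_mat_sym[OF A(2,1)] _ _ _ _ _ \<epsilon> P k(1) _ _ sv])
    show "Ak \<in> carrier_mat n n" "vec_space.rank n Ak \<le> k"
      using best A(1) by (auto simp: best_rank_approx_def)
    show "fro n n (\<lambda>i j. b i j - A $$ (j, i)) \<le> sqrt \<eta> * frob_norm A"
      unfolding b_def B using \<eta> zero by (intro clipped_diff_le A N) (auto simp: B)
    have "2560 * real k / \<epsilon>\<^sup>2 \<le> C * real k / \<epsilon>\<^sup>2" "4000 * real k / \<epsilon> \<le> C' * real k / \<epsilon>"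
      using C \<epsilon> by (auto intro!: divide_right_mono mult_right_mono)
    then show "2560 * real k / \<epsilon>\<^sup>2 \<le> real s" "4000 * real k / \<epsilon> \<le> real t"
      unfolding s_def t_def by linarith+
  qed (use \<eta> in auto)
  also have "\<dots> = measure (measure_spmf (result res)) ?good" by (simp add: result)
  also have "\<dots> = measure (measure_spmf res) (fst -` ?good)" unfolding result_def by (rule measure_map_spmf)
  also have "fst -` ?good = {((X, Y), _). (frob_norm (A - X * transpose_mat Y))\<^sup>2
        \<le> (frob_norm (A - Ak))\<^sup>2 + (\<epsilon> + 9 * sqrt \<eta>) * (frob_norm A)\<^sup>2}"
    by auto
  finally show "2 / 3 \<le> measure (measure_spmf res)
      {((X, Y), _). (frob_norm (A - X * transpose_mat Y))\<^sup>2
        \<le> (frob_norm (A - Ak))\<^sup>2 + (\<epsilon> + 9 * sqrt \<eta>) * (frob_norm A)\<^sup>2}" .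
qed

text \<open>\<open>K\<close> depends on \<open>C\<close>, \<open>C'\<close>, \<open>\<omega>\<close>
  and the two cost constants alone, as the order of quantifiers in the theorem demands. The maxima
  with 0 are taken because these constants come without a sign.\<close>

lemma robust_low_rank_approx_cost:
  fixes svd mm_ops C C' \<omega> K\<^sub>s\<^sub>v\<^sub>d K\<^sub>m\<^sub>m and svd_ops :: "nat \<Rightarrow> nat \<Rightarrow> nat"
  defines "res \<equiv> robust_low_rank_approx (query B) (phi_max A B) svd svd_ops mm_ops C C' n k \<epsilon>"
    and "K \<equiv> 11 + 43 * (C + 1) + 12 * (C' + 1) + (max K\<^sub>s\<^sub>v\<^sub>d 0 * (C + 1) powr (\<omega> - 1)
      + 4 * (max K\<^sub>m\<^sub>m 0 + 1) * (C' + 1))"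
  assumes svd_ops: "\<forall>n s. 1 \<le> n \<and> 1 \<le> s \<longrightarrow> real (svd_ops n s) \<le> K\<^sub>s\<^sub>v\<^sub>d * real n * real s powr (\<omega> - 1)"
    and mm_ops: "\<forall>m \<ge> 1. real (mm_ops m) \<le> K\<^sub>m\<^sub>m * real m powr \<omega>" and \<omega>: "2 \<le> \<omega>"
    and C: "1 \<le> C" "1 \<le> C'"
  shows "expected_queries res \<le> ennreal (K * ((phi_max A B)\<^sup>2 * real n * real k / \<epsilon>\<^sup>2))"
    and "expected_ops res \<le> ennreal (K * (real n * (real k / \<epsilon>\<^sup>2) powr (\<omega> - 1)
              + (phi_max A B)\<^sup>2 * real n * real k / \<epsilon>\<^sup>2))"
proof -
  define s where "s = nat \<lceil>C * real k / \<epsilon>\<^sup>2\<rceil>"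
  define t where "t = nat \<lceil>C' * real k / \<epsilon>\<rceil>"
  define p where "p = (phi_max A B)\<^sup>2"
  define \<kappa> where "\<kappa> = real k / \<epsilon>\<^sup>2"
  define W where "W = real n * \<kappa> powr (\<omega> - 1)"
  have p: "1 \<le> p" using phi_max_ge_1[of A B] by (simp add: p_def)
  have "\<epsilon>\<^sup>2 \<le> \<epsilon>" "\<epsilon>\<^sup>2 \<le> 1" using \<epsilon> by (auto simp: power2_eq_square mult_le_one)
  then have k\<epsilon>: "real k / \<epsilon> \<le> \<kappa>" "real k \<le> \<kappa>" "real k \<le> real k / \<epsilon>"
    using \<epsilon> divide_left_mono[of "\<epsilon>\<^sup>2" \<epsilon> "real k"] divide_left_mono[of "\<epsilon>\<^sup>2" 1 "real k"]
      divide_left_mono[of \<epsilon> 1 "real k"] by (auto simp: \<kappa>_def)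
  have k1: "1 \<le> real k" using k by simp
  have s: "C * \<kappa> \<le> real s" "real s \<le> (C + 1) * \<kappa>"
    using nat_ceiling_bounds[of "C * \<kappa>" \<kappa> C] C k1 k\<epsilon> by (simp_all add: s_def \<kappa>_def)
  have t: "C' * (real k / \<epsilon>) \<le> real t" "real t \<le> (C' + 1) * (real k / \<epsilon>)"
  proof -
    have "t = nat \<lceil>C' * (real k / \<epsilon>)\<rceil>" by (simp add: t_def)
    then show "C' * (real k / \<epsilon>) \<le> real t" "real t \<le> (C' + 1) * (real k / \<epsilon>)"
      using nat_ceiling_bounds[of "C' * (real k / \<epsilon>)" "real k / \<epsilon>" C'] C k1 k\<epsilon> \<epsilon>
      by (simp_all only: mult_nonneg_nonneg order_refl)
  qed
  have t': "real t \<le> (C' + 1) * \<kappa>"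
    using t(2) mult_left_mono[OF k\<epsilon>(1), of "C' + 1"] C by simp
  have "1 \<le> C * \<kappa>" using mult_mono[of 1 C 1 \<kappa>] C k1 k\<epsilon> by simp
  then have s1: "1 \<le> s" using s(1) by linarith
  have "real k \<le> C' * (real k / \<epsilon>)"
    using mult_mono[of 1 C' "real k" "real k / \<epsilon>"] C k\<epsilon> k1 by simp
  \<comment> \<open>Together with \<open>k \<le> n\<close> this makes \<open>k\<close> the block
    side of the product that forms \<open>Y\<close>.\<close>
  then have kt: "k \<le> t" using t(1) by linarith
  have svd_le: "real (svd_ops n s) \<le> (max K\<^sub>s\<^sub>v\<^sub>d 0 * (C + 1) powr (\<omega> - 1)) * W"
  proof -
    have "real (svd_ops n s) \<le> K\<^sub>s\<^sub>v\<^sub>d * real n * real s powr (\<omega> - 1)" using svd_ops k s1 by simp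
    also have "\<dots> \<le> max K\<^sub>s\<^sub>v\<^sub>d 0 * real n * ((C + 1) * \<kappa>) powr (\<omega> - 1)"
      using s \<omega> by (intro mult_mono powr_mono2) auto
    also have "\<dots> = (max K\<^sub>s\<^sub>v\<^sub>d 0 * (C + 1) powr (\<omega> - 1)) * W"
      using C k1 k\<epsilon> by (simp add: W_def powr_mult)
    finally show ?thesis .
  qed
  have rect_le: "real (rect_mult_ops mm_ops n t k) \<le> (4 * (max K\<^sub>m\<^sub>m 0 + 1) * (C' + 1)) * W"
  proof -
    have "real (mm_ops k) \<le> K\<^sub>m\<^sub>m * real k powr \<omega>" using mm_ops k by simp
    also have "\<dots> \<le> max K\<^sub>m\<^sub>m 0 * real k powr \<omega>" by (intro mult_right_mono) auto
    finally have mm: "real (mm_ops k) \<le> max K\<^sub>m\<^sub>m 0 * real k powr \<omega>" .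
    have "real t * real k powr (\<omega> - 2) \<le> (C' + 1) * (real k / \<epsilon>) * real k powr (\<omega> - 2)"
      using t(2) by (intro mult_right_mono) auto
    also have "\<dots> \<le> (C' + 1) * \<kappa> powr (\<omega> - 1)"
      unfolding \<kappa>_def mult.assoc using powr_budget[OF k(1) \<epsilon> \<omega>] C by (intro mult_left_mono) auto
    finally have "real n * (real t * real k powr (\<omega> - 2)) \<le> real n * ((C' + 1) * \<kappa> powr (\<omega> - 1))"
      by (rule mult_left_mono) simp
    then have "4 * (max K\<^sub>m\<^sub>m 0 + 1) * (real n * real t * real k powr (\<omega> - 2))
      \<le> 4 * (max K\<^sub>m\<^sub>m 0 + 1) * (real n * ((C' + 1) * \<kappa> powr (\<omega> - 1)))"
      by (intro mult_left_mono) (auto simp: mult.assoc)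
    then show ?thesis using rect_mult_ops_le[where mm_ops=mm_ops and c="max K\<^sub>m\<^sub>m 0", OF k kt _ mm \<omega>] by (simp add: W_def mult_ac)
  qed
  obtain P where res_P: "result (robust_sample (clipped_entry (query B) (phi_max A B)) (phi_max A B) n) = spmf_of_pmf P"
    using robust_sampler(1) by blast
  note ecost = ecost_low_rank_approx[where entry="clipped_entry (query B) (phi_max A B)"
      and sampler="robust_sample (clipped_entry (query B) (phi_max A B)) (phi_max A B) n",
      OF clipped_entry_clipped res_P robust_sampler(2), where C=C and C'=C' and n=n and k=k and \<epsilon>=\<epsilon> and svd=svd
      and svd_ops=svd_ops and mm_ops=mm_ops, folded s_def t_def robust_low_rank_approx_def res_def p_def]
  have Z: "p * real n * real k / \<epsilon>\<^sup>2 = p * real n * \<kappa>" by (simp add: \<kappa>_def)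
  have Z0: "0 \<le> p * real n * \<kappa>" and W0: "0 \<le> W" using p k\<epsilon> k1 by (auto simp: W_def)
  define D where "D = max K\<^sub>s\<^sub>v\<^sub>d 0 * (C + 1) powr (\<omega> - 1) + 4 * (max K\<^sub>m\<^sub>m 0 + 1) * (C' + 1)"
  have D0: "0 \<le> D" using C by (simp add: D_def)
  have K: "K = 11 + 43 * (C + 1) + 12 * (C' + 1) + D" by (simp only: K_def D_def)
  have "expected_queries res \<le> ennreal (real s * (6 * (p * real n)) + (real s * (3 * real n) + real t * (3 * real n)))"
    unfolding expected_queries_ecost using ecost[of 1 0] p by (simp add: mult_ac)
  also have "\<dots> \<le> ennreal (K * (p * real n * \<kappa>))"
  proof (rule ennreal_leI)
    have "real s * (6 * (p * real n)) + (real s * (3 * real n) + real t * (3 * real n))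
      \<le> (9 * (C + 1) + 3 * (C' + 1)) * (p * real n * \<kappa>)"
      using p s t' k\<epsilon> k1 C by (intro query_budget) auto
    also have "\<dots> \<le> K * (p * real n * \<kappa>)"
    proof (rule mult_right_mono[OF _ Z0])
      show "9 * (C + 1) + 3 * (C' + 1) \<le> K" unfolding K using D0 C by (simp add: algebra_simps)
    qed
    finally show "real s * (6 * (p * real n)) + (real s * (3 * real n) + real t * (3 * real n))
      \<le> K * (p * real n * \<kappa>)" .
  qed
  finally show "expected_queries res \<le> ennreal (K * ((phi_max A B)\<^sup>2 * real n * real k / \<epsilon>\<^sup>2))"
    by (simp only: p_def[symmetric] Z)
  have "expected_ops res \<le> ennreal (7 + (real s * (32 * (p * real n)) + (real s * (real n * 8 + 3 * real n)
    + (real (svd_ops n s) + (2 * real n * real k + (real n + (real t + (real t * (real n * 8)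
      + (real t * (3 * real k) + (real (rect_mult_ops mm_ops n t k) + real n * real k))))))))))"
    unfolding expected_ops_ecost using ecost[of 0 1] p by simp
  also have "\<dots> \<le> ennreal (K * (W + p * real n * \<kappa>))"
  proof (rule ennreal_leI)
    have "7 + (real s * (32 * (p * real n)) + (real s * (real n * 8 + 3 * real n)
      + (real (svd_ops n s) + (2 * real n * real k + (real n + (real t + (real t * (real n * 8)
        + (real t * (3 * real k) + (real (rect_mult_ops mm_ops n t k) + real n * real k)))))))))
      \<le> (11 + 43 * (C + 1) + 12 * (C' + 1)) * (p * real n * \<kappa>) + D * W"
      unfolding D_def using k p k\<epsilon> s t' C svd_le rect_le by (intro operation_budget) auto
    also have "\<dots> \<le> K * (p * real n * \<kappa>) + K * W"
      unfolding K using D0 C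
      by (intro add_mono[OF mult_right_mono[OF _ Z0] mult_right_mono[OF _ W0]]) (simp_all add: algebra_simps)
    finally show "7 + (real s * (32 * (p * real n)) + (real s * (real n * 8 + 3 * real n)
      + (real (svd_ops n s) + (2 * real n * real k + (real n + (real t + (real t * (real n * 8)
        + (real t * (3 * real k) + (real (rect_mult_ops mm_ops n t k) + real n * real k)))))))))
      \<le> K * (W + p * real n * \<kappa>)" by (simp add: algebra_simps)
  qed
  finally show "expected_ops res \<le> ennreal (K * (real n * (real k / \<epsilon>\<^sup>2) powr (\<omega> - 1)
              + (phi_max A B)\<^sup>2 * real n * real k / \<epsilon>\<^sup>2))"
    by (simp only: p_def[symmetric] Z W_def \<kappa>_def[symmetric])
qed

end

theorem theorem16:
  shows "\<exists>C\<^sub>0 > 0. \<exists>C\<^sub>0' > 0. \<forall>C \<ge> C\<^sub>0. \<forall>C' \<ge> C\<^sub>0'. \<forall>(\<omega>::real) K\<^sub>s\<^sub>v\<^sub>d K\<^sub>m\<^sub>m. 2 \<le> \<omega> \<longrightarrow>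
    (\<exists>K > 0. \<forall>svd svd_ops mm_ops.
      (\<forall>k M. 1 \<le> k \<and> k \<le> dim_row M \<longrightarrow> top_left_singular_vectors k M (svd k M)) \<longrightarrow>
      (\<forall>n s. 1 \<le> n \<and> 1 \<le> s \<longrightarrow> real (svd_ops n s) \<le> K\<^sub>s\<^sub>v\<^sub>d * real n * real s powr (\<omega> - 1)) \<longrightarrow>
      (\<forall>m \<ge> 1. real (mm_ops m) \<le> K\<^sub>m\<^sub>m * real m powr \<omega>) \<longrightarrow>
      (\<forall>n k \<epsilon> \<eta> A N B.
        A \<in> carrier_mat n n \<longrightarrow> psd_mat A \<longrightarrow> N \<in> carrier_mat n n \<longrightarrow> B = A + N \<longrightarrow>
        0 \<le> \<eta> \<longrightarrow> \<eta> \<le> 1 \<longrightarrow> (frob_norm N)\<^sup>2 \<le> \<eta> * (frob_norm A)\<^sup>2 \<longrightarrow>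
        (\<forall>i < n. B $$ (i, i) = 0 \<longrightarrow> A $$ (i, i) = 0) \<longrightarrow>
        1 \<le> k \<longrightarrow> k \<le> n \<longrightarrow> 0 < \<epsilon> \<longrightarrow> \<epsilon> < 1 \<longrightarrow>
        (let \<phi> = phi_max A B;
             res = robust_low_rank_approx (query B) \<phi> svd svd_ops mm_ops C C' n k \<epsilon>
         in lossless_spmf res \<and>
            (\<forall>((X, Y), _) \<in> set_spmf res. X \<in> carrier_mat n k \<and> Y \<in> carrier_mat n k) \<and>
            (\<forall>Ak. best_rank_approx k A Ak \<longrightarrow>
              measure (measure_spmf res)
                {((X, Y), _). (frob_norm (A - X * transpose_mat Y))\<^sup>2
                   \<le> (frob_norm (A - Ak))\<^sup>2 + (\<epsilon> + 9 * sqrt \<eta>) * (frob_norm A)\<^sup>2} \<ge> 2 / 3) \<and>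
            expected_queries res \<le> ennreal (K * (\<phi>\<^sup>2 * real n * real k / \<epsilon>\<^sup>2)) \<and>
            expected_ops res \<le> ennreal (K * (real n * (real k / \<epsilon>\<^sup>2) powr (\<omega> - 1)
              + \<phi>\<^sup>2 * real n * real k / \<epsilon>\<^sup>2)))))"
proof (rule exI[of _ 2560], rule conjI, simp, rule exI[of _ 4000], rule conjI, simp, intro allI impI, goal_cases)
  case (1 C C' \<omega> K\<^sub>s\<^sub>v\<^sub>d K\<^sub>m\<^sub>m)
  define K where "K = 11 + 43 * (C + 1) + 12 * (C' + 1) + (max K\<^sub>s\<^sub>v\<^sub>d 0 * (C + 1) powr (\<omega> - 1)
      + 4 * (max K\<^sub>m\<^sub>m 0 + 1) * (C' + 1))"
  have C: "2560 \<le> C" "4000 \<le> C'" "1 \<le> C" "1 \<le> C'" and \<omega>: "2 \<le> \<omega>" using 1 by auto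
  have "0 < K" unfolding K_def using C by (intro add_pos_nonneg add_nonneg_nonneg mult_nonneg_nonneg) auto
  then show ?case
  proof (intro exI[of _ K] conjI allI impI, goal_cases)
    case (2 svd svd_ops mm_ops n k \<epsilon> \<eta> A N B)
    show ?case
      unfolding Let_def K_def
      by (intro conjI allI impI
          robust_low_rank_approx_correct[OF 2(5-16) 2(2) C(1,2)]
          robust_low_rank_approx_cost[OF 2(5-16) 2(3,4) \<omega> C(3,4)])
  qed
qed

end
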